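(* Let $M$ be a monoid. For any $(A,\eta)\in can\text{-}\mathcal{S}\mathrm{mod}_M$, the fibres $D_1^{-1}(A,\eta)$ and $d_1^{-1}(A,\eta)$ of the functors $D_1\colon\mathrm{XSExt}_M\to can\text{-}\mathcal{S}\mathrm{mod}_M$ and $d_1\colon com\text{-}\mathrm{XSExt}_M\to can\text{-}\mathcal{S}\mathrm{mod}_M$ admit a natural structure of symmetric monoidal category.
   Context: Monoids are written additively with neutral element $0$ and are not assumed commutative. $\mathbf{Mon}$ is the category of monoids (its regular epimorphisms are the surjective homomorphisms). Given a functor $F\colon\mathcal{U}\to\mathcal{V}$ and an object $V$ of $\mathcal{V}$, the fibre $F^{-1}(V)$ is the category of objects of $\mathcal{U}$ sent to $V$ and arrows sent to $1_V$. A Schreier extension is a short exact sequence $K\xrightarrow{k}X\xrightarrow{f}M$ in $\mathbf{Mon}$ ($k$ is a kernel of $f$ and $f$ is a cokernel of $k$) such that for every $m\in M$ there is $u_m\in f^{-1}(m)$, called a representative of $m$, such that every $x\in f^{-1}(m)$ can be written as $x=k(a)+u_m$ for a unique $a\in K$. A morphism of Schreier extensions is a commutative diagram of homomorphisms between two such sequences whose middle component sends representatives to representatives. A crossed semimodule is a pair $(\delta\colon B\to C,\alpha)$ where $\delta$ is a homomorphism of monoids and $\alpha\colon C\to\mathrm{End}(B)$ is a monoid homomorphism (write $c\ast b=\alpha(c)(b)$) with $\delta(c\ast b)+c=c+\delta(b)$ and $\delta(b_1)\ast b_2+b_1=b_1+b_2$ for all $b,b_1,b_2\in B$, $c\in C$.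 A morphism $(\delta,\alpha)\to(\delta',\alpha')$ is a pair of homomorphisms $\varphi\colon B\to B'$, $\psi\colon C\to C'$ with $\delta'\varphi=\psi\delta$ and $\varphi(\alpha(c)(b))=\alpha'(\psi(c))(\varphi(b))$. A sequence $A\xrightarrow{k}B\xrightarrow{\delta}C\xrightarrow{\pi}M$ with $(\delta,\alpha)$ a crossed semimodule, $k$ a kernel and $\pi$ a cokernel of $\delta$, is a crossed Schreier extension if, for the (regular epimorphism, monomorphism) factorisation $\delta=\nu\rho$, $\rho\colon B\to N$, $\nu\colon N\to C$: ($\mathbf{CS}_r$) $N$ is right cancellative and $N\xrightarrow{\nu}C\xrightarrow{\pi}M$ is a Schreier extension; ($\mathbf{CS}_l$) $A$ is right cancellative and $A\xrightarrow{k}B\xrightarrow{\rho}N$ is a Schreier extension. Then $A$ is commutative and cancellative, $\alpha$ restricts to an action of $C$ on $A$, and there is a well-defined induced action $\beta\colon M\to\mathrm{End}(A)$, $\beta(m)(a)=\alpha(c)(a)$ for any $c\in C$ with $\pi(c)=m$. $\mathrm{XSExt}_M$ is the category of crossed Schreier extensions ending in $M$; a morphism is a morphism of crossed semimodules $(\varphi,\psi)$ with $\pi'\psi=\pi$ such that, with $\varphi^\star\colon A\to A'$ and $\psi^\star\colon N\to N'$ the induced maps, $(\varphi^\star,\varphi,\psi^\star)$ and $(\psi^\star,\psi,1_M)$ are morphisms of Schreier extensions between, respectively, $A\to B\to N$ and $A'\to B'\to N'$, and $N\to C\to M$ and $N'\to C'\to M$. $com\text{-}\mathrm{XSExt}_M$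 is the full subcategory on the objects with $B$ commutative. $can\text{-}\mathcal{S}\mathrm{mod}_M$ is the category of cancellative $M$-semimodules: pairs $(A,\beta)$ with $A$ a commutative cancellative monoid and $\beta\colon M\to\mathrm{End}(A)$ a monoid homomorphism, with action-preserving monoid homomorphisms. $D_1$ sends a crossed Schreier extension to $(A,\beta)$, where $\beta$ is the induced action, and a morphism $(\varphi,\psi)$ to $\varphi^\star$; $d_1$ is its restriction to $com\text{-}\mathrm{XSExt}_M$. *)

theory Defs
  imports "HOL-Algebra.Group"
begin

section \<open>Categories, functors, fibres\<close>

record ('o, 'a) cat =
  Ob :: "'o set"
  Ar :: "'a set"
  Dom :: "'a \<Rightarrow> 'o"
  Cod :: "'a \<Rightarrow> 'o"
  Idn :: "'o \<Rightarrow> 'a"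
  Comp :: "'a \<Rightarrow> 'a \<Rightarrow> 'a"  (infixl "\<cdot>\<index>" 70)

definition in_hom :: "('o, 'a) cat \<Rightarrow> 'a \<Rightarrow> 'o \<Rightarrow> 'o \<Rightarrow> bool" where
  "in_hom C f X Y \<longleftrightarrow> f \<in> Ar C \<and> Dom C f = X \<and> Cod C f = Y"

locale category =
  fixes C :: "('o, 'a) cat" (structure)
  assumes dom_in: "f \<in> Ar C \<Longrightarrow> Dom C f \<in> Ob C"
    and cod_in: "f \<in> Ar C \<Longrightarrow> Cod C f \<in> Ob C"
    and idn_hom: "X \<in> Ob C \<Longrightarrow> in_hom C (Idn C X) X X"
    and comp_hom: "in_hom C f X Y \<Longrightarrow> in_hom C g Y Z \<Longrightarrow> in_hom C (g \<cdot> f) X Z"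
    and comp_idn: "in_hom C f X Y \<Longrightarrow> f \<cdot> Idn C X = f"
    and idn_comp: "in_hom C f X Y \<Longrightarrow> Idn C Y \<cdot> f = f"
    and comp_assoc: "in_hom C f X Y \<Longrightarrow> in_hom C g Y Z \<Longrightarrow> in_hom C h Z W \<Longrightarrow>
      h \<cdot> (g \<cdot> f) = (h \<cdot> g) \<cdot> f"

definition is_iso :: "('o, 'a) cat \<Rightarrow> 'a \<Rightarrow> 'o \<Rightarrow> 'o \<Rightarrow> bool" where
  "is_iso C f X Y \<longleftrightarrow> in_hom C f X Y \<and>
     (\<exists>g. in_hom C g Y X \<and> g \<cdot>\<^bsub>C\<^esub> f = Idn C X \<and> f \<cdot>\<^bsub>C\<^esub> g = Idn C Y)"

definition full_subcat :: "('o, 'a) cat \<Rightarrow> ('o \<Rightarrow> bool) \<Rightarrow> ('o, 'a) cat" where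
  "full_subcat C P = C\<lparr>Ob := {X \<in> Ob C. P X},
                       Ar := {f \<in> Ar C. P (Dom C f) \<and> P (Cod C f)}\<rparr>"

record ('o, 'a, 'p, 'b) cfunctor =
  Src :: "('o, 'a) cat"
  Tgt :: "('p, 'b) cat"
  FOb :: "'o \<Rightarrow> 'p"
  FAr :: "'a \<Rightarrow> 'b"

definition fibre :: "('o, 'a, 'p, 'b) cfunctor \<Rightarrow> 'p \<Rightarrow> ('o, 'a) cat" where
  "fibre F V = (Src F)\<lparr>Ob := {X \<in> Ob (Src F). FOb F X = V},
                       Ar := {f \<in> Ar (Src F). FOb F (Dom (Src F) f) = V \<and>
                               FOb F (Cod (Src F) f) = V \<and> FAr F f = Idn (Tgt F) V}\<rparr>"

definition is_product :: "('o, 'a) cat \<Rightarrow> 'o \<Rightarrow> 'a \<Rightarrow> 'a \<Rightarrow> 'o \<Rightarrow> 'o \<Rightarrow> bool" where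
  "is_product C P p1 p2 X Y \<longleftrightarrow> P \<in> Ob C \<and> in_hom C p1 P X \<and> in_hom C p2 P Y \<and>
     (\<forall>T x y. in_hom C x T X \<and> in_hom C y T Y \<longrightarrow>
        (\<exists>!h. in_hom C h T P \<and> p1 \<cdot>\<^bsub>C\<^esub> h = x \<and> p2 \<cdot>\<^bsub>C\<^esub> h = y))"

definition is_terminal :: "('o, 'a) cat \<Rightarrow> 'o \<Rightarrow> bool" where
  "is_terminal C Z \<longleftrightarrow> Z \<in> Ob C \<and> (\<forall>T \<in> Ob C. \<exists>!t. in_hom C t T Z)"

definition is_opcartesian :: "('o, 'a, 'p, 'b) cfunctor \<Rightarrow> 'a \<Rightarrow> bool" where
  "is_opcartesian F q \<longleftrightarrow> (let U = Src F; V = Tgt F in q \<in> Ar U \<and>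
     (\<forall>g w. g \<in> Ar U \<and> Dom U g = Dom U q \<and>
        in_hom V w (FOb F (Cod U q)) (FOb F (Cod U g)) \<and> FAr F g = w \<cdot>\<^bsub>V\<^esub> FAr F q \<longrightarrow>
        (\<exists>!h. in_hom U h (Cod U q) (Cod U g) \<and> FAr F h = w \<and> h \<cdot>\<^bsub>U\<^esub> q = g)))"


section \<open>Symmetric monoidal categories\<close>

record ('o, 'a) monoidal_data =
  tob :: "'o \<Rightarrow> 'o \<Rightarrow> 'o"
  tar :: "'a \<Rightarrow> 'a \<Rightarrow> 'a"
  unt :: 'o
  asc :: "'o \<Rightarrow> 'o \<Rightarrow> 'o \<Rightarrow> 'a"
  lun :: "'o \<Rightarrow> 'a"
  run :: "'o \<Rightarrow> 'a"
  swp :: "'o \<Rightarrow> 'o \<Rightarrow> 'a"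

locale symmetric_monoidal_category = category C
  for C :: "('o, 'a) cat" (structure) +
  fixes S :: "('o, 'a) monoidal_data"
  assumes unt_in: "unt S \<in> Ob C"
    and tob_in: "X \<in> Ob C \<Longrightarrow> Y \<in> Ob C \<Longrightarrow> tob S X Y \<in> Ob C"
    and tar_hom: "in_hom C f X X' \<Longrightarrow> in_hom C g Y Y' \<Longrightarrow>
      in_hom C (tar S f g) (tob S X Y) (tob S X' Y')"
    and tar_idn: "X \<in> Ob C \<Longrightarrow> Y \<in> Ob C \<Longrightarrow>
      tar S (Idn C X) (Idn C Y) = Idn C (tob S X Y)"
    and tar_comp: "in_hom C f X X' \<Longrightarrow> in_hom C f' X' X'' \<Longrightarrow>
      in_hom C g Y Y' \<Longrightarrow> in_hom C g' Y' Y'' \<Longrightarrow>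
      tar S (f' \<cdot> f) (g' \<cdot> g) = tar S f' g' \<cdot> tar S f g"
    and asc_iso: "X \<in> Ob C \<Longrightarrow> Y \<in> Ob C \<Longrightarrow> Z \<in> Ob C \<Longrightarrow>
      is_iso C (asc S X Y Z) (tob S (tob S X Y) Z) (tob S X (tob S Y Z))"
    and asc_nat: "in_hom C f X X' \<Longrightarrow> in_hom C g Y Y' \<Longrightarrow> in_hom C h Z Z' \<Longrightarrow>
      asc S X' Y' Z' \<cdot> tar S (tar S f g) h = tar S f (tar S g h) \<cdot> asc S X Y Z"
    and lun_iso: "X \<in> Ob C \<Longrightarrow> is_iso C (lun S X) (tob S (unt S) X) X"
    and lun_nat: "in_hom C f X X' \<Longrightarrow>
      lun S X' \<cdot> tar S (Idn C (unt S)) f = f \<cdot> lun S X"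
    and run_iso: "X \<in> Ob C \<Longrightarrow> is_iso C (run S X) (tob S X (unt S)) X"
    and run_nat: "in_hom C f X X' \<Longrightarrow>
      run S X' \<cdot> tar S f (Idn C (unt S)) = f \<cdot> run S X"
    and swp_iso: "X \<in> Ob C \<Longrightarrow> Y \<in> Ob C \<Longrightarrow> is_iso C (swp S X Y) (tob S X Y) (tob S Y X)"
    and swp_nat: "in_hom C f X X' \<Longrightarrow> in_hom C g Y Y' \<Longrightarrow>
      swp S X' Y' \<cdot> tar S f g = tar S g f \<cdot> swp S X Y"
    and pentagon: "W \<in> Ob C \<Longrightarrow> X \<in> Ob C \<Longrightarrow> Y \<in> Ob C \<Longrightarrow> Z \<in> Ob C \<Longrightarrow>
      asc S W X (tob S Y Z) \<cdot> asc S (tob S W X) Y Z =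
      tar S (Idn C W) (asc S X Y Z) \<cdot> asc S W (tob S X Y) Z \<cdot> tar S (asc S W X Y) (Idn C Z)"
    and triangle: "X \<in> Ob C \<Longrightarrow> Y \<in> Ob C \<Longrightarrow>
      tar S (Idn C X) (lun S Y) \<cdot> asc S X (unt S) Y = tar S (run S X) (Idn C Y)"
    and hexagon: "X \<in> Ob C \<Longrightarrow> Y \<in> Ob C \<Longrightarrow> Z \<in> Ob C \<Longrightarrow>
      asc S Y Z X \<cdot> swp S X (tob S Y Z) \<cdot> asc S X Y Z =
      tar S (Idn C Y) (swp S X Z) \<cdot> asc S Y X Z \<cdot> tar S (swp S X Y) (Idn C Z)"
    and swp_swp: "X \<in> Ob C \<Longrightarrow> Y \<in> Ob C \<Longrightarrow> swp S Y X \<cdot> swp S X Y = Idn C (tob S X Y)"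


section \<open>Monoids, kernels and cokernels\<close>

text \<open>
  Monoids are written multiplicatively, as in HOL-Algebra. Homomorphisms preserve the neutral
  element (which \<^const>\<open>hom\<close> does not demand), and are extensional functions, so that equality of
  homomorphisms is equality of functions.

  The category of monoids is rendered by all monoids with carrier in a fixed type \<open>'u\<close>,
  which plays the role of the universe; it is meant to be infinite, so that it is closed under
  finite products, quotients and submonoids up to isomorphism. Kernels and cokernels are tested
  against all monoids of the universe.
\<close>

definition mon_hom :: "'a monoid \<Rightarrow> 'b monoid \<Rightarrow> ('a \<Rightarrow> 'b) set" where
  "mon_hom G H = {f \<in> hom G H. f \<in> extensional (carrier G) \<and> f \<one>\<^bsub>G\<^esub> = \<one>\<^bsub>H\<^esub>}"

definition End_monoid :: "'a monoid \<Rightarrow> ('a \<Rightarrow> 'a) monoid" where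
  "End_monoid G = \<lparr>carrier = mon_hom G G, mult = compose (carrier G), one = (\<lambda>x\<in>carrier G. x)\<rparr>"

definition zero_hom :: "'a monoid \<Rightarrow> 'b monoid \<Rightarrow> 'a \<Rightarrow> 'b" where
  "zero_hom G H = (\<lambda>x\<in>carrier G. \<one>\<^bsub>H\<^esub>)"

definition right_cancellative :: "'a monoid \<Rightarrow> bool" where
  "right_cancellative G \<longleftrightarrow> (\<forall>x\<in>carrier G. \<forall>y\<in>carrier G. \<forall>z\<in>carrier G.
     x \<otimes>\<^bsub>G\<^esub> z = y \<otimes>\<^bsub>G\<^esub> z \<longrightarrow> x = y)"

definition left_cancellative :: "'a monoid \<Rightarrow> bool" where
  "left_cancellative G \<longleftrightarrow> (\<forall>x\<in>carrier G. \<forall>y\<in>carrier G. \<forall>z\<in>carrier G.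
     z \<otimes>\<^bsub>G\<^esub> x = z \<otimes>\<^bsub>G\<^esub> y \<longrightarrow> x = y)"

definition is_kernel :: "'u monoid \<Rightarrow> ('u \<Rightarrow> 'u) \<Rightarrow> 'u monoid \<Rightarrow> ('u \<Rightarrow> 'u) \<Rightarrow> 'u monoid \<Rightarrow> bool" where
  "is_kernel K k X f Y \<longleftrightarrow> k \<in> mon_hom K X \<and> compose (carrier K) f k = zero_hom K Y \<and>
     (\<forall>(Z :: 'u monoid) g. monoid Z \<and> g \<in> mon_hom Z X \<and> compose (carrier Z) f g = zero_hom Z Y \<longrightarrow>
        (\<exists>!h. h \<in> mon_hom Z K \<and> compose (carrier Z) k h = g))"

definition is_cokernel :: "'u monoid \<Rightarrow> ('u \<Rightarrow> 'u) \<Rightarrow> 'u monoid \<Rightarrow> ('u \<Rightarrow> 'u) \<Rightarrow> 'u monoid \<Rightarrow> bool" where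
  "is_cokernel K k X f Y \<longleftrightarrow> f \<in> mon_hom X Y \<and> compose (carrier K) f k = zero_hom K Y \<and>
     (\<forall>(Z :: 'u monoid) g. monoid Z \<and> g \<in> mon_hom X Z \<and> compose (carrier K) g k = zero_hom K Z \<longrightarrow>
        (\<exists>!h. h \<in> mon_hom Y Z \<and> compose (carrier X) h f = g))"


section \<open>Schreier extensions\<close>

definition representative ::
    "'u monoid \<Rightarrow> ('u \<Rightarrow> 'u) \<Rightarrow> 'u monoid \<Rightarrow> ('u \<Rightarrow> 'u) \<Rightarrow> 'u \<Rightarrow> 'u \<Rightarrow> bool" where
  "representative K k X f m u \<longleftrightarrow> u \<in> carrier X \<and> f u = m \<and>
     (\<forall>x\<in>carrier X. f x = m \<longrightarrow> (\<exists>!a. a \<in> carrier K \<and> x = k a \<otimes>\<^bsub>X\<^esub> u))"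

definition schreier_extension ::
    "'u monoid \<Rightarrow> ('u \<Rightarrow> 'u) \<Rightarrow> 'u monoid \<Rightarrow> ('u \<Rightarrow> 'u) \<Rightarrow> 'u monoid \<Rightarrow> bool" where
  "schreier_extension K k X f M \<longleftrightarrow> monoid K \<and> monoid X \<and> monoid M \<and>
     k \<in> mon_hom K X \<and> f \<in> mon_hom X M \<and> is_kernel K k X f M \<and> is_cokernel K k X f M \<and>
     (\<forall>m\<in>carrier M. \<exists>u. representative K k X f m u)"

definition schreier_morphism ::
    "'u monoid \<Rightarrow> ('u \<Rightarrow> 'u) \<Rightarrow> 'u monoid \<Rightarrow> ('u \<Rightarrow> 'u) \<Rightarrow> 'u monoid \<Rightarrow>
     'u monoid \<Rightarrow> ('u \<Rightarrow> 'u) \<Rightarrow> 'u monoid \<Rightarrow> ('u \<Rightarrow> 'u) \<Rightarrow> 'u monoid \<Rightarrow>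
     ('u \<Rightarrow> 'u) \<Rightarrow> ('u \<Rightarrow> 'u) \<Rightarrow> ('u \<Rightarrow> 'u) \<Rightarrow> bool" where
  "schreier_morphism K k X f M K' k' X' f' M' r s t \<longleftrightarrow>
     r \<in> mon_hom K K' \<and> s \<in> mon_hom X X' \<and> t \<in> mon_hom M M' \<and>
     compose (carrier K) s k = compose (carrier K) k' r \<and>
     compose (carrier X) t f = compose (carrier X) f' s \<and>
     (\<forall>m\<in>carrier M. \<forall>u. representative K k X f m u \<longrightarrow> representative K' k' X' f' (t m) (s u))"


section \<open>Crossed semimodules and crossed Schreier extensions\<close>

definition crossed_semimodule ::
    "'u monoid \<Rightarrow> ('u \<Rightarrow> 'u) \<Rightarrow> 'u monoid \<Rightarrow> ('u \<Rightarrow> 'u \<Rightarrow> 'u) \<Rightarrow> bool" where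
  "crossed_semimodule B d C \<alpha> \<longleftrightarrow> monoid B \<and> monoid C \<and> d \<in> mon_hom B C \<and>
     \<alpha> \<in> mon_hom C (End_monoid B) \<and>
     (\<forall>c\<in>carrier C. \<forall>b\<in>carrier B. d (\<alpha> c b) \<otimes>\<^bsub>C\<^esub> c = c \<otimes>\<^bsub>C\<^esub> d b) \<and>
     (\<forall>b1\<in>carrier B. \<forall>b2\<in>carrier B. \<alpha> (d b1) b2 \<otimes>\<^bsub>B\<^esub> b1 = b1 \<otimes>\<^bsub>B\<^esub> b2)"

definition semimodule_morphism ::
    "'u monoid \<Rightarrow> ('u \<Rightarrow> 'u) \<Rightarrow> 'u monoid \<Rightarrow> ('u \<Rightarrow> 'u \<Rightarrow> 'u) \<Rightarrow>
     'u monoid \<Rightarrow> ('u \<Rightarrow> 'u) \<Rightarrow> 'u monoid \<Rightarrow> ('u \<Rightarrow> 'u \<Rightarrow> 'u) \<Rightarrow>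
     ('u \<Rightarrow> 'u) \<Rightarrow> ('u \<Rightarrow> 'u) \<Rightarrow> bool" where
  "semimodule_morphism B d C \<alpha> B' d' C' \<alpha>' \<phi> \<psi> \<longleftrightarrow>
     \<phi> \<in> mon_hom B B' \<and> \<psi> \<in> mon_hom C C' \<and>
     compose (carrier B) d' \<phi> = compose (carrier B) \<psi> d \<and>
     (\<forall>c\<in>carrier C. \<forall>b\<in>carrier B. \<phi> (\<alpha> c b) = \<alpha>' (\<psi> c) (\<phi> b))"

text \<open>A sequence \<open>A \<rightarrow> B \<rightarrow> C \<rightarrow> M\<close> with maps \<open>mk\<close>, \<open>md\<close>, \<open>mp\<close> and an action \<open>act\<close> of \<open>C\<close> on \<open>B\<close>.\<close>

record 'u xseq =
  obA :: "'u monoid"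
  obB :: "'u monoid"
  obC :: "'u monoid"
  obM :: "'u monoid"
  mk :: "'u \<Rightarrow> 'u"
  md :: "'u \<Rightarrow> 'u"
  mp :: "'u \<Rightarrow> 'u"
  act :: "'u \<Rightarrow> 'u \<Rightarrow> 'u"

text \<open>
  The (regular epimorphism, monomorphism) factorisation of \<open>md\<close> is the one through its image
  \<open>obN\<close>: the regular epimorphism is the function \<open>md\<close> itself, now with codomain \<open>obN\<close>, and the
  monomorphism is the inclusion \<open>mn\<close>.
\<close>

definition obN :: "'u xseq \<Rightarrow> 'u monoid" where
  "obN E = (obC E)\<lparr>carrier := md E ` carrier (obB E)\<rparr>"

definition mn :: "'u xseq \<Rightarrow> 'u \<Rightarrow> 'u" where
  "mn E = (\<lambda>x\<in>carrier (obN E). x)"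

definition crossed_schreier_extension :: "'u xseq \<Rightarrow> bool" where
  "crossed_schreier_extension E \<longleftrightarrow>
     monoid (obA E) \<and> monoid (obM E) \<and>
     crossed_semimodule (obB E) (md E) (obC E) (act E) \<and>
     is_kernel (obA E) (mk E) (obB E) (md E) (obC E) \<and>
     is_cokernel (obB E) (md E) (obC E) (mp E) (obM E) \<and>
     right_cancellative (obN E) \<and>
     schreier_extension (obN E) (mn E) (obC E) (mp E) (obM E) \<and>
     right_cancellative (obA E) \<and>
     schreier_extension (obA E) (mk E) (obB E) (md E) (obN E)"

text \<open>The map \<open>A \<rightarrow> A'\<close> induced by \<open>\<phi> : B \<rightarrow> B'\<close>, and the map \<open>N \<rightarrow> N'\<close> induced by \<open>\<psi> : C \<rightarrow> C'\<close>.\<close>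

definition starA :: "'u xseq \<Rightarrow> 'u xseq \<Rightarrow> ('u \<Rightarrow> 'u) \<Rightarrow> 'u \<Rightarrow> 'u" where
  "starA E E' \<phi> = (\<lambda>a\<in>carrier (obA E). THE a'. a' \<in> carrier (obA E') \<and> mk E' a' = \<phi> (mk E a))"

definition starN :: "'u xseq \<Rightarrow> ('u \<Rightarrow> 'u) \<Rightarrow> 'u \<Rightarrow> 'u" where
  "starN E \<psi> = (\<lambda>n\<in>carrier (obN E). \<psi> n)"

type_synonym 'u xarr = "'u xseq \<times> (('u \<Rightarrow> 'u) \<times> ('u \<Rightarrow> 'u)) \<times> 'u xseq"

definition xsext_morphism :: "'u xseq \<Rightarrow> 'u xseq \<Rightarrow> ('u \<Rightarrow> 'u) \<Rightarrow> ('u \<Rightarrow> 'u) \<Rightarrow> bool" where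
  "xsext_morphism E E' \<phi> \<psi> \<longleftrightarrow>
     semimodule_morphism (obB E) (md E) (obC E) (act E) (obB E') (md E') (obC E') (act E') \<phi> \<psi> \<and>
     compose (carrier (obC E)) (mp E') \<psi> = mp E \<and>
     schreier_morphism (obA E) (mk E) (obB E) (md E) (obN E)
       (obA E') (mk E') (obB E') (md E') (obN E') (starA E E' \<phi>) \<phi> (starN E \<psi>) \<and>
     schreier_morphism (obN E) (mn E) (obC E) (mp E) (obM E)
       (obN E') (mn E') (obC E') (mp E') (obM E') (starN E \<psi>) \<psi> (\<lambda>m\<in>carrier (obM E). m)"

definition XSExt :: "'u monoid \<Rightarrow> ('u xseq, 'u xarr) cat" where
  "XSExt M = \<lparr>Ob = {E. crossed_schreier_extension E \<and> obM E = M},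
     Ar = {(E, (\<phi>, \<psi>), E'). crossed_schreier_extension E \<and> obM E = M \<and>
            crossed_schreier_extension E' \<and> obM E' = M \<and> xsext_morphism E E' \<phi> \<psi>},
     Dom = (\<lambda>(E, _, E'). E),
     Cod = (\<lambda>(E, _, E'). E'),
     Idn = (\<lambda>E. (E, (\<lambda>b\<in>carrier (obB E). b, \<lambda>c\<in>carrier (obC E). c), E)),
     Comp = (\<lambda>(_, (\<phi>', \<psi>'), E'') (E, (\<phi>, \<psi>), _).
       (E, (compose (carrier (obB E)) \<phi>' \<phi>, compose (carrier (obC E)) \<psi>' \<psi>), E''))\<rparr>"

definition com_XSExt :: "'u monoid \<Rightarrow> ('u xseq, 'u xarr) cat" where
  "com_XSExt M = full_subcat (XSExt M) (\<lambda>E. comm_monoid (obB E))"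


section \<open>Cancellative semimodules and the functors \<open>D\<^sub>1\<close>, \<open>d\<^sub>1\<close>\<close>

type_synonym 'u smod = "'u monoid \<times> ('u \<Rightarrow> 'u \<Rightarrow> 'u)"
type_synonym 'u sarr = "'u smod \<times> ('u \<Rightarrow> 'u) \<times> 'u smod"

definition can_semimodule :: "'u monoid \<Rightarrow> 'u smod \<Rightarrow> bool" where
  "can_semimodule M V \<longleftrightarrow> comm_monoid (fst V) \<and>
     left_cancellative (fst V) \<and> right_cancellative (fst V) \<and>
     snd V \<in> mon_hom M (End_monoid (fst V))"

definition can_Smod :: "'u monoid \<Rightarrow> ('u smod, 'u sarr) cat" where
  "can_Smod M = \<lparr>Ob = {V. can_semimodule M V},
     Ar = {(V, f, V'). can_semimodule M V \<and> can_semimodule M V' \<and> f \<in> mon_hom (fst V) (fst V') \<and>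
            (\<forall>m\<in>carrier M. \<forall>a\<in>carrier (fst V). f (snd V m a) = snd V' m (f a))},
     Dom = (\<lambda>(V, _, V'). V),
     Cod = (\<lambda>(V, _, V'). V'),
     Idn = (\<lambda>V. (V, \<lambda>a\<in>carrier (fst V). a, V)),
     Comp = (\<lambda>(_, g, V'') (V, f, _). (V, compose (carrier (fst V)) g f, V''))\<rparr>"

text \<open>\<open>induced_action E m a = act E c a\<close> for any \<open>c\<close> over \<open>m\<close>, read in \<open>A\<close> through \<open>mk E\<close>.\<close>

definition induced_action :: "'u xseq \<Rightarrow> 'u \<Rightarrow> 'u \<Rightarrow> 'u" where
  "induced_action E = (\<lambda>m\<in>carrier (obM E). \<lambda>a\<in>carrier (obA E).
     THE a'. a' \<in> carrier (obA E) \<and>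
       (\<exists>c\<in>carrier (obC E). mp E c = m \<and> mk E a' = act E c (mk E a)))"

definition D1 :: "'u monoid \<Rightarrow> ('u xseq, 'u xarr, 'u smod, 'u sarr) cfunctor" where
  "D1 M = \<lparr>Src = XSExt M, Tgt = can_Smod M,
     FOb = (\<lambda>E. (obA E, induced_action E)),
     FAr = (\<lambda>(E, (\<phi>, \<psi>), E'). ((obA E, induced_action E), starA E E' \<phi>, (obA E', induced_action E')))\<rparr>"

definition d1 :: "'u monoid \<Rightarrow> ('u xseq, 'u xarr, 'u smod, 'u sarr) cfunctor" where
  "d1 M = (D1 M)\<lparr>Src := com_XSExt M\<rparr>"


section \<open>The natural monoidal structure on a fibre\<close>

text \<open>
  Every object \<open>V\<close> of \<^const>\<open>can_Smod\<close> is an internal commutative monoid, so that the arrows with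
  codomain \<open>V\<close> can be added pointwise. For a functor \<open>F\<close> to \<^const>\<open>can_Smod\<close> whose source has
  finite products, the structure on the fibre over \<open>V\<close> is natural in the following sense. The
  tensor product of \<open>X\<close> and \<open>Y\<close> is the push forward of their product (in the source of \<open>F\<close>) along
  the addition of \<open>V\<close>, i.e. their Baer sum: there is an opcartesian arrow \<open>adq X Y\<close> from the
  product to the tensor product, with image under \<open>F\<close> the sum of the images of the two
  projections. The unit is the push forward of the terminal object along \<open>0 \<rightarrow> V\<close>. The
  tensor product of arrows and the constraint isomorphisms are those induced by the functoriality,
  associativity, unit and symmetry of products; this is expressed on the generalised elements
  \<open>x + y : T \<rightarrow> X \<otimes> Y\<close>, the composites of \<open>adq X Y\<close> with the pairing of \<open>x : T \<rightarrow> X\<close> and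
  \<open>y : T \<rightarrow> Y\<close>, and \<open>0 : T \<rightarrow> I\<close>, the composite of \<open>zrq\<close> with the arrow to the terminal object.
\<close>

definition smod_add :: "'u sarr \<Rightarrow> 'u sarr \<Rightarrow> 'u sarr" where
  "smod_add = (\<lambda>(V, f, W) (_, g, _). (V, \<lambda>a\<in>carrier (fst V). f a \<otimes>\<^bsub>fst W\<^esub> g a, W))"

definition smod_zero :: "'u smod \<Rightarrow> 'u smod \<Rightarrow> 'u sarr" where
  "smod_zero V W = (V, zero_hom (fst V) (fst W), W)"

record ('o, 'a) addition_data =
  prob :: "'o \<Rightarrow> 'o \<Rightarrow> 'o"
  pr1 :: "'o \<Rightarrow> 'o \<Rightarrow> 'a"
  pr2 :: "'o \<Rightarrow> 'o \<Rightarrow> 'a"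
  adq :: "'o \<Rightarrow> 'o \<Rightarrow> 'a"
  trm :: 'o
  zrq :: 'a

definition gen_add :: "('o, 'a) cat \<Rightarrow> ('o, 'a) addition_data \<Rightarrow> 'a \<Rightarrow> 'a \<Rightarrow> 'a" where
  "gen_add U Q x y = adq Q (Cod U x) (Cod U y) \<cdot>\<^bsub>U\<^esub>
     (THE h. in_hom U h (Dom U x) (prob Q (Cod U x) (Cod U y)) \<and>
        pr1 Q (Cod U x) (Cod U y) \<cdot>\<^bsub>U\<^esub> h = x \<and> pr2 Q (Cod U x) (Cod U y) \<cdot>\<^bsub>U\<^esub> h = y)"

definition gen_zero :: "('o, 'a) cat \<Rightarrow> ('o, 'a) addition_data \<Rightarrow> 'o \<Rightarrow> 'a" where
  "gen_zero U Q T = zrq Q \<cdot>\<^bsub>U\<^esub> (THE t. in_hom U t T (trm Q))"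

locale induced_by_addition =
  fixes U :: "('o, 'a) cat" (structure)
    and X0 :: "('o, 'a) cat"
    and F :: "('o, 'a, 'u smod, 'u sarr) cfunctor"
    and V :: "'u smod"
    and S :: "('o, 'a) monoidal_data"
    and Q :: "('o, 'a) addition_data"
  assumes product: "X \<in> Ob X0 \<Longrightarrow> Y \<in> Ob X0 \<Longrightarrow>
      is_product U (prob Q X Y) (pr1 Q X Y) (pr2 Q X Y) X Y"
    and adq_hom: "X \<in> Ob X0 \<Longrightarrow> Y \<in> Ob X0 \<Longrightarrow> in_hom U (adq Q X Y) (prob Q X Y) (tob S X Y)"
    and adq_opcartesian: "X \<in> Ob X0 \<Longrightarrow> Y \<in> Ob X0 \<Longrightarrow> is_opcartesian F (adq Q X Y)"
    and adq_over: "X \<in> Ob X0 \<Longrightarrow> Y \<in> Ob X0 \<Longrightarrow>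
      FAr F (adq Q X Y) = smod_add (FAr F (pr1 Q X Y)) (FAr F (pr2 Q X Y))"
    and terminal: "is_terminal U (trm Q)"
    and zrq_hom: "in_hom U (zrq Q) (trm Q) (unt S)"
    and zrq_opcartesian: "is_opcartesian F (zrq Q)"
    and zrq_over: "FAr F (zrq Q) = smod_zero (FOb F (trm Q)) V"
    and tar_gen: "in_hom X0 f X X' \<Longrightarrow> in_hom X0 g Y Y' \<Longrightarrow>
      in_hom U x T X \<Longrightarrow> in_hom U y T Y \<Longrightarrow>
      tar S f g \<cdot> gen_add U Q x y = gen_add U Q (f \<cdot> x) (g \<cdot> y)"
    and asc_gen: "X \<in> Ob X0 \<Longrightarrow> Y \<in> Ob X0 \<Longrightarrow> Z \<in> Ob X0 \<Longrightarrow>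
      in_hom U x T X \<Longrightarrow> in_hom U y T Y \<Longrightarrow> in_hom U z T Z \<Longrightarrow>
      asc S X Y Z \<cdot> gen_add U Q (gen_add U Q x y) z = gen_add U Q x (gen_add U Q y z)"
    and lun_gen: "X \<in> Ob X0 \<Longrightarrow> in_hom U x T X \<Longrightarrow>
      lun S X \<cdot> gen_add U Q (gen_zero U Q T) x = x"
    and run_gen: "X \<in> Ob X0 \<Longrightarrow> in_hom U x T X \<Longrightarrow>
      run S X \<cdot> gen_add U Q x (gen_zero U Q T) = x"
    and swp_gen: "X \<in> Ob X0 \<Longrightarrow> Y \<in> Ob X0 \<Longrightarrow> in_hom U x T X \<Longrightarrow> in_hom U y T Y \<Longrightarrow>
      swp S X Y \<cdot> gen_add U Q x y = gen_add U Q y x"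

definition natural_structure ::
    "('o, 'a, 'u smod, 'u sarr) cfunctor \<Rightarrow> 'u smod \<Rightarrow> ('o, 'a) monoidal_data \<Rightarrow> bool" where
  "natural_structure F V S \<longleftrightarrow> (\<exists>Q. induced_by_addition (Src F) (fibre F V) F V S Q)"

end

theory Submission
  imports Defs
begin

text \<open>
  The tensor product of two objects of a fibre is their Baer sum: the push forward of their product
  along the addition of \<open>V = (A, \<eta>)\<close>. Hence everything follows formally once the source of the functor
  has finite products and a class of opcartesian arrows which is closed under composition and
  products and contains a lift of every arrow into \<open>V\<close>: a morphism of the fibre out of an iterated
  tensor product is then determined by its effect on sums of generalised elements, where the
  coherence laws reduce to the commutative monoid laws.

  For crossed Schreier extensions, a morphism whose component \<open>C \<rightarrow> C'\<close> is bijective is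
  opcartesian, since every element of \<open>B'\<close> has the form \<open>k'(a) + \<phi>(b)\<close>. Products are fibre products
  over \<open>M\<close>. The push forward of \<open>A \<rightarrow> B \<rightarrow> C \<rightarrow> M\<close> along \<open>w : A \<rightarrow> A'\<close> is the quotient of \<open>A' \<times> B\<close>
  by \<open>(x, k(a) + b) \<sim> (x + w(a), b)\<close>, realised on the set \<open>A' \<times> N\<close> by means of a choice of
  representatives.
\<close>

section \<open>Symmetric monoidal fibres from opcartesian arrows\<close>

text \<open>A morphism has to carry every representative to a representative, so a map given by a
  formula on sums is not obviously a morphism. The remedy is that the representatives of one element
  form a single orbit under translation by invertible elements of the kernel, and homomorphisms keep
  elements invertible: one representative per fibre is enough to check. Well-definedness of such
  maps rests on freeness. The definition of a representative gives uniqueness of coefficients at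
  representatives only; right cancellation of the kernel extends it to every element of the middle
  monoid. All monoids have their carrier in the same type \<open>'u\<close>. A bijection between
  \<open>'u\<close> and its square, which exists as \<open>'u\<close> is infinite, encodes pairs;
  the quotient in a push forward becomes a set of pairs and not a set of classes, so it stays inside
  \<open>'u\<close>. The functors \<open>D1\<close> and \<open>d1\<close> are treated together by
  means of a Boolean flag, since products, push forwards and the terminal object all preserve
  commutativity of \<open>B\<close>.\<close>

lemma in_hom_can_Smod:
  "in_hom (can_Smod M) v W V \<longleftrightarrow> (\<exists>f. v = (W, f, V) \<and> can_semimodule M W \<and> can_semimodule M V \<and>
     f \<in> mon_hom (fst W) (fst V) \<and>
     (\<forall>m\<in>carrier M. \<forall>a\<in>carrier (fst W). f (snd W m a) = snd V m (f a)))"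
  by (cases v) (auto simp: in_hom_def can_Smod_def)

lemma can_Smod_sel:
  "Ob (can_Smod M) = {V. can_semimodule M V}"
  "(x, g, z) \<cdot>\<^bsub>can_Smod M\<^esub> (W, f, y) = (W, compose (carrier (fst W)) g f, z)"
  "Idn (can_Smod M) V = (V, \<lambda>a\<in>carrier (fst V). a, V)"
  by (simp_all add: can_Smod_def)

lemma action_hom: "can_semimodule M V \<Longrightarrow> m \<in> carrier M \<Longrightarrow> snd V m \<in> mon_hom (fst V) (fst V)"
  by (auto simp: can_semimodule_def mon_hom_def End_monoid_def hom_def)

text \<open>Commutativity of \<open>V\<close> interchanges the two middle factors in the image of a
  product; equivariance holds because each \<open>snd V m\<close> is an endomorphism.\<close>

lemma smod_add_hom:
  assumes "in_hom (can_Smod M) u W V" "in_hom (can_Smod M) v W V"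
  shows "in_hom (can_Smod M) (smod_add u v) W V"
proof -
  obtain f g where fg: "u = (W, f, V)" "v = (W, g, V)" and W: "can_semimodule M W" and V: "can_semimodule M V"
    and f: "f \<in> mon_hom (fst W) (fst V)" "\<forall>m\<in>carrier M. \<forall>a\<in>carrier (fst W). f (snd W m a) = snd V m (f a)"
    and g: "g \<in> mon_hom (fst W) (fst V)" "\<forall>m\<in>carrier M. \<forall>a\<in>carrier (fst W). g (snd W m a) = snd V m (g a)"
    using assms by (auto simp: in_hom_can_Smod)
  interpret V: comm_monoid "fst V" using V by (simp add: can_semimodule_def)
  interpret W: comm_monoid "fst W" using W by (simp add: can_semimodule_def)
  have cl: "a \<in> carrier (fst W) \<Longrightarrow> f a \<in> carrier (fst V)" "a \<in> carrier (fst W) \<Longrightarrow> g a \<in> carrier (fst V)" for a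
    using f g by (auto simp: mon_hom_def hom_def)
  have "snd W m a \<in> carrier (fst W)" if "m \<in> carrier M" "a \<in> carrier (fst W)" for m a
    using action_hom[OF W that(1)] that(2) by (auto simp: mon_hom_def hom_def)
  moreover have "snd V m (x \<otimes>\<^bsub>fst V\<^esub> y) = snd V m x \<otimes>\<^bsub>fst V\<^esub> snd V m y"
    if "m \<in> carrier M" "x \<in> carrier (fst V)" "y \<in> carrier (fst V)" for m x y
    using action_hom[OF V that(1)] that by (auto simp: mon_hom_def hom_def)
  ultimately show ?thesis
    using f g W V cl by (auto simp: fg smod_add_def in_hom_can_Smod mon_hom_def hom_def V.m_ac)
qed

lemma smod_zero_hom:
  assumes W: "can_semimodule M W" and V: "can_semimodule M V"
  shows "in_hom (can_Smod M) (smod_zero W V) W V"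
proof -
  interpret V: comm_monoid "fst V" using V by (simp add: can_semimodule_def)
  interpret W: comm_monoid "fst W" using W by (simp add: can_semimodule_def)
  have "snd W m a \<in> carrier (fst W)" if "m \<in> carrier M" "a \<in> carrier (fst W)" for m a
    using action_hom[OF W that(1)] that(2) by (auto simp: mon_hom_def hom_def)
  moreover have "snd V m \<one>\<^bsub>fst V\<^esub> = \<one>\<^bsub>fst V\<^esub>" if "m \<in> carrier M" for m
    using action_hom[OF V that(1)] that by (auto simp: mon_hom_def hom_def)
  ultimately show ?thesis
    using W V by (auto simp: smod_zero_def zero_hom_def in_hom_can_Smod mon_hom_def hom_def)
qed

lemma smod_add_assoc:
  assumes "in_hom (can_Smod M) u W V" "in_hom (can_Smod M) v W V" "in_hom (can_Smod M) w W V"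
  shows "smod_add (smod_add u v) w = smod_add u (smod_add v w)"
proof -
  obtain f g h where fg: "u = (W, f, V)" "v = (W, g, V)" "w = (W, h, V)" and V: "can_semimodule M V"
    and f: "f \<in> mon_hom (fst W) (fst V)"
    and g: "g \<in> mon_hom (fst W) (fst V)"
    and h: "h \<in> mon_hom (fst W) (fst V)"
    using assms by (auto simp: in_hom_can_Smod)
  interpret V: comm_monoid "fst V" using V by (simp add: can_semimodule_def)
  show ?thesis using f g h
    by (auto simp: fg smod_add_def mon_hom_def hom_def Pi_iff fun_eq_iff restrict_def V.m_assoc)
qed

lemma smod_add_comm:
  assumes "in_hom (can_Smod M) u W V" "in_hom (can_Smod M) v W V"
  shows "smod_add u v = smod_add v u"
proof -
  obtain f g where fg: "u = (W, f, V)" "v = (W, g, V)" and V: "can_semimodule M V"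
    and f: "f \<in> mon_hom (fst W) (fst V)"
    and g: "g \<in> mon_hom (fst W) (fst V)"
    using assms by (auto simp: in_hom_can_Smod)
  interpret V: comm_monoid "fst V" using V by (simp add: can_semimodule_def)
  show ?thesis using f g
    by (auto simp: fg smod_add_def mon_hom_def hom_def Pi_iff fun_eq_iff restrict_def V.m_comm)
qed

lemma smod_add_zero:
  assumes "in_hom (can_Smod M) u W V"
  shows "smod_add (smod_zero W V) u = u"
proof -
  obtain f where f: "u = (W, f, V)" "f \<in> mon_hom (fst W) (fst V)" and V: "can_semimodule M V"
    using assms by (auto simp: in_hom_can_Smod)
  interpret V: comm_monoid "fst V" using V by (simp add: can_semimodule_def)
  show ?thesis using f(2)
    by (auto simp: f smod_add_def smod_zero_def zero_hom_def Pi_iff mon_hom_def hom_def Pi_iff extensional_def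
        fun_eq_iff restrict_def)
qed

text \<open>Sums are computed in the codomain, so precomposition distributes over them. This is what
  makes \<open>F\<close> additive on generalised elements.\<close>

lemma smod_add_comp:
  assumes "in_hom (can_Smod M) u W V" "in_hom (can_Smod M) v W V" "in_hom (can_Smod M) t W' W"
  shows "smod_add u v \<cdot>\<^bsub>can_Smod M\<^esub> t = smod_add (u \<cdot>\<^bsub>can_Smod M\<^esub> t) (v \<cdot>\<^bsub>can_Smod M\<^esub> t)"
  using assms by (auto simp: in_hom_can_Smod smod_add_def can_Smod_sel mon_hom_def hom_def Pi_iff
      compose_def fun_eq_iff restrict_def)

lemma smod_zero_comp:
  assumes "in_hom (can_Smod M) t W' W"
  shows "smod_zero W V \<cdot>\<^bsub>can_Smod M\<^esub> t = smod_zero W' V"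
  using assms by (auto simp: in_hom_can_Smod smod_zero_def zero_hom_def Pi_iff can_Smod_sel mon_hom_def hom_def Pi_iff
      compose_def fun_eq_iff restrict_def)

lemma smod_idn_comp:
  assumes "in_hom (can_Smod M) t W V"
  shows "Idn (can_Smod M) V \<cdot>\<^bsub>can_Smod M\<^esub> t = t"
  using assms by (auto simp: in_hom_can_Smod can_Smod_sel mon_hom_def hom_def Pi_iff extensional_def
      compose_def fun_eq_iff restrict_def)

lemma smod_idn_hom:
  assumes "can_semimodule M V"
  shows "in_hom (can_Smod M) (Idn (can_Smod M) V) V V"
proof -
  interpret V: comm_monoid "fst V" using assms by (simp add: can_semimodule_def)
  have "snd V m a \<in> carrier (fst V)" if "m \<in> carrier M" "a \<in> carrier (fst V)" for m a
    using action_hom[OF assms that(1)] that(2) by (auto simp: mon_hom_def hom_def Pi_iff)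
  then show ?thesis using assms unfolding in_hom_can_Smod can_Smod_sel
    by (auto simp: can_Smod_sel mon_hom_def hom_def Pi_iff)
qed

text \<open>A separate predicate \<open>G\<close> is carried along because a product of two
  opcartesian arrows need not be opcartesian in general, whereas the argument needs iterated
  products of the arrows that define the tensor product.\<close>

locale opcartesian_class = category U for U :: "('o, 'a) cat" (structure) +
  fixes F :: "('o, 'a, 'u smod, 'u sarr) cfunctor" and M :: "'u monoid" and V :: "'u smod"
    and pob :: "'o \<Rightarrow> 'o \<Rightarrow> 'o" and p1 p2 :: "'o \<Rightarrow> 'o \<Rightarrow> 'a" and one :: 'o and G :: "'a \<Rightarrow> bool"
  assumes Src_F: "Src F = U"
    and Tgt_F: "Tgt F = can_Smod M"
    and V_semimodule: "can_semimodule M V"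
    and F_hom: "in_hom U f X Y \<Longrightarrow> in_hom (can_Smod M) (FAr F f) (FOb F X) (FOb F Y)"
    and F_comp: "in_hom U f X Y \<Longrightarrow> in_hom U g Y Z \<Longrightarrow>
      FAr F (g \<cdot> f) = FAr F g \<cdot>\<^bsub>can_Smod M\<^esub> FAr F f"
    and F_idn: "X \<in> Ob U \<Longrightarrow> FAr F (Idn U X) = Idn (can_Smod M) (FOb F X)"
    and pob_product: "X \<in> Ob U \<Longrightarrow> Y \<in> Ob U \<Longrightarrow> is_product U (pob X Y) (p1 X Y) (p2 X Y) X Y"
    and one_terminal: "is_terminal U one"
    and G_opcartesian: "G q \<Longrightarrow> q \<in> Ar U \<Longrightarrow> is_opcartesian F q"
    and G_idn: "X \<in> Ob U \<Longrightarrow> G (Idn U X)"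
    and G_comp: "in_hom U f X Y \<Longrightarrow> in_hom U g Y Z \<Longrightarrow> G f \<Longrightarrow> G g \<Longrightarrow> G (g \<cdot> f)"
    and G_product: "in_hom U f X X' \<Longrightarrow> in_hom U g Y Y' \<Longrightarrow> G f \<Longrightarrow> G g \<Longrightarrow>
      in_hom U h (pob X Y) (pob X' Y') \<Longrightarrow> p1 X' Y' \<cdot> h = f \<cdot> p1 X Y \<Longrightarrow> p2 X' Y' \<cdot> h = g \<cdot> p2 X Y \<Longrightarrow> G h"
    and G_lift: "X \<in> Ob U \<Longrightarrow> in_hom (can_Smod M) v (FOb F X) V \<Longrightarrow>
      \<exists>q. q \<in> Ar U \<and> Dom U q = X \<and> FOb F (Cod U q) = V \<and> FAr F q = v \<and> G q"
begin

text \<open>Stating membership in the fibre by predicates on \<open>U\<close> keeps all computations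
  in one category, where arrows of the fibre may be composed with generalised elements from outside
  it.\<close>

definition fib :: "'o \<Rightarrow> bool" where "fib X \<longleftrightarrow> X \<in> Ob U \<and> FOb F X = V"

definition fibar :: "'a \<Rightarrow> bool" where
  "fibar f \<longleftrightarrow> f \<in> Ar U \<and> fib (Dom U f) \<and> fib (Cod U f) \<and> FAr F f = Idn (can_Smod M) V"

section \<open>The fibre inside the ambient category\<close>

lemma fibre_Ob: "X \<in> Ob (fibre F V) \<longleftrightarrow> fib X"
  by (auto simp: fibre_def Src_F fib_def)

lemma fibre_Ar: "f \<in> Ar (fibre F V) \<longleftrightarrow> fibar f"
  using dom_in cod_in by (auto simp: fibre_def Src_F Tgt_F fib_def fibar_def)

lemma fibre_hom: "in_hom (fibre F V) f X Y \<longleftrightarrow> fibar f \<and> Dom U f = X \<and> Cod U f = Y"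
  using dom_in cod_in
  by (auto simp: fibre_def Src_F Tgt_F fib_def fibar_def in_hom_def)

lemma fibre_sel: "Idn (fibre F V) = Idn U" "Comp (fibre F V) = Comp U"
  "Dom (fibre F V) = Dom U" "Cod (fibre F V) = Cod U"
  by (auto simp: fibre_def Src_F)

lemma fibI: "X \<in> Ob U \<Longrightarrow> FOb F X = V \<Longrightarrow> fib X"
  by (simp add: fib_def)

lemma fibarI: "f \<in> Ar U \<Longrightarrow> fib (Dom U f) \<Longrightarrow> fib (Cod U f) \<Longrightarrow>
    FAr F f = Idn (can_Smod M) V \<Longrightarrow> fibar f"
  by (simp add: fibar_def)

lemma fib_Ob [simp]: "fib X \<Longrightarrow> X \<in> Ob U" and fib_F [simp]: "fib X \<Longrightarrow> FOb F X = V"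
  by (auto simp: fib_def)

lemma fibarD [simp]: "fibar f \<Longrightarrow> f \<in> Ar U" "fibar f \<Longrightarrow> fib (Dom U f)" "fibar f \<Longrightarrow> fib (Cod U f)"
  "fibar f \<Longrightarrow> FAr F f = Idn (can_Smod M) V"
  by (auto simp: fibar_def)

lemma Ar_comp [simp]:
  assumes "f \<in> Ar U" "g \<in> Ar U" "Cod U f = Dom U g"
  shows "g \<cdot> f \<in> Ar U" "Dom U (g \<cdot> f) = Dom U f" "Cod U (g \<cdot> f) = Cod U g"
  using comp_hom[of f "Dom U f" "Cod U f" g "Cod U g"] assms by (auto simp: in_hom_def)

lemma Ar_idn [simp]:
  assumes "X \<in> Ob U" shows "Idn U X \<in> Ar U" "Dom U (Idn U X) = X" "Cod U (Idn U X) = X"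
  using idn_hom[OF assms] by (auto simp: in_hom_def)

text \<open>As a rewrite rule this produces right-nested composites, the shape in which the value of
  a structure arrow on a sum can be substituted.\<close>

lemma comp_assoc' [simp]:
  assumes "f \<in> Ar U" "g \<in> Ar U" "h \<in> Ar U" "Cod U f = Dom U g" "Cod U g = Dom U h"
  shows "(h \<cdot> g) \<cdot> f = h \<cdot> (g \<cdot> f)"
  using comp_assoc[of f "Dom U f" "Cod U f" g "Cod U g" h "Cod U h"] assms by (auto simp: in_hom_def)

lemma idn_comp' [simp]: "f \<in> Ar U \<Longrightarrow> Cod U f = X \<Longrightarrow> Idn U X \<cdot> f = f"
  and comp_idn' [simp]: "f \<in> Ar U \<Longrightarrow> Dom U f = X \<Longrightarrow> f \<cdot> Idn U X = f"
  using idn_comp[of f "Dom U f" "Cod U f"] comp_idn[of f "Dom U f" "Cod U f"] by (auto simp: in_hom_def)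

lemma Ob_dom [simp]: "f \<in> Ar U \<Longrightarrow> Dom U f \<in> Ob U" and Ob_cod [simp]: "f \<in> Ar U \<Longrightarrow> Cod U f \<in> Ob U"
  using dom_in cod_in by auto

lemma F_hom': "f \<in> Ar U \<Longrightarrow> in_hom (can_Smod M) (FAr F f) (FOb F (Dom U f)) (FOb F (Cod U f))"
  by (rule F_hom) (auto simp: in_hom_def)

lemma F_hom_fib: "f \<in> Ar U \<Longrightarrow> fib (Cod U f) \<Longrightarrow> in_hom (can_Smod M) (FAr F f) (FOb F (Dom U f)) V"
  using F_hom'[of f] by simp

lemma F_comp': "f \<in> Ar U \<Longrightarrow> g \<in> Ar U \<Longrightarrow> Cod U f = Dom U g \<Longrightarrow>
  FAr F (g \<cdot> f) = FAr F g \<cdot>\<^bsub>can_Smod M\<^esub> FAr F f"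
  by (rule F_comp) (auto simp: in_hom_def)

lemma F_fibar_comp [simp]:
  assumes "fibar g" "f \<in> Ar U" "Cod U f = Dom U g"
  shows "FAr F (g \<cdot> f) = FAr F f"
  using assms F_hom'[of f] by (simp add: F_comp' smod_idn_comp)

lemma fibar_comp [simp]: "fibar f \<Longrightarrow> fibar g \<Longrightarrow> Cod U f = Dom U g \<Longrightarrow> fibar (g \<cdot> f)"
  by (rule fibarI) auto

lemma fibar_idn [simp]: "fib X \<Longrightarrow> fibar (Idn U X)"
  by (rule fibarI) (auto simp: F_idn)

lemma hom_fibar_iff: "fib X \<Longrightarrow> fib Y \<Longrightarrow> in_hom U h X Y \<and> FAr F h = Idn (can_Smod M) V \<longleftrightarrow>
    fibar h \<and> Dom U h = X \<and> Cod U h = Y"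
  by (auto simp: in_hom_def intro!: fibarI)

lemma fibre_category: "category (fibre F V)"
  by unfold_locales (auto simp: fibre_hom fibre_sel fibre_Ob fibre_Ar)

section \<open>Pairings into products\<close>

lemma pob_simps [simp]:
  assumes "X \<in> Ob U" "Y \<in> Ob U"
  shows "pob X Y \<in> Ob U" "p1 X Y \<in> Ar U" "p2 X Y \<in> Ar U" "Dom U (p1 X Y) = pob X Y"
    "Dom U (p2 X Y) = pob X Y" "Cod U (p1 X Y) = X" "Cod U (p2 X Y) = Y"
  using pob_product[OF assms] by (auto simp: is_product_def in_hom_def)

text \<open>The description is the one inside \<open>gen_add\<close>, so that the comparison
  \<open>gen_add_eq\<close> is a mere unfolding.\<close>

definition pairing :: "'a \<Rightarrow> 'a \<Rightarrow> 'a" where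
  "pairing x y = (THE h. in_hom U h (Dom U x) (pob (Cod U x) (Cod U y)) \<and>
     p1 (Cod U x) (Cod U y) \<cdot> h = x \<and> p2 (Cod U x) (Cod U y) \<cdot> h = y)"

lemma pairing_ex1:
  assumes "x \<in> Ar U" "y \<in> Ar U" "Dom U x = Dom U y"
  shows "\<exists>!h. in_hom U h (Dom U x) (pob (Cod U x) (Cod U y)) \<and>
     p1 (Cod U x) (Cod U y) \<cdot> h = x \<and> p2 (Cod U x) (Cod U y) \<cdot> h = y"
  using pob_product[of "Cod U x" "Cod U y", unfolded is_product_def, THEN conjunct2, THEN conjunct2,
      THEN conjunct2, rule_format, of x "Dom U x" y] assms
  by (simp add: in_hom_def)

lemma pairing:
  assumes "x \<in> Ar U" "y \<in> Ar U" "Dom U x = Dom U y"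
  shows "pairing x y \<in> Ar U" "Dom U (pairing x y) = Dom U y" "Cod U (pairing x y) = pob (Cod U x) (Cod U y)"
    "Cod U x = X \<Longrightarrow> Cod U y = Y \<Longrightarrow> p1 X Y \<cdot> pairing x y = x"
    "Cod U x = X \<Longrightarrow> Cod U y = Y \<Longrightarrow> p2 X Y \<cdot> pairing x y = y"
  using theI'[OF pairing_ex1[OF assms], folded pairing_def] assms by (auto simp: in_hom_def)

lemmas [simp] = pairing

lemma pairing_eqI:
  assumes "h \<in> Ar U" "h' \<in> Ar U" "Dom U h = Dom U h'" "Cod U h = pob X Y" "Cod U h' = pob X Y"
    "X \<in> Ob U" "Y \<in> Ob U" "p1 X Y \<cdot> h = p1 X Y \<cdot> h'" "p2 X Y \<cdot> h = p2 X Y \<cdot> h'"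
  shows "h = h'"
proof -
  have "\<exists>!k. in_hom U k (Dom U h) (pob X Y) \<and> p1 X Y \<cdot> k = p1 X Y \<cdot> h \<and> p2 X Y \<cdot> k = p2 X Y \<cdot> h"
    using pob_product[of X Y, unfolded is_product_def, THEN conjunct2, THEN conjunct2,
        THEN conjunct2, rule_format, of "p1 X Y \<cdot> h" "Dom U h" "p2 X Y \<cdot> h"] assms
    by (simp add: in_hom_def)
  then show ?thesis using assms unfolding in_hom_def by metis
qed

lemma pairing_comp [simp]:
  assumes "x \<in> Ar U" "y \<in> Ar U" "Dom U x = Dom U y" "t \<in> Ar U" "Cod U t = Dom U y"
  shows "pairing x y \<cdot> t = pairing (x \<cdot> t) (y \<cdot> t)"
  by (rule pairing_eqI[of _ _ "Cod U x" "Cod U y"])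
    (use assms in \<open>auto simp flip: comp_assoc'\<close>)

text \<open>The clause \<open>G q\<close> belongs to the choice, since it is membership in
  \<open>G\<close> that passes to products and composites. The codomain of the chosen lift is the
  tensor product; it is not constructed separately.\<close>

definition ad :: "'o \<Rightarrow> 'o \<Rightarrow> 'a" where
  "ad X Y = (SOME q. q \<in> Ar U \<and> Dom U q = pob X Y \<and> FOb F (Cod U q) = V \<and>
     FAr F q = smod_add (FAr F (p1 X Y)) (FAr F (p2 X Y)) \<and> G q)"

definition zr :: 'a where
  "zr = (SOME q. q \<in> Ar U \<and> Dom U q = one \<and> FOb F (Cod U q) = V \<and>
     FAr F q = smod_zero (FOb F one) V \<and> G q)"

definition tens :: "'o \<Rightarrow> 'o \<Rightarrow> 'o" where "tens X Y = Cod U (ad X Y)"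

definition ten_unit :: 'o where "ten_unit = Cod U zr"

lemma ad:
  assumes "fib X" "fib Y"
  shows "ad X Y \<in> Ar U" "Dom U (ad X Y) = pob X Y" "fib (tens X Y)" "Cod U (ad X Y) = tens X Y"
    "FAr F (ad X Y) = smod_add (FAr F (p1 X Y)) (FAr F (p2 X Y))" "G (ad X Y)"
proof -
  have "\<exists>q. q \<in> Ar U \<and> Dom U q = pob X Y \<and> FOb F (Cod U q) = V \<and>
     FAr F q = smod_add (FAr F (p1 X Y)) (FAr F (p2 X Y)) \<and> G q"
    using assms F_hom_fib[of "p1 X Y"] F_hom_fib[of "p2 X Y"]
    by (intro G_lift smod_add_hom) auto
  from someI_ex[OF this, folded ad_def]
  show "ad X Y \<in> Ar U" "Dom U (ad X Y) = pob X Y" "fib (tens X Y)" "Cod U (ad X Y) = tens X Y"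
    "FAr F (ad X Y) = smod_add (FAr F (p1 X Y)) (FAr F (p2 X Y))" "G (ad X Y)"
    by (auto simp: tens_def intro!: fibI)
qed

lemmas [simp] = ad

lemma one_Ob [simp]: "one \<in> Ob U"
  using one_terminal by (auto simp: is_terminal_def)

lemma zr [simp]: "zr \<in> Ar U" "Dom U zr = one" "fib ten_unit" "Cod U zr = ten_unit"
    "FAr F zr = smod_zero (FOb F one) V" "G zr"
proof -
  have "can_semimodule M (FOb F one)"
    using F_hom'[of "Idn U one"] by (auto simp: in_hom_can_Smod)
  then have "\<exists>q. q \<in> Ar U \<and> Dom U q = one \<and> FOb F (Cod U q) = V \<and>
     FAr F q = smod_zero (FOb F one) V \<and> G q"
    by (intro G_lift smod_zero_hom V_semimodule) auto
  from someI_ex[OF this, folded zr_def]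
  show "zr \<in> Ar U" "Dom U zr = one" "fib ten_unit" "Cod U zr = ten_unit"
    "FAr F zr = smod_zero (FOb F one) V" "G zr"
    by (auto simp: ten_unit_def intro!: fibI)
qed

section \<open>Sums of generalised elements\<close>

definition Q :: "('o, 'a) addition_data" where
  "Q = \<lparr>prob = pob, pr1 = p1, pr2 = p2, adq = ad, trm = one, zrq = zr\<rparr>"

definition plus :: "'a \<Rightarrow> 'a \<Rightarrow> 'a"  (infixl "\<oplus>" 65) where
  "x \<oplus> y = ad (Cod U x) (Cod U y) \<cdot> pairing x y"

definition bang :: "'o \<Rightarrow> 'a" where "bang T = (THE t. in_hom U t T one)"

definition zero :: "'o \<Rightarrow> 'a" where "zero T = zr \<cdot> bang T"

lemma gen_add_eq: "gen_add U Q = plus"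
  by (intro ext) (simp add: gen_add_def plus_def pairing_def Q_def)

lemma gen_zero_eq: "gen_zero U Q = zero"
  by (intro ext) (simp add: gen_zero_def zero_def bang_def Q_def)

lemma bang_ex1: "T \<in> Ob U \<Longrightarrow> \<exists>!t. in_hom U t T one"
  using one_terminal by (auto simp: is_terminal_def)

lemma bang [simp]: "T \<in> Ob U \<Longrightarrow> bang T \<in> Ar U" "T \<in> Ob U \<Longrightarrow> Dom U (bang T) = T"
    "T \<in> Ob U \<Longrightarrow> Cod U (bang T) = one"
  using theI'[OF bang_ex1, folded bang_def] by (auto simp: in_hom_def)

lemma bang_unique: "t \<in> Ar U \<Longrightarrow> Cod U t = one \<Longrightarrow> t = bang (Dom U t)"
  using bang_ex1[of "Dom U t"] bang[of "Dom U t"] Ob_dom[of t] unfolding in_hom_def by metis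

lemma zero_simps [simp]: "T \<in> Ob U \<Longrightarrow> zero T \<in> Ar U" "T \<in> Ob U \<Longrightarrow> Dom U (zero T) = T"
    "T \<in> Ob U \<Longrightarrow> Cod U (zero T) = ten_unit"
  by (auto simp: zero_def)

lemma zero_comp [simp]: "t \<in> Ar U \<Longrightarrow> Cod U t = T \<Longrightarrow> zero T \<cdot> t = zero (Dom U t)"
  using bang_unique[of "bang T \<cdot> t"] by (auto simp: zero_def)

lemma F_zero [simp]: "T \<in> Ob U \<Longrightarrow> FAr F (zero T) = smod_zero (FOb F T) V"
  using F_hom'[of "bang T"] by (simp add: zero_def F_comp' smod_zero_comp)

lemma plus_simps [simp]:
  assumes "x \<in> Ar U" "y \<in> Ar U" "Dom U x = Dom U y" "fib (Cod U x)" "fib (Cod U y)"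
  shows "x \<oplus> y \<in> Ar U" "Dom U (x \<oplus> y) = Dom U y" "Cod U (x \<oplus> y) = tens (Cod U x) (Cod U y)"
  using assms by (auto simp: plus_def)

text \<open>Naturality in the domain: any sum of generalised elements is obtained from the sum of
  projections by precomposition.\<close>

lemma plus_comp [simp]:
  assumes "x \<in> Ar U" "y \<in> Ar U" "Dom U x = Dom U y" "fib (Cod U x)" "fib (Cod U y)"
    "t \<in> Ar U" "Cod U t = Dom U y"
  shows "(x \<oplus> y) \<cdot> t = (x \<cdot> t) \<oplus> (y \<cdot> t)"
  using assms by (auto simp: plus_def)

text \<open>\<open>ad\<close> lies over the sum of the projections. Precomposition with
  \<open>pairing x y\<close> distributes over this sum and turns the projections into
  \<open>x\<close> and \<open>y\<close>.\<close>

lemma F_plus [simp]: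
  assumes "x \<in> Ar U" "y \<in> Ar U" "Dom U x = Dom U y" "fib (Cod U x)" "fib (Cod U y)"
  shows "FAr F (x \<oplus> y) = smod_add (FAr F x) (FAr F y)"
proof -
  let ?X = "Cod U x" and ?Y = "Cod U y"
  have "FAr F (x \<oplus> y) = smod_add (FAr F (p1 ?X ?Y)) (FAr F (p2 ?X ?Y)) \<cdot>\<^bsub>can_Smod M\<^esub> FAr F (pairing x y)"
    using assms by (simp add: plus_def F_comp')
  also have "\<dots> = smod_add (FAr F (p1 ?X ?Y \<cdot> pairing x y)) (FAr F (p2 ?X ?Y \<cdot> pairing x y))"
    using assms F_hom'[of "p1 ?X ?Y"] F_hom'[of "p2 ?X ?Y"] F_hom'[of "pairing x y"]
    by (subst smod_add_comp[where W = "FOb F (pob ?X ?Y)" and V = V and W' = "FOb F (Dom U y)"])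
       (auto simp: F_comp' simp del: pairing(4,5))
  finally show ?thesis using assms by simp
qed

text \<open>Generic arrows play the role of generalised elements: morphisms of the fibre out of their codomain
  are determined by, and can be prescribed on, them.\<close>

definition generic :: "'a \<Rightarrow> bool" where "generic e \<longleftrightarrow> e \<in> Ar U \<and> fib (Cod U e) \<and> G e"

text \<open>The opcartesian property is applied with the identity of \<open>V\<close> as the arrow
  below; equality of the two images is then exactly the required factorisation.\<close>

lemma generic_ex1:
  assumes "generic e" "g \<in> Ar U" "Dom U g = Dom U e" "fib (Cod U g)" "FAr F g = FAr F e"
  shows "\<exists>!h. fibar h \<and> Dom U h = Cod U e \<and> Cod U h = Cod U g \<and> h \<cdot> e = g"
proof -
  have e: "e \<in> Ar U" "fib (Cod U e)" "G e" using assms by (simp_all add: generic_def)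
  have "is_opcartesian F e" using e by (intro G_opcartesian)
  have "\<exists>!h. in_hom U h (Cod U e) (Cod U g) \<and> FAr F h = Idn (can_Smod M) V \<and> h \<cdot> e = g"
    using e(2) assms smod_idn_hom[OF V_semimodule] smod_idn_comp[OF F_hom_fib[OF e(1,2)]]
    by (intro \<open>is_opcartesian F e\<close>[unfolded is_opcartesian_def Let_def Src_F Tgt_F, THEN conjunct2,
        THEN spec[where x = g], THEN spec[where x = "Idn (can_Smod M) V"], THEN mp] conjI) simp_all
  moreover have "(in_hom U h (Cod U e) (Cod U g) \<and> FAr F h = Idn (can_Smod M) V \<and> h \<cdot> e = g) \<longleftrightarrow>
    (fibar h \<and> Dom U h = Cod U e \<and> Cod U h = Cod U g \<and> h \<cdot> e = g)" for h
    using hom_fibar_iff[OF e(2) assms(4), of h] by blast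
  ultimately show ?thesis by simp
qed

definition ind :: "'a \<Rightarrow> 'a \<Rightarrow> 'a" where
  "ind e g = (THE h. fibar h \<and> Dom U h = Cod U e \<and> Cod U h = Cod U g \<and> h \<cdot> e = g)"

lemma ind:
  assumes "generic e" "g \<in> Ar U" "Dom U g = Dom U e" "fib (Cod U g)" "FAr F g = FAr F e"
  shows "fibar (ind e g)" "Dom U (ind e g) = Cod U e" "Cod U (ind e g) = Cod U g" "ind e g \<cdot> e = g"
  using theI'[OF generic_ex1[OF assms], folded ind_def] by auto

lemma generic_cancel:
  assumes "generic e" "fibar f" "fibar f'" "Dom U f = Cod U e" "Dom U f' = Cod U e"
    "Cod U f = Cod U f'" "f \<cdot> e = f' \<cdot> e"
  shows "f = f'"
  using generic_ex1[OF assms(1), of "f \<cdot> e"] assms by (auto simp: generic_def)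

lemma genericI: "e \<in> Ar U \<Longrightarrow> fib (Cod U e) \<Longrightarrow> G e \<Longrightarrow> generic e"
  by (simp add: generic_def)

lemma generic_Ar [simp]: "generic e \<Longrightarrow> e \<in> Ar U" "generic e \<Longrightarrow> fib (Cod U e)" "generic e \<Longrightarrow> G e"
  by (auto simp: generic_def)

lemma generic_idn [simp]: "fib X \<Longrightarrow> generic (Idn U X)"
  by (rule genericI) (auto simp: G_idn)

lemma generic_zr [simp]: "generic zr"
  by (rule genericI) auto

text \<open>An external sum: the summands keep their own domains. Iterated on identities and
  \<open>zr\<close>, it gives the universal sum on an iterated tensor product.\<close>

definition xplus :: "'a \<Rightarrow> 'a \<Rightarrow> 'a" where
  "xplus x y = (x \<cdot> p1 (Dom U x) (Dom U y)) \<oplus> (y \<cdot> p2 (Dom U x) (Dom U y))"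

text \<open>\<open>xplus x y\<close> is \<open>ad\<close> after the product of \<open>x\<close> and
  \<open>y\<close>. The product lies in \<open>G\<close> by \<open>G_product\<close>, the composite
  by \<open>G_comp\<close>; iteration reaches tensor products of any length.\<close>

lemma generic_xplus [simp]:
  assumes "generic x" "generic y"
  shows "generic (xplus x y)"
proof -
  let ?X = "Dom U x" and ?Y = "Dom U y"
  let ?h = "pairing (x \<cdot> p1 ?X ?Y) (y \<cdot> p2 ?X ?Y)"
  have "G ?h"
    by (rule G_product[of x ?X "Cod U x" y ?Y "Cod U y"])
       (use assms in \<open>auto simp: in_hom_def\<close>)
  then have "G (ad (Cod U x) (Cod U y) \<cdot> ?h)"
    by (intro G_comp[of ?h "pob ?X ?Y" "pob (Cod U x) (Cod U y)" _ "tens (Cod U x) (Cod U y)"])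
       (use assms in \<open>auto simp: in_hom_def\<close>)
  then show ?thesis using assms by (intro genericI) (simp_all add: xplus_def plus_def)
qed

lemma xplus_simps [simp]:
  assumes "x \<in> Ar U" "y \<in> Ar U" "fib (Cod U x)" "fib (Cod U y)"
  shows "Dom U (xplus x y) = pob (Dom U x) (Dom U y)" "Cod U (xplus x y) = tens (Cod U x) (Cod U y)"
   "xplus x y \<in> Ar U"
  using assms by (auto simp: xplus_def)

text \<open>Each structure arrow has the form \<open>ind e g\<close>, with \<open>e\<close> a
  universal sum and \<open>g\<close> the value prescribed on it. It exists once \<open>e\<close> and
  \<open>g\<close> have the same image under \<open>F\<close>; for the constraints this is where
  associativity, neutrality and commutativity in \<open>V\<close> enter.\<close>

definition tens_ar :: "'a \<Rightarrow> 'a \<Rightarrow> 'a" where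
  "tens_ar f g = ind (xplus (Idn U (Dom U f)) (Idn U (Dom U g))) (xplus f g)"

definition assoc :: "'o \<Rightarrow> 'o \<Rightarrow> 'o \<Rightarrow> 'a" where
  "assoc X Y Z = (let e = xplus (xplus (Idn U X) (Idn U Y)) (Idn U Z); P = pob X Y;
     x = p1 X Y \<cdot> p1 P Z; y = p2 X Y \<cdot> p1 P Z; z = p2 P Z in ind e (x \<oplus> (y \<oplus> z)))"

definition assoc_inv :: "'o \<Rightarrow> 'o \<Rightarrow> 'o \<Rightarrow> 'a" where
  "assoc_inv X Y Z = (let e = xplus (Idn U X) (xplus (Idn U Y) (Idn U Z)); P = pob Y Z;
     x = p1 X P; y = p1 Y Z \<cdot> p2 X P; z = p2 Y Z \<cdot> p2 X P in ind e ((x \<oplus> y) \<oplus> z))"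

definition lunit :: "'o \<Rightarrow> 'a" where "lunit X = ind (xplus zr (Idn U X)) (p2 one X)"

definition runit :: "'o \<Rightarrow> 'a" where "runit X = ind (xplus (Idn U X) zr) (p1 X one)"

definition swap_ar :: "'o \<Rightarrow> 'o \<Rightarrow> 'a" where
  "swap_ar X Y = ind (xplus (Idn U X) (Idn U Y)) (p2 X Y \<oplus> p1 X Y)"

section \<open>Structure arrows and their values on sums\<close>

lemma F_smod: "X \<in> Ob U \<Longrightarrow> can_semimodule M (FOb F X)"
  using F_hom'[of "Idn U X"] by (auto simp: in_hom_can_Smod)

lemma add_assoc_F:
  assumes "x \<in> Ar U" "y \<in> Ar U" "z \<in> Ar U" "Dom U x = Dom U z" "Dom U y = Dom U z"
    "fib (Cod U x)" "fib (Cod U y)" "fib (Cod U z)"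
  shows "smod_add (smod_add (FAr F x) (FAr F y)) (FAr F z) = smod_add (FAr F x) (smod_add (FAr F y) (FAr F z))"
  using assms F_hom_fib[of x] F_hom_fib[of y] F_hom_fib[of z] by (intro smod_add_assoc) auto

lemma add_comm_F:
  assumes "x \<in> Ar U" "y \<in> Ar U" "Dom U x = Dom U y"
    "fib (Cod U x)" "fib (Cod U y)"
  shows "smod_add (FAr F x) (FAr F y) = smod_add (FAr F y) (FAr F x)"
  using assms F_hom_fib[of x] F_hom_fib[of y] by (intro smod_add_comm) auto

lemma add_zero_F:
  assumes "x \<in> Ar U" "fib (Cod U x)" "W = FOb F (Dom U x)"
  shows "smod_add (smod_zero W V) (FAr F x) = FAr F x" "smod_add (FAr F x) (smod_zero W V) = FAr F x"
proof -
  have x: "in_hom (can_Smod M) (FAr F x) W V" using assms F_hom_fib[of x] by auto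
  then show "smod_add (smod_zero W V) (FAr F x) = FAr F x" by (rule smod_add_zero)
  have "in_hom (can_Smod M) (smod_zero W V) W V"
    using assms by (auto intro!: smod_zero_hom F_smod V_semimodule)
  with x show "smod_add (FAr F x) (smod_zero W V) = FAr F x"
    using smod_add_comm smod_add_zero by metis
qed

lemma zr_comp [simp]: "t \<in> Ar U \<Longrightarrow> Cod U t = one \<Longrightarrow> zr \<cdot> t = zero (Dom U t)"
  unfolding zero_def using bang_unique by metis

text \<open>By precomposition the value prescribed on the universal sum determines the value on
  every sum of generalised elements.\<close>

lemma ind_comp:
  assumes "generic e" "g \<in> Ar U" "Dom U g = Dom U e" "fib (Cod U g)" "FAr F g = FAr F e"
    "t \<in> Ar U" "Cod U t = Dom U e"
  shows "ind e g \<cdot> (e \<cdot> t) = g \<cdot> t"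
proof -
  have "ind e g \<cdot> (e \<cdot> t) = (ind e g \<cdot> e) \<cdot> t"
    by (rule comp_assoc'[symmetric]) (use assms ind[OF assms(1-5)] in auto)
  then show ?thesis using ind(4)[OF assms(1-5)] by simp
qed

lemma tens_ar:
  assumes "fibar f" "fibar g"
  shows "fibar (tens_ar f g)" "Dom U (tens_ar f g) = tens (Dom U f) (Dom U g)"
    "Cod U (tens_ar f g) = tens (Cod U f) (Cod U g)"
    and "x \<in> Ar U \<Longrightarrow> y \<in> Ar U \<Longrightarrow> Dom U x = Dom U y \<Longrightarrow> Cod U x = Dom U f \<Longrightarrow> Cod U y = Dom U g \<Longrightarrow>
       tens_ar f g \<cdot> (x \<oplus> y) = (f \<cdot> x) \<oplus> (g \<cdot> y)"
proof -
  let ?e = "xplus (Idn U (Dom U f)) (Idn U (Dom U g))" and ?g = "xplus f g"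
  have e: "generic ?e" "?g \<in> Ar U" "Dom U ?g = Dom U ?e" "fib (Cod U ?g)" "FAr F ?g = FAr F ?e"
    using assms by (simp_all, simp_all add: xplus_def)
  show "fibar (tens_ar f g)" "Dom U (tens_ar f g) = tens (Dom U f) (Dom U g)"
    "Cod U (tens_ar f g) = tens (Cod U f) (Cod U g)"
    using ind[OF e, folded tens_ar_def] assms by simp_all
  assume xy: "x \<in> Ar U" "y \<in> Ar U" "Dom U x = Dom U y" "Cod U x = Dom U f" "Cod U y = Dom U g"
  \<comment> \<open>Both sides are pulled back from the universal case along the pairing of the two
    generalised elements. The constraint isomorphisms are evaluated by the same device.\<close>
  then have eqs: "x \<oplus> y = ?e \<cdot> pairing x y" "(f \<cdot> x) \<oplus> (g \<cdot> y) = ?g \<cdot> pairing x y"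
    using assms by (simp_all add: xplus_def)
  have "ind ?e ?g \<cdot> (?e \<cdot> pairing x y) = ?g \<cdot> pairing x y"
    by (rule ind_comp[OF e]) (use assms xy in simp_all)
  then show "tens_ar f g \<cdot> (x \<oplus> y) = (f \<cdot> x) \<oplus> (g \<cdot> y)" by (simp only: eqs tens_ar_def)
qed

lemma assoc:
  assumes "fib X" "fib Y" "fib Z"
  shows "fibar (assoc X Y Z)" "Dom U (assoc X Y Z) = tens (tens X Y) Z"
    "Cod U (assoc X Y Z) = tens X (tens Y Z)"
    and "x \<in> Ar U \<Longrightarrow> y \<in> Ar U \<Longrightarrow> z \<in> Ar U \<Longrightarrow> Dom U x = Dom U z \<Longrightarrow> Dom U y = Dom U z \<Longrightarrow>
      Cod U x = X \<Longrightarrow> Cod U y = Y \<Longrightarrow> Cod U z = Z \<Longrightarrow> assoc X Y Z \<cdot> ((x \<oplus> y) \<oplus> z) = x \<oplus> (y \<oplus> z)"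
proof -
  let ?e = "xplus (xplus (Idn U X) (Idn U Y)) (Idn U Z)" and ?P = "pob X Y"
  let ?g = "(p1 X Y \<cdot> p1 ?P Z) \<oplus> ((p2 X Y \<cdot> p1 ?P Z) \<oplus> p2 ?P Z)"
  have e: "generic ?e" "?g \<in> Ar U" "Dom U ?g = Dom U ?e" "fib (Cod U ?g)" "FAr F ?g = FAr F ?e"
    using assms by (simp_all, simp_all add: xplus_def add_assoc_F)
  have eq: "assoc X Y Z = ind ?e ?g" by (simp add: assoc_def Let_def)
  show "fibar (assoc X Y Z)" "Dom U (assoc X Y Z) = tens (tens X Y) Z"
    "Cod U (assoc X Y Z) = tens X (tens Y Z)"
    using ind[OF e, folded eq] assms by simp_all
  assume xy: "x \<in> Ar U" "y \<in> Ar U" "z \<in> Ar U" "Dom U x = Dom U z" "Dom U y = Dom U z"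
    "Cod U x = X" "Cod U y = Y" "Cod U z = Z"
  let ?t = "pairing (pairing x y) z"
  have eqs: "(x \<oplus> y) \<oplus> z = ?e \<cdot> ?t" "x \<oplus> (y \<oplus> z) = ?g \<cdot> ?t"
    using assms xy by (simp_all add: xplus_def)
  have "ind ?e ?g \<cdot> (?e \<cdot> ?t) = ?g \<cdot> ?t"
    by (rule ind_comp[OF e]) (use assms xy in simp_all)
  then show "assoc X Y Z \<cdot> ((x \<oplus> y) \<oplus> z) = x \<oplus> (y \<oplus> z)" by (simp only: eqs eq)
qed

lemma assoc_inv:
  assumes "fib X" "fib Y" "fib Z"
  shows "fibar (assoc_inv X Y Z)" "Dom U (assoc_inv X Y Z) = tens X (tens Y Z)"
    "Cod U (assoc_inv X Y Z) = tens (tens X Y) Z"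
    and "x \<in> Ar U \<Longrightarrow> y \<in> Ar U \<Longrightarrow> z \<in> Ar U \<Longrightarrow> Dom U x = Dom U z \<Longrightarrow> Dom U y = Dom U z \<Longrightarrow>
      Cod U x = X \<Longrightarrow> Cod U y = Y \<Longrightarrow> Cod U z = Z \<Longrightarrow> assoc_inv X Y Z \<cdot> (x \<oplus> (y \<oplus> z)) = (x \<oplus> y) \<oplus> z"
proof -
  let ?e = "xplus (Idn U X) (xplus (Idn U Y) (Idn U Z))" and ?P = "pob Y Z"
  let ?g = "(p1 X ?P \<oplus> (p1 Y Z \<cdot> p2 X ?P)) \<oplus> (p2 Y Z \<cdot> p2 X ?P)"
  have e: "generic ?e" "?g \<in> Ar U" "Dom U ?g = Dom U ?e" "fib (Cod U ?g)" "FAr F ?g = FAr F ?e"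
    using assms by (simp_all, simp_all add: xplus_def add_assoc_F)
  have eq: "assoc_inv X Y Z = ind ?e ?g" by (simp add: assoc_inv_def Let_def)
  show "fibar (assoc_inv X Y Z)" "Dom U (assoc_inv X Y Z) = tens X (tens Y Z)"
    "Cod U (assoc_inv X Y Z) = tens (tens X Y) Z"
    using ind[OF e, folded eq] assms by simp_all
  assume xy: "x \<in> Ar U" "y \<in> Ar U" "z \<in> Ar U" "Dom U x = Dom U z" "Dom U y = Dom U z"
    "Cod U x = X" "Cod U y = Y" "Cod U z = Z"
  let ?t = "pairing x (pairing y z)"
  have eqs: "x \<oplus> (y \<oplus> z) = ?e \<cdot> ?t" "(x \<oplus> y) \<oplus> z = ?g \<cdot> ?t"
    using assms xy by (simp_all add: xplus_def)
  have "ind ?e ?g \<cdot> (?e \<cdot> ?t) = ?g \<cdot> ?t"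
    by (rule ind_comp[OF e]) (use assms xy in simp_all)
  then show "assoc_inv X Y Z \<cdot> (x \<oplus> (y \<oplus> z)) = (x \<oplus> y) \<oplus> z" by (simp only: eqs eq)
qed

lemma lunit:
  assumes "fib X"
  shows "fibar (lunit X)" "Dom U (lunit X) = tens ten_unit X" "Cod U (lunit X) = X"
    and "x \<in> Ar U \<Longrightarrow> Cod U x = X \<Longrightarrow> Dom U x = T \<Longrightarrow> lunit X \<cdot> (zero T \<oplus> x) = x"
proof -
  let ?e = "xplus zr (Idn U X)" and ?g = "p2 one X"
  have e: "generic ?e" "?g \<in> Ar U" "Dom U ?g = Dom U ?e" "fib (Cod U ?g)" "FAr F ?g = FAr F ?e"
    using assms by (simp_all, simp_all add: xplus_def add_zero_F)
  note eq = lunit_def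
  show "fibar (lunit X)" "Dom U (lunit X) = tens ten_unit X" "Cod U (lunit X) = X"
    using ind[OF e, folded eq] assms by simp_all
  assume xy: "x \<in> Ar U" "Cod U x = X" "Dom U x = T"
  \<comment> \<open>The universal sum involving \<open>zr\<close> starts at
    \<open>pob one X\<close>, so its unit component is supplied by the arrow to the terminal
    object.\<close>
  let ?t = "pairing (bang T) x"
  have T: "T \<in> Ob U" using xy by auto
  have eqs: "zero T \<oplus> x = ?e \<cdot> ?t" "x = ?g \<cdot> ?t"
    using assms xy T by (simp_all add: xplus_def)
  have "ind ?e ?g \<cdot> (?e \<cdot> ?t) = ?g \<cdot> ?t"
    by (rule ind_comp[OF e]) (use assms xy T in simp_all)
  then show "lunit X \<cdot> (zero T \<oplus> x) = x" by (simp only: eqs(1) eqs(2)[symmetric] eq)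
qed

lemma runit:
  assumes "fib X"
  shows "fibar (runit X)" "Dom U (runit X) = tens X ten_unit" "Cod U (runit X) = X"
    and "x \<in> Ar U \<Longrightarrow> Cod U x = X \<Longrightarrow> Dom U x = T \<Longrightarrow> runit X \<cdot> (x \<oplus> zero T) = x"
proof -
  let ?e = "xplus (Idn U X) zr" and ?g = "p1 X one"
  have e: "generic ?e" "?g \<in> Ar U" "Dom U ?g = Dom U ?e" "fib (Cod U ?g)" "FAr F ?g = FAr F ?e"
    using assms by (simp_all, simp_all add: xplus_def add_zero_F)
  note eq = runit_def
  show "fibar (runit X)" "Dom U (runit X) = tens X ten_unit" "Cod U (runit X) = X"
    using ind[OF e, folded eq] assms by simp_all
  assume xy: "x \<in> Ar U" "Cod U x = X" "Dom U x = T"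
  let ?t = "pairing x (bang T)"
  have T: "T \<in> Ob U" using xy by auto
  have eqs: "x \<oplus> zero T = ?e \<cdot> ?t" "x = ?g \<cdot> ?t"
    using assms xy T by (simp_all add: xplus_def)
  have "ind ?e ?g \<cdot> (?e \<cdot> ?t) = ?g \<cdot> ?t"
    by (rule ind_comp[OF e]) (use assms xy T in simp_all)
  then show "runit X \<cdot> (x \<oplus> zero T) = x" by (simp only: eqs(1) eqs(2)[symmetric] eq)
qed

lemma swap_ar:
  assumes "fib X" "fib Y"
  shows "fibar (swap_ar X Y)" "Dom U (swap_ar X Y) = tens X Y" "Cod U (swap_ar X Y) = tens Y X"
    and "x \<in> Ar U \<Longrightarrow> y \<in> Ar U \<Longrightarrow> Dom U x = Dom U y \<Longrightarrow> Cod U x = X \<Longrightarrow> Cod U y = Y \<Longrightarrow>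
       swap_ar X Y \<cdot> (x \<oplus> y) = y \<oplus> x"
proof -
  let ?e = "xplus (Idn U X) (Idn U Y)" and ?g = "p2 X Y \<oplus> p1 X Y"
  have e: "generic ?e" "?g \<in> Ar U" "Dom U ?g = Dom U ?e" "fib (Cod U ?g)" "FAr F ?g = FAr F ?e"
    using assms by (simp_all, simp_all add: xplus_def add_comm_F)
  note eq = swap_ar_def
  show "fibar (swap_ar X Y)" "Dom U (swap_ar X Y) = tens X Y" "Cod U (swap_ar X Y) = tens Y X"
    using ind[OF e, folded eq] assms by simp_all
  assume xy: "x \<in> Ar U" "y \<in> Ar U" "Dom U x = Dom U y" "Cod U x = X" "Cod U y = Y"
  let ?t = "pairing x y"
  have eqs: "x \<oplus> y = ?e \<cdot> ?t" "y \<oplus> x = ?g \<cdot> ?t"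
    using assms xy by (simp_all add: xplus_def)
  have "ind ?e ?g \<cdot> (?e \<cdot> ?t) = ?g \<cdot> ?t"
    by (rule ind_comp[OF e]) (use assms xy in simp_all)
  then show "swap_ar X Y \<cdot> (x \<oplus> y) = y \<oplus> x" by (simp only: eqs eq)
qed

lemmas [simp] = tens_ar assoc assoc_inv lunit runit swap_ar

text \<open>The universal sum can be cancelled, and it is itself the sum of the two projections,
  hence among the sums on which agreement is assumed. The longer versions below rest on the same
  observation.\<close>

lemma ext2:
  assumes "fib X" "fib Y" "fibar f" "fibar f'" "Dom U f = tens X Y" "Dom U f' = tens X Y" "Cod U f = Cod U f'"
    and eq: "\<And>x y. x \<in> Ar U \<Longrightarrow> y \<in> Ar U \<Longrightarrow> Dom U x = Dom U y \<Longrightarrow> Cod U x = X \<Longrightarrow> Cod U y = Y \<Longrightarrow>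
      f \<cdot> (x \<oplus> y) = f' \<cdot> (x \<oplus> y)"
  shows "f = f'"
  by (rule generic_cancel[of "xplus (Idn U X) (Idn U Y)"])
     (use assms(1-7) in \<open>simp_all, simp_all add: xplus_def eq\<close>)

lemma ext3:
  assumes "fib X" "fib Y" "fib Z" "fibar f" "fibar f'" "Dom U f = tens (tens X Y) Z"
    "Dom U f' = tens (tens X Y) Z" "Cod U f = Cod U f'"
    and eq: "\<And>x y z. x \<in> Ar U \<Longrightarrow> y \<in> Ar U \<Longrightarrow> z \<in> Ar U \<Longrightarrow> Dom U x = Dom U z \<Longrightarrow> Dom U y = Dom U z \<Longrightarrow>
      Cod U x = X \<Longrightarrow> Cod U y = Y \<Longrightarrow> Cod U z = Z \<Longrightarrow> f \<cdot> ((x \<oplus> y) \<oplus> z) = f' \<cdot> ((x \<oplus> y) \<oplus> z)"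
  shows "f = f'"
  by (rule generic_cancel[of "xplus (xplus (Idn U X) (Idn U Y)) (Idn U Z)"])
     (use assms(1-8) in \<open>simp_all, simp_all add: xplus_def eq\<close>)

lemma ext3':
  assumes "fib X" "fib Y" "fib Z" "fibar f" "fibar f'" "Dom U f = tens X (tens Y Z)"
    "Dom U f' = tens X (tens Y Z)" "Cod U f = Cod U f'"
    and eq: "\<And>x y z. x \<in> Ar U \<Longrightarrow> y \<in> Ar U \<Longrightarrow> z \<in> Ar U \<Longrightarrow> Dom U x = Dom U z \<Longrightarrow> Dom U y = Dom U z \<Longrightarrow>
      Cod U x = X \<Longrightarrow> Cod U y = Y \<Longrightarrow> Cod U z = Z \<Longrightarrow> f \<cdot> (x \<oplus> (y \<oplus> z)) = f' \<cdot> (x \<oplus> (y \<oplus> z))"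
  shows "f = f'"
  by (rule generic_cancel[of "xplus (Idn U X) (xplus (Idn U Y) (Idn U Z))"])
     (use assms(1-8) in \<open>simp_all, simp_all add: xplus_def eq\<close>)

lemma ext4:
  assumes "fib W" "fib X" "fib Y" "fib Z" "fibar f" "fibar f'" "Dom U f = tens (tens (tens W X) Y) Z"
    "Dom U f' = tens (tens (tens W X) Y) Z" "Cod U f = Cod U f'"
    and eq: "\<And>w x y z. w \<in> Ar U \<Longrightarrow> x \<in> Ar U \<Longrightarrow> y \<in> Ar U \<Longrightarrow> z \<in> Ar U \<Longrightarrow>
      Dom U w = Dom U z \<Longrightarrow> Dom U x = Dom U z \<Longrightarrow> Dom U y = Dom U z \<Longrightarrow>
      Cod U w = W \<Longrightarrow> Cod U x = X \<Longrightarrow> Cod U y = Y \<Longrightarrow> Cod U z = Z \<Longrightarrow>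
      f \<cdot> (((w \<oplus> x) \<oplus> y) \<oplus> z) = f' \<cdot> (((w \<oplus> x) \<oplus> y) \<oplus> z)"
  shows "f = f'"
  by (rule generic_cancel[of "xplus (xplus (xplus (Idn U W) (Idn U X)) (Idn U Y)) (Idn U Z)"])
     (use assms(1-9) in \<open>simp_all, simp_all add: xplus_def eq\<close>)

text \<open>\<open>zr\<close> starts at the terminal object, so in the unit factor it suffices to
  test \<open>zero\<close>; the universal sum is the case \<open>x = p2 one X\<close>.\<close>

lemma ext_zero_left:
  assumes "fib X" "fibar f" "fibar f'" "Dom U f = tens ten_unit X" "Dom U f' = tens ten_unit X" "Cod U f = Cod U f'"
    and eq: "\<And>x. x \<in> Ar U \<Longrightarrow> Cod U x = X \<Longrightarrow> f \<cdot> (zero (Dom U x) \<oplus> x) = f' \<cdot> (zero (Dom U x) \<oplus> x)"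
  shows "f = f'"
  by (rule generic_cancel[of "xplus zr (Idn U X)"])
     (use assms(1-6) eq[of "p2 one X"] in \<open>simp_all, simp_all add: xplus_def\<close>)

lemma ext_zero_right:
  assumes "fib X" "fibar f" "fibar f'" "Dom U f = tens X ten_unit" "Dom U f' = tens X ten_unit" "Cod U f = Cod U f'"
    and eq: "\<And>x. x \<in> Ar U \<Longrightarrow> Cod U x = X \<Longrightarrow> f \<cdot> (x \<oplus> zero (Dom U x)) = f' \<cdot> (x \<oplus> zero (Dom U x))"
  shows "f = f'"
  by (rule generic_cancel[of "xplus (Idn U X) zr"])
     (use assms(1-6) eq[of "p1 X one"] in \<open>simp_all, simp_all add: xplus_def\<close>)

lemma ext_zero_mid:
  assumes "fib X" "fib Y" "fibar f" "fibar f'" "Dom U f = tens (tens X ten_unit) Y"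
    "Dom U f' = tens (tens X ten_unit) Y" "Cod U f = Cod U f'"
    and eq: "\<And>x y T. T \<in> Ob U \<Longrightarrow> x \<in> Ar U \<Longrightarrow> y \<in> Ar U \<Longrightarrow> Dom U x = T \<Longrightarrow> Dom U y = T \<Longrightarrow> Cod U x = X \<Longrightarrow> Cod U y = Y \<Longrightarrow>
      f \<cdot> ((x \<oplus> zero T) \<oplus> y) = f' \<cdot> ((x \<oplus> zero T) \<oplus> y)"
  shows "f = f'"
  by (rule generic_cancel[of "xplus (xplus (Idn U X) zr) (Idn U Y)"])
     (use assms(1-7) in \<open>simp_all, simp_all add: xplus_def eq\<close>)

section \<open>The symmetric monoidal structure and its naturality\<close>

definition S :: "('o, 'a) monoidal_data" where
  "S = \<lparr>tob = tens, tar = tens_ar, unt = ten_unit, asc = assoc, lun = lunit, run = runit, swp = swap_ar\<rparr>"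

lemma S_sel: "tob S = tens" "tar S = tens_ar" "unt S = ten_unit" "asc S = assoc" "lun S = lunit"
  "run S = runit" "swp S = swap_ar"
  by (simp_all add: S_def)

lemma Q_sel: "prob Q = pob" "pr1 Q = p1" "pr2 Q = p2" "adq Q = ad" "trm Q = one" "zrq Q = zr"
  by (simp_all add: Q_def)

lemma fibre_isoI:
  assumes "fibar f" "Dom U f = X" "Cod U f = Y" "fibar g" "Dom U g = Y" "Cod U g = X"
    "g \<cdot> f = Idn U X" "f \<cdot> g = Idn U Y"
  shows "is_iso (fibre F V) f X Y"
  using assms by (auto simp: is_iso_def fibre_hom fibre_sel)

lemma assoc_iso: "fib X \<Longrightarrow> fib Y \<Longrightarrow> fib Z \<Longrightarrow>
    is_iso (fibre F V) (assoc X Y Z) (tens (tens X Y) Z) (tens X (tens Y Z))"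
  by (rule fibre_isoI[where g = "assoc_inv X Y Z"])
     (simp_all, (rule ext3[of X Y Z] ext3'[of X Y Z]; simp)+)

text \<open>Provides the inverse of the left unitor, the sum of zero and the identity: adding zero
  leaves the image under \<open>F\<close> unchanged, so the sum stays over the identity of
  \<open>V\<close>.\<close>

lemma fibar_zero_plus: "fibar f \<Longrightarrow> Dom U f = T \<Longrightarrow> fibar (zero T \<oplus> f)"
  using add_zero_F[of f] fibarD(2)[of f] by (intro fibarI) (simp_all del: fibarD(2))

lemma lunit_iso: "fib X \<Longrightarrow> is_iso (fibre F V) (lunit X) (tens ten_unit X) X"
  by (rule fibre_isoI[where g = "zero X \<oplus> Idn U X"])
     (simp_all add: fibar_zero_plus, rule ext_zero_left[of X], simp_all add: fibar_zero_plus)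

lemma fibar_plus_zero: "fibar f \<Longrightarrow> Dom U f = T \<Longrightarrow> fibar (f \<oplus> zero T)"
  using add_zero_F[of f] fibarD(2)[of f] by (intro fibarI) (simp_all del: fibarD(2))

lemma runit_iso: "fib X \<Longrightarrow> is_iso (fibre F V) (runit X) (tens X ten_unit) X"
  by (rule fibre_isoI[where g = "Idn U X \<oplus> zero X"])
     (simp_all add: fibar_plus_zero, rule ext_zero_right[of X], simp_all add: fibar_plus_zero)

lemma swap_swap: "fib X \<Longrightarrow> fib Y \<Longrightarrow> swap_ar Y X \<cdot> swap_ar X Y = Idn U (tens X Y)"
  by (rule ext2[of X Y]) simp_all

lemma swap_iso: "fib X \<Longrightarrow> fib Y \<Longrightarrow> is_iso (fibre F V) (swap_ar X Y) (tens X Y) (tens Y X)"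
  by (rule fibre_isoI[where g = "swap_ar Y X"]) (simp_all add: swap_swap)

theorem symmetric_monoidal_fibre: "symmetric_monoidal_category (fibre F V) S"
proof -
  interpret fib: category "fibre F V" by (rule fibre_category)
  show ?thesis
    apply (unfold_locales; (unfold fibre_hom fibre_Ob fibre_sel S_sel)?)
                   apply (simp_all add: assoc_iso lunit_iso runit_iso swap_iso swap_swap)
    \<comment> \<open>Nine equations remain: functoriality of the tensor product, naturality of the
      constraints, pentagon, triangle and hexagon. In each of them both sides have the same value on
      sums.\<close>
    subgoal for X Y by (rule ext2[of X Y]) simp_all
    subgoal for f f' g g' by (rule ext2[of "Dom U f" "Dom U g"]) simp_all
    subgoal for f g h by (rule ext3[of "Dom U f" "Dom U g" "Dom U h"]) simp_all
    subgoal for f by (rule ext_zero_left[of "Dom U f"]) simp_all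
    subgoal for f by (rule ext_zero_right[of "Dom U f"]) simp_all
    subgoal for f g by (rule ext2[of "Dom U f" "Dom U g"]) simp_all
    subgoal for W X Y Z by (rule ext4[of W X Y Z]) simp_all
    subgoal for X Y by (rule ext_zero_mid[of X Y]) simp_all
    subgoal for X Y Z by (rule ext3[of X Y Z]) simp_all
    done
qed

text \<open>The laws on generalised elements are the values of the structure arrows computed above,
  and \<open>ad\<close> and \<open>zr\<close> are opcartesian as members of
  \<open>G\<close>.\<close>

theorem natural_fibre: "natural_structure F V S"
  unfolding natural_structure_def
  by (rule exI[of _ Q], unfold_locales; (unfold Src_F fibre_hom fibre_Ob S_sel Q_sel gen_add_eq gen_zero_eq in_hom_def[of U])?)
     (simp_all add: pob_product one_terminal G_opcartesian)

end

section \<open>Crossed Schreier extensions elementwise\<close>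

lemma mon_hom_iff:
  "f \<in> mon_hom G H \<longleftrightarrow> (\<forall>x\<in>carrier G. f x \<in> carrier H) \<and>
     (\<forall>x\<in>carrier G. \<forall>y\<in>carrier G. f (x \<otimes>\<^bsub>G\<^esub> y) = f x \<otimes>\<^bsub>H\<^esub> f y) \<and>
     f \<one>\<^bsub>G\<^esub> = \<one>\<^bsub>H\<^esub> \<and> f \<in> extensional (carrier G)"
  by (auto simp: mon_hom_def hom_def)

lemma mon_hom_closed: "f \<in> mon_hom G H \<Longrightarrow> x \<in> carrier G \<Longrightarrow> f x \<in> carrier H"
  and mon_hom_mult: "f \<in> mon_hom G H \<Longrightarrow> x \<in> carrier G \<Longrightarrow> y \<in> carrier G \<Longrightarrow> f (x \<otimes>\<^bsub>G\<^esub> y) = f x \<otimes>\<^bsub>H\<^esub> f y"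
  and mon_hom_one: "f \<in> mon_hom G H \<Longrightarrow> f \<one>\<^bsub>G\<^esub> = \<one>\<^bsub>H\<^esub>"
  and mon_hom_ext: "f \<in> mon_hom G H \<Longrightarrow> f \<in> extensional (carrier G)"
  by (auto simp: mon_hom_iff)

lemma mon_hom_eqI:
  "f \<in> mon_hom G H \<Longrightarrow> g \<in> mon_hom G H' \<Longrightarrow> (\<And>x. x \<in> carrier G \<Longrightarrow> f x = g x) \<Longrightarrow> f = g"
  by (rule extensionalityI[of _ "carrier G"]) (auto simp: mon_hom_iff)

lemma mon_hom_compose:
  "monoid G \<Longrightarrow> f \<in> mon_hom G H \<Longrightarrow> g \<in> mon_hom H K \<Longrightarrow> compose (carrier G) g f \<in> mon_hom G K"
  by (auto simp: mon_hom_iff compose_def monoid.m_closed monoid.one_closed)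

lemma mon_hom_id: "monoid G \<Longrightarrow> (\<lambda>x\<in>carrier G. x) \<in> mon_hom G G"
  by (auto simp: mon_hom_iff monoid.m_closed monoid.one_closed)

text \<open>Endomorphisms and the operations of \<open>End_monoid\<close> are extensional, so
  equations between endomorphisms may be tested on the carrier.\<close>

lemma action_hom_iff:
  assumes "monoid C"
  shows "\<alpha> \<in> mon_hom C (End_monoid B) \<longleftrightarrow> (\<forall>c\<in>carrier C. \<alpha> c \<in> mon_hom B B) \<and>
     (\<forall>c\<in>carrier C. \<forall>c'\<in>carrier C. \<forall>b\<in>carrier B. \<alpha> (c \<otimes>\<^bsub>C\<^esub> c') b = \<alpha> c (\<alpha> c' b)) \<and>
     (\<forall>b\<in>carrier B. \<alpha> \<one>\<^bsub>C\<^esub> b = b) \<and> \<alpha> \<in> extensional (carrier C)"  (is "?L \<longleftrightarrow> ?R")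
proof
  assume ?L
  then show ?R by (auto simp: mon_hom_iff[of \<alpha>] End_monoid_def compose_def)
next
  assume R: ?R
  interpret monoid C by fact
  have "\<alpha> (c \<otimes>\<^bsub>C\<^esub> c') = compose (carrier B) (\<alpha> c) (\<alpha> c')" if "c \<in> carrier C" "c' \<in> carrier C" for c c'
    by (rule extensionalityI[of _ "carrier B"]) (use R that in \<open>auto simp: compose_def mon_hom_iff\<close>)
  moreover have "\<alpha> \<one>\<^bsub>C\<^esub> = (\<lambda>x\<in>carrier B. x)"
    by (rule extensionalityI[of _ "carrier B"]) (use R in \<open>auto simp: mon_hom_iff\<close>)
  ultimately show ?L using R by (simp add: mon_hom_iff[of \<alpha>] End_monoid_def)
qed

lemma submonoid_monoid:
  assumes "monoid X" "N \<subseteq> carrier X" "\<one>\<^bsub>X\<^esub> \<in> N" "\<And>x y. x \<in> N \<Longrightarrow> y \<in> N \<Longrightarrow> x \<otimes>\<^bsub>X\<^esub> y \<in> N"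
  shows "monoid (X\<lparr>carrier := N\<rparr>)"
proof -
  interpret monoid X by fact
  show ?thesis using assms by unfold_locales (auto simp: m_assoc subset_iff)
qed

text \<open>The submonoid of elements sent to the neutral one has the same carrier type as
  \<open>X\<close>, so it is among the test objects of the universal property and forces
  \<open>K\<close> to be a copy of it.\<close>

lemma is_kernel_iff:
  assumes K: "monoid K" and X: "monoid X" and f: "f \<in> mon_hom X Y" and Y: "monoid Y"
  shows "is_kernel K k X f Y \<longleftrightarrow> k \<in> mon_hom K X \<and> inj_on k (carrier K) \<and>
    k ` carrier K = {x \<in> carrier X. f x = \<one>\<^bsub>Y\<^esub>}"
proof
  interpret K: monoid K by fact
  interpret X: monoid X by fact
  interpret Y: monoid Y by fact
  assume ker: "is_kernel K k X f Y"
  then have k: "k \<in> mon_hom K X" and fk: "compose (carrier K) f k = zero_hom K Y"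
    by (auto simp: is_kernel_def)
  have fk': "f (k a) = \<one>\<^bsub>Y\<^esub>" if "a \<in> carrier K" for a
    using fun_cong[OF fk, of a] that by (auto simp: zero_hom_def compose_def)
  \<comment> \<open>The test object: the actual submonoid killed by \<open>f\<close>, with its
    inclusion. Its factorisation \<open>h\<close> through \<open>k\<close> will be inverse to
    \<open>k\<close>.\<close>
  let ?Z = "X\<lparr>carrier := {x \<in> carrier X. f x = \<one>\<^bsub>Y\<^esub>}\<rparr>" and ?g = "\<lambda>x\<in>{x \<in> carrier X. f x = \<one>\<^bsub>Y\<^esub>}. x"
  have Z: "monoid ?Z" using X f by (intro submonoid_monoid) (auto simp: mon_hom_iff)
  have g: "?g \<in> mon_hom ?Z X" using f by (auto simp: mon_hom_iff)
  have "compose (carrier ?Z) f ?g = zero_hom ?Z Y" by (auto simp: compose_def zero_hom_def fun_eq_iff)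
  with Z g ker obtain h where h: "h \<in> mon_hom ?Z K" "compose (carrier ?Z) k h = ?g"
    unfolding is_kernel_def by meson
  have kh: "k (h x) = x" if "x \<in> carrier X" "f x = \<one>\<^bsub>Y\<^esub>" for x
    using fun_cong[OF h(2), of x] that by (auto simp: compose_def)
  \<comment> \<open>Both \<open>h\<close> after \<open>k\<close> and the identity factor
    \<open>k\<close> through itself, so uniqueness identifies them; hence \<open>k\<close> is
    injective.\<close>
  have "\<exists>!h. h \<in> mon_hom K K \<and> compose (carrier K) k h = k"
    using K k fk ker unfolding is_kernel_def by blast
  moreover have "compose (carrier K) h k \<in> mon_hom K K"
    using K k h(1) fk' by (auto simp: mon_hom_iff compose_def)
  moreover have "compose (carrier K) k (compose (carrier K) h k) = k"
    using k kh fk' by (intro extensionalityI[of _ "carrier K"]) (auto simp: mon_hom_iff compose_def)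
  moreover have "compose (carrier K) k (\<lambda>x\<in>carrier K. x) = k"
    using k by (intro extensionalityI[of _ "carrier K"]) (auto simp: mon_hom_iff compose_def)
  ultimately have "compose (carrier K) h k = (\<lambda>x\<in>carrier K. x)"
    using mon_hom_id[OF K] by blast
  then have "h (k a) = a" if "a \<in> carrier K" for a
    using that by (auto simp: compose_def fun_eq_iff restrict_def split: if_splits)
  then have "inj_on k (carrier K)" by (metis inj_onI)
  moreover have "x \<in> k ` carrier K" if "x \<in> carrier X" "f x = \<one>\<^bsub>Y\<^esub>" for x
    using kh[OF that] mon_hom_closed[OF h(1), of x] that by (auto intro!: image_eqI[of _ _ "h x"])
  ultimately show "k \<in> mon_hom K X \<and> inj_on k (carrier K) \<and> k ` carrier K = {x \<in> carrier X. f x = \<one>\<^bsub>Y\<^esub>}"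
    using k fk' by (auto simp: mon_hom_iff)
next
  interpret K: monoid K by fact
  interpret X: monoid X by fact
  assume "k \<in> mon_hom K X \<and> inj_on k (carrier K) \<and> k ` carrier K = {x \<in> carrier X. f x = \<one>\<^bsub>Y\<^esub>}"
  then have k: "k \<in> mon_hom K X" and inj: "inj_on k (carrier K)"
    and img: "k ` carrier K = {x \<in> carrier X. f x = \<one>\<^bsub>Y\<^esub>}" by auto
  have "compose (carrier K) f k = zero_hom K Y"
    using img by (auto simp: compose_def zero_hom_def fun_eq_iff)
  moreover have "\<exists>!h. h \<in> mon_hom Z K \<and> compose (carrier Z) k h = g"
    if Z: "monoid Z" and g: "g \<in> mon_hom Z X" and fg: "compose (carrier Z) f g = zero_hom Z Y"
    for Z :: "'a monoid" and g
  proof -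
    interpret Z: monoid Z by fact
    have fg': "g z \<in> k ` carrier K" if "z \<in> carrier Z" for z
      using fun_cong[OF fg, of z] that mon_hom_closed[OF g] unfolding img
      by (auto simp: compose_def zero_hom_def)
    define h where "h = (\<lambda>z\<in>carrier Z. inv_into (carrier K) k (g z))"
    have h: "h z \<in> carrier K" "k (h z) = g z" if "z \<in> carrier Z" for z
      using fg'[OF that] that unfolding h_def by (simp_all add: inv_into_into f_inv_into_f)
    have h_ext: "h \<in> extensional (carrier Z)" by (simp add: h_def)
    have "h (x \<otimes>\<^bsub>Z\<^esub> y) = h x \<otimes>\<^bsub>K\<^esub> h y" if "x \<in> carrier Z" "y \<in> carrier Z" for x y
      by (rule inj_onD[OF inj]) (use that in \<open>simp_all add: h mon_hom_mult[OF g] mon_hom_mult[OF k]\<close>)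
    moreover have "h \<one>\<^bsub>Z\<^esub> = \<one>\<^bsub>K\<^esub>"
      by (rule inj_onD[OF inj]) (simp_all add: h mon_hom_one[OF g] mon_hom_one[OF k])
    ultimately have hom: "h \<in> mon_hom Z K" using h(1) h_ext unfolding mon_hom_iff by auto
    have comp: "compose (carrier Z) k h = g"
      using g h(2) by (intro extensionalityI[of _ "carrier Z"]) (auto simp: mon_hom_iff compose_def)
    show ?thesis
    proof (rule ex1I[of _ h])
      show "h \<in> mon_hom Z K \<and> compose (carrier Z) k h = g" using hom comp by blast
      fix h' assume h': "h' \<in> mon_hom Z K \<and> compose (carrier Z) k h' = g"
      then have "k (h' z) = g z" if "z \<in> carrier Z" for z using that by (auto simp: compose_def)
      then show "h' = h" using h' hom h
        by (intro mon_hom_eqI[of h' Z K], simp_all) (rule inj_onD[OF inj], auto simp: mon_hom_iff[of h'])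
    qed
  qed
  ultimately show "is_kernel K k X f Y" using k by (auto simp: is_kernel_def)
qed

text \<open>Each fibre of \<open>f\<close> consists of left translates of one element by the image
  of \<open>k\<close>. A homomorphism that kills \<open>k\<close> is therefore constant on fibres
  and descends along the surjection \<open>f\<close>.\<close>

lemma is_cokernelI:
  assumes K: "monoid K" and X: "monoid X" and Y: "monoid Y" and f: "f \<in> mon_hom X Y" and k: "k \<in> mon_hom K X"
    and fk: "\<And>a. a \<in> carrier K \<Longrightarrow> f (k a) = \<one>\<^bsub>Y\<^esub>"
    and rep: "\<And>y. y \<in> carrier Y \<Longrightarrow> \<exists>u\<in>carrier X. f u = y \<and>
      (\<forall>x\<in>carrier X. f x = y \<longrightarrow> (\<exists>a\<in>carrier K. x = k a \<otimes>\<^bsub>X\<^esub> u))"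
  shows "is_cokernel K k X f Y"
proof -
  interpret X: monoid X by fact
  interpret Y: monoid Y by fact
  have "\<exists>!h. h \<in> mon_hom Y Z \<and> compose (carrier X) h f = g"
    if Z: "monoid Z" and g: "g \<in> mon_hom X Z" and gk: "compose (carrier K) g k = zero_hom K Z"
    for Z :: "'a monoid" and g
  proof -
    interpret Z: monoid Z by fact
    obtain u where u: "\<And>y. y \<in> carrier Y \<Longrightarrow> u y \<in> carrier X \<and> f (u y) = y \<and>
      (\<forall>x\<in>carrier X. f x = y \<longrightarrow> (\<exists>a\<in>carrier K. x = k a \<otimes>\<^bsub>X\<^esub> u y))"
      using rep by metis
    have gk': "g (k a) = \<one>\<^bsub>Z\<^esub>" if "a \<in> carrier K" for a
      using fun_cong[OF gk, of a] that by (auto simp: compose_def zero_hom_def)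
    let ?h = "\<lambda>y\<in>carrier Y. g (u y)"
    have hf: "?h (f x) = g x" if x: "x \<in> carrier X" for x
    proof -
      have fx: "f x \<in> carrier Y" using f x by (rule mon_hom_closed)
      obtain a where a: "a \<in> carrier K" "x = k a \<otimes>\<^bsub>X\<^esub> u (f x)" using u[OF fx] x by auto
      then have "g x = g (k a) \<otimes>\<^bsub>Z\<^esub> g (u (f x))"
        using u[OF fx] mon_hom_mult[OF g mon_hom_closed[OF k a(1)]] by metis
      then show ?thesis using a gk' fx u[OF fx] mon_hom_closed[OF g] by auto
    qed
    have surj: "\<exists>x\<in>carrier X. f x = y" if "y \<in> carrier Y" for y using u[OF that] by auto
    have "?h \<in> mon_hom Y Z"
      unfolding mon_hom_iff
    proof (intro conjI ballI)
      fix y assume y: "y \<in> carrier Y"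
      then show "?h y \<in> carrier Z" using u[OF y] mon_hom_closed[OF g] by auto
      fix y' assume y': "y' \<in> carrier Y"
      obtain x x' where "x \<in> carrier X" "f x = y" "x' \<in> carrier X" "f x' = y'" using surj y y' by metis
      then show "?h (y \<otimes>\<^bsub>Y\<^esub> y') = ?h y \<otimes>\<^bsub>Z\<^esub> ?h y'"
        using hf[of x] hf[of x'] hf[of "x \<otimes>\<^bsub>X\<^esub> x'"] mon_hom_mult[OF f, of x x'] mon_hom_mult[OF g, of x x']
        by (metis X.m_closed)
    next
      show "?h \<one>\<^bsub>Y\<^esub> = \<one>\<^bsub>Z\<^esub>"
        using hf[of "\<one>\<^bsub>X\<^esub>"] mon_hom_one[OF f] mon_hom_one[OF g] by simp
    qed auto
    moreover have "compose (carrier X) ?h f = g"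
      using g hf by (intro extensionalityI[of _ "carrier X"]) (auto simp: mon_hom_iff compose_def)
    moreover have "h' = ?h" if h': "h' \<in> mon_hom Y Z" "compose (carrier X) h' f = g" for h'
    proof (rule extensionalityI[of _ "carrier Y"])
      fix y assume "y \<in> carrier Y"
      then obtain x where x: "x \<in> carrier X" "f x = y" using surj by auto
      have "h' (f x) = g x" using fun_cong[OF h'(2), of x] x by (simp add: compose_def)
      then show "h' y = ?h y" using hf[OF x(1)] unfolding x(2) by (simp only:)
    qed (use h' in \<open>auto simp: mon_hom_iff\<close>)
    ultimately show ?thesis by blast
  qed
  moreover have "compose (carrier K) f k = zero_hom K Y"
    using fk by (auto simp: compose_def zero_hom_def fun_eq_iff)
  ultimately show ?thesis using f by (auto simp: is_cokernel_def)
qed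

section \<open>Representatives and free translations\<close>

lemma representativeD:
  assumes "representative K k X f m u"
  shows "u \<in> carrier X" "f u = m"
    "\<And>x. x \<in> carrier X \<Longrightarrow> f x = m \<Longrightarrow> \<exists>!a. a \<in> carrier K \<and> x = k a \<otimes>\<^bsub>X\<^esub> u"
  using assms by (auto simp: representative_def)

text \<open>Collects what the two sequences from \<open>A\<close> to \<open>N\<close> and from
  \<open>N\<close> to \<open>M\<close> have in common, so that facts on representatives are proved
  once and used for both.\<close>

locale schreier_data =
  fixes K X Y :: "'u monoid" and k f :: "'u \<Rightarrow> 'u"
  assumes K: "monoid K" and X: "monoid X" and Y: "monoid Y"
    and k: "k \<in> mon_hom K X" and f: "f \<in> mon_hom X Y"
    and fk: "\<And>a. a \<in> carrier K \<Longrightarrow> f (k a) = \<one>\<^bsub>Y\<^esub>"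
begin

interpretation K: monoid K by (fact K)
interpretation X: monoid X by (fact X)
interpretation Y: monoid Y by (fact Y)

lemma f_translate: "a \<in> carrier K \<Longrightarrow> x \<in> carrier X \<Longrightarrow> f (k a \<otimes>\<^bsub>X\<^esub> x) = f x"
  using mon_hom_mult[OF f, of "k a" x] mon_hom_closed[OF k, of a] mon_hom_closed[OF f, of x] fk[of a] by simp

lemma k_assoc: "a \<in> carrier K \<Longrightarrow> b \<in> carrier K \<Longrightarrow> x \<in> carrier X \<Longrightarrow>
    k a \<otimes>\<^bsub>X\<^esub> (k b \<otimes>\<^bsub>X\<^esub> x) = k (a \<otimes>\<^bsub>K\<^esub> b) \<otimes>\<^bsub>X\<^esub> x"
  using mon_hom_mult[OF k, of a b] mon_hom_closed[OF k] X.m_assoc by simp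

lemma rep_cancel:
  assumes "representative K k X f m u" "a \<in> carrier K" "b \<in> carrier K" "k a \<otimes>\<^bsub>X\<^esub> u = k b \<otimes>\<^bsub>X\<^esub> u"
  shows "a = b"
  using representativeD(3)[OF assms(1), of "k a \<otimes>\<^bsub>X\<^esub> u"] representativeD(1,2)[OF assms(1)] assms(2-4)
    f_translate mon_hom_closed[OF k] X.m_closed by metis

text \<open>A representative only gives uniqueness of coefficients at \<open>u\<close> itself.
  Writing \<open>x\<close> as a translate of \<open>u\<close> by some \<open>c\<close> and
  cancelling \<open>c\<close> in \<open>K\<close> extends it to every \<open>x\<close>.\<close>

lemma free:
  assumes "right_cancellative K" "representative K k X f (f x) u" "x \<in> carrier X"
    "a \<in> carrier K" "b \<in> carrier K" "k a \<otimes>\<^bsub>X\<^esub> x = k b \<otimes>\<^bsub>X\<^esub> x"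
  shows "a = b"
proof -
  obtain c where c: "c \<in> carrier K" "x = k c \<otimes>\<^bsub>X\<^esub> u"
    using representativeD(3)[OF assms(2,3)] by auto
  have "k (a \<otimes>\<^bsub>K\<^esub> c) \<otimes>\<^bsub>X\<^esub> u = k (b \<otimes>\<^bsub>K\<^esub> c) \<otimes>\<^bsub>X\<^esub> u"
    using assms(4-6) c k_assoc representativeD(1)[OF assms(2)] by simp
  then have "a \<otimes>\<^bsub>K\<^esub> c = b \<otimes>\<^bsub>K\<^esub> c"
    using rep_cancel[OF assms(2)] assms(4,5) c by simp
  then show ?thesis using assms(1,4,5) c by (auto simp: right_cancellative_def)
qed

text \<open>Invertibility of \<open>a\<close> allows a coefficient \<open>c\<close> to be exchanged
  for \<open>c\<close> times \<open>b\<close>. With \<open>rep_related\<close> this shows that the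
  representatives of \<open>m\<close> form one orbit under the invertible elements of
  \<open>K\<close>, so preservation of representatives can be checked on a single one.\<close>

lemma rep_translate:
  assumes "representative K k X f m u" "a \<in> carrier K" "b \<in> carrier K"
    "a \<otimes>\<^bsub>K\<^esub> b = \<one>\<^bsub>K\<^esub>" "b \<otimes>\<^bsub>K\<^esub> a = \<one>\<^bsub>K\<^esub>"
  shows "representative K k X f m (k a \<otimes>\<^bsub>X\<^esub> u)"
  unfolding representative_def
proof (intro conjI ballI impI)
  note u = representativeD[OF assms(1)]
  show "k a \<otimes>\<^bsub>X\<^esub> u \<in> carrier X" "f (k a \<otimes>\<^bsub>X\<^esub> u) = m"
    using u assms f_translate mon_hom_closed[OF k] by auto
  fix x assume x: "x \<in> carrier X" "f x = m"
  obtain c where c: "c \<in> carrier K" "x = k c \<otimes>\<^bsub>X\<^esub> u" using u(3)[OF x] by auto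
  show "\<exists>!c. c \<in> carrier K \<and> x = k c \<otimes>\<^bsub>X\<^esub> (k a \<otimes>\<^bsub>X\<^esub> u)"
  proof (rule ex1I[of _ "c \<otimes>\<^bsub>K\<^esub> b"])
    show "c \<otimes>\<^bsub>K\<^esub> b \<in> carrier K \<and> x = k (c \<otimes>\<^bsub>K\<^esub> b) \<otimes>\<^bsub>X\<^esub> (k a \<otimes>\<^bsub>X\<^esub> u)"
      using c u assms(2-5) by (simp add: k_assoc K.m_assoc)
    fix c' assume c': "c' \<in> carrier K \<and> x = k c' \<otimes>\<^bsub>X\<^esub> (k a \<otimes>\<^bsub>X\<^esub> u)"
    then have "k (c' \<otimes>\<^bsub>K\<^esub> a) \<otimes>\<^bsub>X\<^esub> u = k c \<otimes>\<^bsub>X\<^esub> u" using c u assms(2) by (simp add: k_assoc)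
    then have "c' \<otimes>\<^bsub>K\<^esub> a = c" using rep_cancel[OF assms(1)] c c' assms(2) by simp
    then show "c' = c \<otimes>\<^bsub>K\<^esub> b" using c' assms(2-4) by (auto simp: K.m_assoc)
  qed
qed

text \<open>Each of \<open>u\<close> and \<open>v\<close> is expressed through the other; comparing
  coefficients after substituting one expression into the other makes both products neutral.\<close>

lemma rep_related:
  assumes "representative K k X f m u" "representative K k X f m v"
  obtains a b where "a \<in> carrier K" "b \<in> carrier K" "a \<otimes>\<^bsub>K\<^esub> b = \<one>\<^bsub>K\<^esub>" "b \<otimes>\<^bsub>K\<^esub> a = \<one>\<^bsub>K\<^esub>"
    "v = k a \<otimes>\<^bsub>X\<^esub> u"
proof -
  note u = representativeD[OF assms(1)] and v = representativeD[OF assms(2)]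
  obtain a where a: "a \<in> carrier K" "v = k a \<otimes>\<^bsub>X\<^esub> u" using u(3)[OF v(1,2)] by auto
  obtain b where b: "b \<in> carrier K" "u = k b \<otimes>\<^bsub>X\<^esub> v" using v(3)[OF u(1,2)] by auto
  have "k (b \<otimes>\<^bsub>K\<^esub> a) \<otimes>\<^bsub>X\<^esub> u = u"
    using k_assoc[OF b(1) a(1) u(1)] unfolding a(2)[symmetric] b(2)[symmetric] by (rule sym)
  with mon_hom_one[OF k] u(1) have "k (b \<otimes>\<^bsub>K\<^esub> a) \<otimes>\<^bsub>X\<^esub> u = k \<one>\<^bsub>K\<^esub> \<otimes>\<^bsub>X\<^esub> u" by simp
  from rep_cancel[OF assms(1) _ _ this] have 1: "b \<otimes>\<^bsub>K\<^esub> a = \<one>\<^bsub>K\<^esub>"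
    using a(1) b(1) by simp
  have "k (a \<otimes>\<^bsub>K\<^esub> b) \<otimes>\<^bsub>X\<^esub> v = v"
    using k_assoc[OF a(1) b(1) v(1)] unfolding b(2)[symmetric] a(2)[symmetric] by (rule sym)
  with mon_hom_one[OF k] v(1) have "k (a \<otimes>\<^bsub>K\<^esub> b) \<otimes>\<^bsub>X\<^esub> v = k \<one>\<^bsub>K\<^esub> \<otimes>\<^bsub>X\<^esub> v" by simp
  from rep_cancel[OF assms(2) _ _ this] have "a \<otimes>\<^bsub>K\<^esub> b = \<one>\<^bsub>K\<^esub>"
    using a(1) b(1) by simp
  with a b 1 show ?thesis by (intro that[of a b])
qed

end

text \<open>The working form of a crossed Schreier extension: no quantification over test monoids
  remains. Kernels are given by images, and the cokernel conditions are recovered from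
  \<open>repN\<close> and \<open>repA\<close>.\<close>

locale crossed_ext =
  fixes E :: "'u xseq"
  assumes mA: "monoid (obA E)" and mB: "monoid (obB E)" and mC: "monoid (obC E)" and mM: "monoid (obM E)"
    and k_hom: "mk E \<in> mon_hom (obA E) (obB E)" and d_hom: "md E \<in> mon_hom (obB E) (obC E)"
    and p_hom: "mp E \<in> mon_hom (obC E) (obM E)"
    and act_hom: "act E \<in> mon_hom (obC E) (End_monoid (obB E))"
    and crossed1: "c \<in> carrier (obC E) \<Longrightarrow> b \<in> carrier (obB E) \<Longrightarrow>
      md E (act E c b) \<otimes>\<^bsub>obC E\<^esub> c = c \<otimes>\<^bsub>obC E\<^esub> md E b"
    and crossed2: "b \<in> carrier (obB E) \<Longrightarrow> b' \<in> carrier (obB E) \<Longrightarrow>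
      act E (md E b) b' \<otimes>\<^bsub>obB E\<^esub> b = b \<otimes>\<^bsub>obB E\<^esub> b'"
    and k_inj: "inj_on (mk E) (carrier (obA E))"
    and k_img: "mk E ` carrier (obA E) = {b \<in> carrier (obB E). md E b = \<one>\<^bsub>obC E\<^esub>}"
    and d_img: "md E ` carrier (obB E) = {c \<in> carrier (obC E). mp E c = \<one>\<^bsub>obM E\<^esub>}"
    and N_canc: "right_cancellative (obN E)" and A_canc: "right_cancellative (obA E)"
    and repN: "m \<in> carrier (obM E) \<Longrightarrow> \<exists>u. representative (obN E) (mn E) (obC E) (mp E) m u"
    and repA: "n \<in> md E ` carrier (obB E) \<Longrightarrow> \<exists>v. representative (obA E) (mk E) (obB E) (md E) n v"

lemma obN_sel [simp]: "carrier (obN E) = md E ` carrier (obB E)" "mult (obN E) = mult (obC E)"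
  "one (obN E) = one (obC E)"
  by (auto simp: obN_def)

lemma obN_monoid:
  assumes "monoid (obB E)" "monoid (obC E)" "md E \<in> mon_hom (obB E) (obC E)"
  shows "monoid (obN E)"
proof -
  interpret B: monoid "obB E" by fact
  interpret C: monoid "obC E" by fact
  show ?thesis unfolding obN_def
  proof (rule submonoid_monoid)
    show "x \<otimes>\<^bsub>obC E\<^esub> y \<in> md E ` carrier (obB E)" if "x \<in> md E ` carrier (obB E)" "y \<in> md E ` carrier (obB E)" for x y
      using that mon_hom_mult[OF assms(3)] by auto (metis B.m_closed imageI)
    show "\<one>\<^bsub>obC E\<^esub> \<in> md E ` carrier (obB E)" using mon_hom_one[OF assms(3)] B.one_closed by force
  qed (use assms in \<open>auto simp: mon_hom_iff\<close>)
qed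

lemma mn_hom:
  assumes "monoid (obB E)" "monoid (obC E)" "md E \<in> mon_hom (obB E) (obC E)"
  shows "mn E \<in> mon_hom (obN E) (obC E)"
  using obN_monoid[OF assms] assms(3) unfolding mn_def mon_hom_iff monoid_def by auto

lemma crossed_schreier_extension_iff: "crossed_schreier_extension E \<longleftrightarrow> crossed_ext E"
proof
  assume E: "crossed_schreier_extension E"
  then have m: "monoid (obA E)" "monoid (obB E)" "monoid (obC E)" "monoid (obM E)"
    and d: "md E \<in> mon_hom (obB E) (obC E)" and p: "mp E \<in> mon_hom (obC E) (obM E)"
    by (auto simp: crossed_schreier_extension_def crossed_semimodule_def is_cokernel_def)
  note N = obN_monoid[OF m(2,3) d]
  have k: "is_kernel (obA E) (mk E) (obB E) (md E) (obC E)" using E by (auto simp: crossed_schreier_extension_def)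
  have n: "is_kernel (obN E) (mn E) (obC E) (mp E) (obM E)"
    using E by (auto simp: crossed_schreier_extension_def schreier_extension_def)
  have "mn E ` carrier (obN E) = md E ` carrier (obB E)" by (auto simp: mn_def)
  \<comment> \<open>\<open>mn E\<close> is an inclusion, so its being a kernel of
    \<open>mp E\<close> says which elements make up its image.\<close>
  then have dim: "md E ` carrier (obB E) = {c \<in> carrier (obC E). mp E c = \<one>\<^bsub>obM E\<^esub>}"
    using n unfolding is_kernel_iff[OF N m(3) p m(4)] by simp
  have rA: "\<exists>v. representative (obA E) (mk E) (obB E) (md E) n v" if "n \<in> md E ` carrier (obB E)" for n
    using E that by (auto simp: crossed_schreier_extension_def schreier_extension_def)
  have kk: "mk E \<in> mon_hom (obA E) (obB E)" "inj_on (mk E) (carrier (obA E))"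
    "mk E ` carrier (obA E) = {b \<in> carrier (obB E). md E b = \<one>\<^bsub>obC E\<^esub>}"
    using k unfolding is_kernel_iff[OF m(1,2) d m(3)] by auto
  show "crossed_ext E"
    using E unfolding crossed_schreier_extension_def crossed_semimodule_def schreier_extension_def
    by (intro crossed_ext.intro m d p kk dim) (blast intro: rA)+
next
  assume "crossed_ext E"
  then interpret crossed_ext E .
  note m = mA mB mC mM and d = d_hom and p = p_hom
  note N = obN_monoid[OF m(2,3) d] and mnh = mn_hom[OF m(2,3) d]
  have mn: "mn E ` carrier (obN E) = md E ` carrier (obB E)" "\<And>x. x \<in> carrier (obN E) \<Longrightarrow> mn E x = x"
     by (auto simp: mn_def)
  have inj: "inj_on (mn E) (carrier (obN E))" by (auto simp: mn_def inj_on_def)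
  have dN: "md E \<in> mon_hom (obB E) (obN E)" using d by (auto simp: mon_hom_iff)
  have ker: "is_kernel (obN E) (mn E) (obC E) (mp E) (obM E)"
     "is_kernel (obA E) (mk E) (obB E) (md E) (obC E)" "is_kernel (obA E) (mk E) (obB E) (md E) (obN E)"
    using mnh inj mn d_img k_hom k_inj k_img unfolding is_kernel_iff[OF m(1,2) d m(3)] is_kernel_iff[OF m(1,2) dN N]
       is_kernel_iff[OF N m(3) p m(4)] by auto
  \<comment> \<open>Cokernels come back from representatives. For \<open>md E\<close> the
    coefficient found in \<open>N\<close> is replaced by a preimage in \<open>B\<close>.\<close>
  have c1: "is_cokernel (obB E) (md E) (obC E) (mp E) (obM E)"
  proof (rule is_cokernelI)
    fix y assume "y \<in> carrier (obM E)"
    then obtain u where "representative (obN E) (mn E) (obC E) (mp E) y u" using repN by blast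
    note u = representativeD[OF this]
    show "\<exists>u\<in>carrier (obC E). mp E u = y \<and>
      (\<forall>x\<in>carrier (obC E). mp E x = y \<longrightarrow> (\<exists>a\<in>carrier (obB E). x = md E a \<otimes>\<^bsub>obC E\<^esub> u))"
    proof (rule bexI[of _ u], intro conjI ballI impI)
      fix x assume "x \<in> carrier (obC E)" "mp E x = y"
      from u(3)[OF this] obtain n where "n \<in> carrier (obN E)" "x = mn E n \<otimes>\<^bsub>obC E\<^esub> u" by blast
      then show "\<exists>a\<in>carrier (obB E). x = md E a \<otimes>\<^bsub>obC E\<^esub> u" by (auto simp: mn_def)
    qed (use u in auto)
  qed (use m d p d_img in auto)
  have c2: "is_cokernel (obN E) (mn E) (obC E) (mp E) (obM E)"
  proof (rule is_cokernelI)
    fix y assume "y \<in> carrier (obM E)"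
    then obtain u where "representative (obN E) (mn E) (obC E) (mp E) y u" using repN by blast
    note u = representativeD[OF this]
    show "\<exists>u\<in>carrier (obC E). mp E u = y \<and>
      (\<forall>x\<in>carrier (obC E). mp E x = y \<longrightarrow> (\<exists>a\<in>carrier (obN E). x = mn E a \<otimes>\<^bsub>obC E\<^esub> u))"
      using u by (intro bexI[of _ u]) blast+
  qed (use m N p mn d_img mnh in auto)
  have c3: "is_cokernel (obA E) (mk E) (obB E) (md E) (obN E)"
  proof (rule is_cokernelI)
    fix y assume "y \<in> carrier (obN E)"
    then obtain u where "representative (obA E) (mk E) (obB E) (md E) y u" using repA by auto
    note u = representativeD[OF this]
    show "\<exists>u\<in>carrier (obB E). md E u = y \<and>
      (\<forall>x\<in>carrier (obB E). md E x = y \<longrightarrow> (\<exists>a\<in>carrier (obA E). x = mk E a \<otimes>\<^bsub>obB E\<^esub> u))"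
      using u by (intro bexI[of _ u]) blast+
  qed (use m N dN k_hom k_img in auto)
  show "crossed_schreier_extension E"
    unfolding crossed_schreier_extension_def crossed_semimodule_def schreier_extension_def
    using m N d p dN k_hom act_hom crossed1 crossed2 mnh ker c1 c2 c3 N_canc A_canc repN repA by auto
qed

context crossed_ext
begin

abbreviation "A \<equiv> carrier (obA E)"
abbreviation "B \<equiv> carrier (obB E)"
abbreviation "C \<equiv> carrier (obC E)"
abbreviation "N \<equiv> md E ` carrier (obB E)"
abbreviation "k \<equiv> mk E"
abbreviation "d \<equiv> md E"
abbreviation "p \<equiv> mp E"
abbreviation "\<alpha> \<equiv> act E"
abbreviation "repAB \<equiv> representative (obA E) (mk E) (obB E) (md E)"
abbreviation "repNC \<equiv> representative (obN E) (mn E) (obC E) (mp E)"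

sublocale A: monoid "obA E" by (fact mA)
sublocale B: monoid "obB E" by (fact mB)
sublocale C: monoid "obC E" by (fact mC)
sublocale M: monoid "obM E" by (fact mM)
sublocale N: monoid "obN E" by (rule obN_monoid[OF mB mC d_hom])

lemma mn [simp]: "n \<in> N \<Longrightarrow> mn E n = n" by (simp add: mn_def)

lemma k_closed [simp]: "a \<in> A \<Longrightarrow> k a \<in> B"
  and k_mult [simp]: "a \<in> A \<Longrightarrow> a' \<in> A \<Longrightarrow> k (a \<otimes>\<^bsub>obA E\<^esub> a') = k a \<otimes>\<^bsub>obB E\<^esub> k a'"
  and k_one [simp]: "k \<one>\<^bsub>obA E\<^esub> = \<one>\<^bsub>obB E\<^esub>"
  and d_closed [simp]: "b \<in> B \<Longrightarrow> d b \<in> C"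
  and d_mult [simp]: "b \<in> B \<Longrightarrow> b' \<in> B \<Longrightarrow> d (b \<otimes>\<^bsub>obB E\<^esub> b') = d b \<otimes>\<^bsub>obC E\<^esub> d b'"
  and d_one [simp]: "d \<one>\<^bsub>obB E\<^esub> = \<one>\<^bsub>obC E\<^esub>"
  and p_closed [simp]: "c \<in> C \<Longrightarrow> p c \<in> carrier (obM E)"
  and p_mult [simp]: "c \<in> C \<Longrightarrow> c' \<in> C \<Longrightarrow> p (c \<otimes>\<^bsub>obC E\<^esub> c') = p c \<otimes>\<^bsub>obM E\<^esub> p c'"
  and p_one [simp]: "p \<one>\<^bsub>obC E\<^esub> = \<one>\<^bsub>obM E\<^esub>"
  using k_hom d_hom p_hom by (auto simp: mon_hom_iff)

lemma k_eq_iff [simp]: "a \<in> A \<Longrightarrow> a' \<in> A \<Longrightarrow> k a = k a' \<longleftrightarrow> a = a'"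
  using k_inj by (auto simp: inj_on_def)

lemma dk [simp]: "a \<in> A \<Longrightarrow> d (k a) = \<one>\<^bsub>obC E\<^esub>"
  using k_img by auto

lemma pd [simp]: "b \<in> B \<Longrightarrow> p (d b) = \<one>\<^bsub>obM E\<^esub>"
  using d_img by auto

lemma ker_d: "b \<in> B \<Longrightarrow> d b = \<one>\<^bsub>obC E\<^esub> \<Longrightarrow> \<exists>a\<in>A. b = k a"
  using k_img by auto

lemma ker_p: "c \<in> C \<Longrightarrow> p c = \<one>\<^bsub>obM E\<^esub> \<Longrightarrow> \<exists>b\<in>B. c = d b"
  using d_img by auto

lemma act_endo: "c \<in> C \<Longrightarrow> \<alpha> c \<in> mon_hom (obB E) (obB E)"
  using act_hom unfolding action_hom_iff[OF mC] by auto

lemma act_closed [simp]: "c \<in> C \<Longrightarrow> b \<in> B \<Longrightarrow> \<alpha> c b \<in> B"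
  and act_mult [simp]: "c \<in> C \<Longrightarrow> b \<in> B \<Longrightarrow> b' \<in> B \<Longrightarrow> \<alpha> c (b \<otimes>\<^bsub>obB E\<^esub> b') = \<alpha> c b \<otimes>\<^bsub>obB E\<^esub> \<alpha> c b'"
  and act_one [simp]: "c \<in> C \<Longrightarrow> \<alpha> c \<one>\<^bsub>obB E\<^esub> = \<one>\<^bsub>obB E\<^esub>"
  and act_comp [simp]: "c \<in> C \<Longrightarrow> c' \<in> C \<Longrightarrow> b \<in> B \<Longrightarrow> \<alpha> (c \<otimes>\<^bsub>obC E\<^esub> c') b = \<alpha> c (\<alpha> c' b)"
  and act_id [simp]: "b \<in> B \<Longrightarrow> \<alpha> \<one>\<^bsub>obC E\<^esub> b = b"
  using act_endo act_hom unfolding action_hom_iff[OF mC] by (auto simp: mon_hom_iff)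

sublocale sA: schreier_data "obA E" "obB E" "obN E" "mk E" "md E"
  by unfold_locales (auto simp: k_hom, auto simp: mon_hom_iff d_hom[unfolded mon_hom_iff])

sublocale sN: schreier_data "obN E" "obC E" "obM E" "mn E" "mp E"
  by unfold_locales (auto simp: mn_hom[OF mB mC d_hom] p_hom)

section \<open>Freeness, centrality and the induced action\<close>

lemma freeA: "a \<in> A \<Longrightarrow> a' \<in> A \<Longrightarrow> b \<in> B \<Longrightarrow> k a \<otimes>\<^bsub>obB E\<^esub> b = k a' \<otimes>\<^bsub>obB E\<^esub> b \<Longrightarrow> a = a'"
  using repA[of "d b"] sA.free[OF A_canc] by blast

lemma freeN: "n \<in> N \<Longrightarrow> n' \<in> N \<Longrightarrow> c \<in> C \<Longrightarrow> n \<otimes>\<^bsub>obC E\<^esub> c = n' \<otimes>\<^bsub>obC E\<^esub> c \<Longrightarrow> n = n'"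
  using repN[OF p_closed[of c]] sN.free[OF N_canc, of c _ n n'] by auto

text \<open>This is the second crossed semimodule law with \<open>k a\<close> as the acting element,
  which acts trivially because \<open>d (k a)\<close> is neutral.\<close>

lemma k_central: "a \<in> A \<Longrightarrow> b \<in> B \<Longrightarrow> b \<otimes>\<^bsub>obB E\<^esub> k a = k a \<otimes>\<^bsub>obB E\<^esub> b"
  using crossed2[of "k a" b] by simp

lemma A_comm: "a \<in> A \<Longrightarrow> a' \<in> A \<Longrightarrow> a \<otimes>\<^bsub>obA E\<^esub> a' = a' \<otimes>\<^bsub>obA E\<^esub> a"
  using k_central[of a "k a'"] by (simp flip: k_mult)

lemma p_surj: "m \<in> carrier (obM E) \<Longrightarrow> \<exists>c\<in>C. p c = m"
  using repN[of m] representativeD(1,2)[of "obN E" "mn E" "obC E" p m] by blast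

text \<open>The first crossed semimodule law leaves the element in question times \<open>c\<close>
  equal to \<open>c\<close>. Here \<open>c\<close> may be cancelled since \<open>N\<close> acts
  freely on \<open>C\<close>, although \<open>C\<close> itself need not be cancellative.\<close>

lemma d_act_k: "c \<in> C \<Longrightarrow> a \<in> A \<Longrightarrow> d (\<alpha> c (k a)) = \<one>\<^bsub>obC E\<^esub>"
  by (rule freeN[of _ _ c]) (use crossed1[of c "k a"] N.one_closed in simp_all)

lemma act_k: "c \<in> C \<Longrightarrow> a \<in> A \<Longrightarrow> \<exists>a'\<in>A. \<alpha> c (k a) = k a'"
  using ker_d[OF _ d_act_k] by simp

text \<open>Write \<open>n = d b\<close>. The second law and centrality identify the translates of
  \<open>b\<close> by the transformed and by the original element of \<open>A\<close>; freeness of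
  \<open>A\<close> on \<open>B\<close> removes \<open>b\<close>.\<close>

lemma act_N: "n \<in> N \<Longrightarrow> a \<in> A \<Longrightarrow> \<alpha> n (k a) = k a"
proof -
  assume n: "n \<in> N" and a: "a \<in> A"
  then obtain b where b: "b \<in> B" "n = d b" by auto
  obtain a' where a': "a' \<in> A" "\<alpha> (d b) (k a) = k a'" using act_k[OF d_closed[OF b(1)] a] by blast
  have "k a' \<otimes>\<^bsub>obB E\<^esub> b = k a \<otimes>\<^bsub>obB E\<^esub> b"
    using crossed2[of b "k a"] a b a' by (simp add: k_central)
  then show ?thesis using freeA a a' b by metis
qed

text \<open>Every element of the fibre is a product of some \<open>n\<close> in \<open>N\<close>
  with one fixed \<open>u\<close>, and \<open>N\<close> acts trivially on the image of
  \<open>A\<close>. This makes the induced action well defined.\<close>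

lemma act_fibre: "c \<in> C \<Longrightarrow> c' \<in> C \<Longrightarrow> p c = p c' \<Longrightarrow> a \<in> A \<Longrightarrow> \<alpha> c (k a) = \<alpha> c' (k a)"
proof -
  assume c: "c \<in> C" "c' \<in> C" "p c = p c'" and a: "a \<in> A"
  obtain u where "repNC (p c) u" using repN c by fastforce
  note u = representativeD[OF this]
  have *: "\<alpha> x (k a) = \<alpha> u (k a)" if x: "x \<in> C" "p x = p c" for x
  proof -
    have "\<exists>n\<in>N. x = n \<otimes>\<^bsub>obC E\<^esub> u" using u(3)[OF x] mn unfolding obN_sel by (metis (no_types, lifting))
    then obtain n where n: "n \<in> N" "x = n \<otimes>\<^bsub>obC E\<^esub> u" by blast
    have nC: "n \<in> C" using n(1) d_closed by blast
    obtain a' where a': "a' \<in> A" "\<alpha> u (k a) = k a'" using act_k[OF u(1) a] by blast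
    have "\<alpha> x (k a) = \<alpha> n (\<alpha> u (k a))" unfolding n(2) by (rule act_comp[OF nC u(1) k_closed[OF a]])
    then show ?thesis unfolding a'(2) by (simp only: act_N[OF n(1) a'(1)])
  qed
  show ?thesis using *[of c] *[of c'] c by simp
qed

lemma induced:
  assumes "c \<in> C" "a \<in> A"
  shows "induced_action E (p c) a \<in> A" "k (induced_action E (p c) a) = \<alpha> c (k a)"
proof -
  obtain a' where a': "a' \<in> A" "\<alpha> c (k a) = k a'" using act_k[OF assms] by auto
  have "(THE a'. a' \<in> A \<and> (\<exists>c'\<in>C. p c' = p c \<and> k a' = \<alpha> c' (k a))) = a'"
  proof (rule the_equality)
    show "a' \<in> A \<and> (\<exists>c'\<in>C. p c' = p c \<and> k a' = \<alpha> c' (k a))" using a' assms by force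
    fix a'' assume "a'' \<in> A \<and> (\<exists>c'\<in>C. p c' = p c \<and> k a'' = \<alpha> c' (k a))"
    then show "a'' = a'" using a' act_fibre[OF _ assms(1) _ assms(2)] k_eq_iff by metis
  qed
  then have "induced_action E (p c) a = a'" using assms by (simp add: induced_action_def)
  then show "induced_action E (p c) a \<in> A" "k (induced_action E (p c) a) = \<alpha> c (k a)" using a' by auto
qed

text \<open>Objects of the fibre must be sent to \<open>V\<close> by an honest equality, so the
  action has to be recovered as a function, including its values outside the carriers.\<close>

lemma induced_action_eqI:
  assumes "\<And>c a. c \<in> C \<Longrightarrow> a \<in> A \<Longrightarrow> \<eta> (p c) a \<in> A \<and> k (\<eta> (p c) a) = \<alpha> c (k a)"
    and "\<eta> \<in> mon_hom (obM E) (End_monoid (obA E))"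
  shows "induced_action E = \<eta>"
proof (rule extensionalityI[of _ "carrier (obM E)"])
  show "induced_action E \<in> extensional (carrier (obM E))" by (simp add: induced_action_def)
  show "\<eta> \<in> extensional (carrier (obM E))" using assms(2) by (rule mon_hom_ext)
  fix m assume m: "m \<in> carrier (obM E)"
  show "induced_action E m = \<eta> m"
  proof (rule extensionalityI[of _ A])
    show "induced_action E m \<in> extensional A" using m by (simp add: induced_action_def)
    show "\<eta> m \<in> extensional A" using assms(2) m unfolding action_hom_iff[OF mM] by (intro mon_hom_ext) blast
    fix a assume a: "a \<in> A"
    obtain c where "c \<in> C" "p c = m" using p_surj[OF m] by auto
    then show "induced_action E m a = \<eta> m a"
      using induced[of c a] assms(1)[of c a] a k_eq_iff by metis
  qed
qed

lemma induced_can_semimodule: "can_semimodule (obM E) (obA E, induced_action E)"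
proof -
  have "comm_monoid (obA E)" by unfold_locales (simp add: A_comm)
  moreover have "left_cancellative (obA E)"
    using A_canc A_comm unfolding left_cancellative_def right_cancellative_def by metis
  moreover have "induced_action E \<in> mon_hom (obM E) (End_monoid (obA E))"
    unfolding action_hom_iff[OF mM]
  proof (intro conjI ballI)
    fix m assume m: "m \<in> carrier (obM E)"
    then obtain c where c: "c \<in> C" "p c = m" using p_surj by auto
    note ind = induced[OF c(1), unfolded c(2)]
    show "induced_action E m \<in> mon_hom (obA E) (obA E)"
      unfolding mon_hom_iff
    proof (intro conjI ballI)
      show "induced_action E m \<in> extensional A" using m by (simp add: induced_action_def)
      show "induced_action E m a \<in> A" if "a \<in> A" for a using ind that by simp
      show "induced_action E m (a \<otimes>\<^bsub>obA E\<^esub> a') = induced_action E m a \<otimes>\<^bsub>obA E\<^esub> induced_action E m a'"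
        if "a \<in> A" "a' \<in> A" for a a'
        using that ind c(1) by (subst k_eq_iff[symmetric]) auto
      show "induced_action E m \<one>\<^bsub>obA E\<^esub> = \<one>\<^bsub>obA E\<^esub>"
        using ind c(1) by (subst k_eq_iff[symmetric]) auto
    qed
    fix m' a assume m': "m' \<in> carrier (obM E)" and a: "a \<in> A"
    then obtain c' where c': "c' \<in> C" "p c' = m'" using p_surj by auto
    note ind' = induced[OF c'(1), unfolded c'(2)]
    note ind'' = induced[OF C.m_closed[OF c(1) c'(1)], unfolded p_mult[OF c(1) c'(1)] c(2) c'(2)]
    show "induced_action E (m \<otimes>\<^bsub>obM E\<^esub> m') a = induced_action E m (induced_action E m' a)"
      using ind ind' ind'' a c(1) c'(1) by (subst k_eq_iff[symmetric]) auto
  next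
    fix a assume a: "a \<in> A"
    show "induced_action E \<one>\<^bsub>obM E\<^esub> a = a"
      using induced[OF C.one_closed a] a by (subst k_eq_iff[symmetric]) auto
  next
    show "induced_action E \<in> extensional (carrier (obM E))" by (simp add: induced_action_def)
  qed
  ultimately show ?thesis using A_canc by (simp add: can_semimodule_def)
qed

end

section \<open>Morphisms of crossed Schreier extensions in terms of elements\<close>

definition crossed_ext_hom :: "'u xseq \<Rightarrow> 'u xseq \<Rightarrow> ('u \<Rightarrow> 'u) \<Rightarrow> ('u \<Rightarrow> 'u) \<Rightarrow> bool" where
  "crossed_ext_hom E E' \<phi> \<psi> \<longleftrightarrow> \<phi> \<in> mon_hom (obB E) (obB E') \<and> \<psi> \<in> mon_hom (obC E) (obC E') \<and>
     (\<forall>b\<in>carrier (obB E). md E' (\<phi> b) = \<psi> (md E b)) \<and>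
     (\<forall>c\<in>carrier (obC E). \<forall>b\<in>carrier (obB E). \<phi> (act E c b) = act E' (\<psi> c) (\<phi> b)) \<and>
     (\<forall>c\<in>carrier (obC E). mp E' (\<psi> c) = mp E c) \<and>
     (\<forall>n\<in>md E ` carrier (obB E). \<forall>v. representative (obA E) (mk E) (obB E) (md E) n v \<longrightarrow>
        representative (obA E') (mk E') (obB E') (md E') (\<psi> n) (\<phi> v)) \<and>
     (\<forall>m\<in>carrier (obM E). \<forall>u. representative (obN E) (mn E) (obC E) (mp E) m u \<longrightarrow>
        representative (obN E') (mn E') (obC E') (mp E') m (\<psi> u))"

lemma crossed_ext_homD:
  assumes "crossed_ext_hom E E' \<phi> \<psi>"
  shows "\<phi> \<in> mon_hom (obB E) (obB E')" "\<psi> \<in> mon_hom (obC E) (obC E')"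
     "b \<in> carrier (obB E) \<Longrightarrow> md E' (\<phi> b) = \<psi> (md E b)"
     "c \<in> carrier (obC E) \<Longrightarrow> b \<in> carrier (obB E) \<Longrightarrow> \<phi> (act E c b) = act E' (\<psi> c) (\<phi> b)"
     "c \<in> carrier (obC E) \<Longrightarrow> mp E' (\<psi> c) = mp E c"
     "n \<in> md E ` carrier (obB E) \<Longrightarrow> representative (obA E) (mk E) (obB E) (md E) n v \<Longrightarrow>
        representative (obA E') (mk E') (obB E') (md E') (\<psi> n) (\<phi> v)"
     "m \<in> carrier (obM E) \<Longrightarrow> representative (obN E) (mn E) (obC E) (mp E) m u \<Longrightarrow>
        representative (obN E') (mn E') (obC E') (mp E') m (\<psi> u)"
  using assms by (auto simp: crossed_ext_hom_def)

lemma starA: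
  assumes "crossed_ext E" "crossed_ext E'" "crossed_ext_hom E E' \<phi> \<psi>" "a \<in> carrier (obA E)"
  shows "starA E E' \<phi> a \<in> carrier (obA E')" "mk E' (starA E E' \<phi> a) = \<phi> (mk E a)"
proof -
  interpret E: crossed_ext E by fact
  interpret E': crossed_ext E' by fact
  have "md E' (\<phi> (mk E a)) = \<one>\<^bsub>obC E'\<^esub>"
    using crossed_ext_homD(3)[OF assms(3), of "mk E a"] mon_hom_one[OF crossed_ext_homD(2)[OF assms(3)]] assms(4) by simp
  then obtain a' where a': "a' \<in> carrier (obA E')" "\<phi> (mk E a) = mk E' a'"
    using E'.ker_d[of "\<phi> (mk E a)"] mon_hom_closed[OF crossed_ext_homD(1)[OF assms(3)]] assms(4) by auto
  then have "starA E E' \<phi> a = a'"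
    using assms(4) by (auto simp: starA_def intro!: the_equality)
  then show "starA E E' \<phi> a \<in> carrier (obA E')" "mk E' (starA E E' \<phi> a) = \<phi> (mk E a)"
    using a' by auto
qed

lemma starA_hom:
  assumes "crossed_ext E" "crossed_ext E'" "crossed_ext_hom E E' \<phi> \<psi>"
  shows "starA E E' \<phi> \<in> mon_hom (obA E) (obA E')"
proof -
  interpret E: crossed_ext E by fact
  interpret E': crossed_ext E' by fact
  note s = starA[OF assms] and \<phi> = crossed_ext_homD(1)[OF assms(3)]
  show ?thesis unfolding mon_hom_iff
  proof (intro conjI ballI)
    show "starA E E' \<phi> \<in> extensional (carrier (obA E))" by (simp add: starA_def)
    show "starA E E' \<phi> \<one>\<^bsub>obA E\<^esub> = \<one>\<^bsub>obA E'\<^esub>"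
      using s mon_hom_one[OF \<phi>] by (subst E'.k_eq_iff[symmetric]) auto
    show "starA E E' \<phi> (a \<otimes>\<^bsub>obA E\<^esub> a') = starA E E' \<phi> a \<otimes>\<^bsub>obA E'\<^esub> starA E E' \<phi> a'"
      if "a \<in> carrier (obA E)" "a' \<in> carrier (obA E)" for a a'
      using s that mon_hom_mult[OF \<phi>] by (subst E'.k_eq_iff[symmetric]) auto
  qed (use s in auto)
qed

lemma starA_eqI:
  assumes "crossed_ext E" "crossed_ext E'" "crossed_ext_hom E E' \<phi> \<psi>" "w \<in> mon_hom (obA E) (obA E')"
    "\<And>a. a \<in> carrier (obA E) \<Longrightarrow> mk E' (w a) = \<phi> (mk E a)"
  shows "starA E E' \<phi> = w"
proof (rule mon_hom_eqI[OF starA_hom[OF assms(1-3)] assms(4)])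
  interpret E': crossed_ext E' by fact
  fix a assume a: "a \<in> carrier (obA E)"
  then show "starA E E' \<phi> a = w a"
    using starA[OF assms(1-3) a] assms(5)[OF a] mon_hom_closed[OF assms(4) a] E'.k_eq_iff by metis
qed

text \<open>An element \<open>c\<close> over \<open>m\<close> is sent by \<open>\<psi>\<close> to an
  element over the same \<open>m\<close>, so both induced actions may be computed from
  \<open>c\<close> and \<open>\<psi> c\<close>.\<close>

lemma starA_equivariant:
  assumes "crossed_ext E" "crossed_ext E'" "crossed_ext_hom E E' \<phi> \<psi>" "obM E = obM E'" "m \<in> carrier (obM E)" "a \<in> carrier (obA E)"
  shows "starA E E' \<phi> (induced_action E m a) = induced_action E' m (starA E E' \<phi> a)"
proof -
  interpret E: crossed_ext E by fact
  interpret E': crossed_ext E' by fact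
  note s = starA[OF assms(1-3)] and \<phi> = crossed_ext_homD[OF assms(3)]
  obtain c where c: "c \<in> carrier (obC E)" "mp E c = m" using E.p_surj assms(5) by auto
  have c': "\<psi> c \<in> carrier (obC E')" "mp E' (\<psi> c) = m" using c \<phi>(5) mon_hom_closed[OF \<phi>(2)] by auto
  note i = E.induced[OF c(1) assms(6)] E'.induced[OF c'(1) s(1)[OF assms(6)]]
  show ?thesis using i c c' s assms(6) \<phi>(4) by (subst E'.k_eq_iff[symmetric]) auto
qed

text \<open>The induced maps on \<open>A\<close> and \<open>N\<close> are determined by
  \<open>\<phi>\<close> and \<open>\<psi>\<close>. The squares that involve them therefore hold
  automatically, and only preservation of representatives remains.\<close>

lemma xsext_morphism_iff:
  assumes "crossed_ext E" "crossed_ext E'" "obM E = obM E'"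
  shows "xsext_morphism E E' \<phi> \<psi> \<longleftrightarrow> crossed_ext_hom E E' \<phi> \<psi>"
proof -
  interpret E: crossed_ext E by fact
  interpret E': crossed_ext E' by fact
  show ?thesis
  proof
    assume L: "xsext_morphism E E' \<phi> \<psi>"
    have "md E' (\<phi> b) = \<psi> (md E b)" if "b \<in> carrier (obB E)" for b
    proof -
      have "compose (carrier (obB E)) (md E') \<phi> = compose (carrier (obB E)) \<psi> (md E)"
        using L by (auto simp: xsext_morphism_def semimodule_morphism_def)
      from fun_cong[OF this, of b] that show ?thesis by (simp add: compose_def)
    qed
    moreover have "mp E' (\<psi> c) = mp E c" if "c \<in> carrier (obC E)" for c
    proof -
      have "compose (carrier (obC E)) (mp E') \<psi> = mp E"
        using L by (auto simp: xsext_morphism_def)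
      from fun_cong[OF this, of c] that show ?thesis by (simp add: compose_def)
    qed
    ultimately show "crossed_ext_hom E E' \<phi> \<psi>"
      using L by (auto simp: crossed_ext_hom_def xsext_morphism_def semimodule_morphism_def schreier_morphism_def starN_def)
  next
    assume R: "crossed_ext_hom E E' \<phi> \<psi>"
    note s = starA[OF assms(1,2) R] and \<phi> = crossed_ext_homD[OF R]
    have sN: "starN E \<psi> \<in> mon_hom (obN E) (obN E')"
      using \<phi>(3) mon_hom_closed[OF \<phi>(1)] mon_hom_mult[OF \<phi>(2)] mon_hom_one[OF \<phi>(2)] E.N.m_closed E.N.one_closed
      by (auto simp: mon_hom_iff starN_def) (metis imageI)
    have eqs: "compose (carrier (obB E)) (md E') \<phi> = compose (carrier (obB E)) \<psi> (md E)"
      "compose (carrier (obC E)) (mp E') \<psi> = mp E"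
      "compose (carrier (obA E)) \<phi> (mk E) = compose (carrier (obA E)) (mk E') (starA E E' \<phi>)"
      "compose (carrier (obB E)) (starN E \<psi>) (md E) = compose (carrier (obB E)) (md E') \<phi>"
      "compose (carrier (obN E)) \<psi> (mn E) = compose (carrier (obN E)) (mn E') (starN E \<psi>)"
      "compose (carrier (obC E)) (\<lambda>m\<in>carrier (obM E). m) (mp E) = compose (carrier (obC E)) (mp E') \<psi>"
      using \<phi>(3,5) s mon_hom_ext[OF E.p_hom] mon_hom_closed[OF sN]
      by (auto simp: compose_def fun_eq_iff extensional_def starN_def)
    have "(\<lambda>m\<in>carrier (obM E). m) \<in> mon_hom (obM E) (obM E')"
      unfolding assms(3)[symmetric] by (rule mon_hom_id[OF E.mM])
    then show "xsext_morphism E E' \<phi> \<psi>"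
      using R eqs sN starA_hom[OF assms(1,2) R]
      unfolding crossed_ext_hom_def xsext_morphism_def semimodule_morphism_def schreier_morphism_def
      by (auto simp: starN_def)
  qed
qed

lemma crossed_ext_hom_compose:
  assumes "crossed_ext E" "crossed_ext E'" "crossed_ext E''" "obM E = obM E'" "crossed_ext_hom E E' \<phi> \<psi>" "crossed_ext_hom E' E'' \<phi>' \<psi>'"
  shows "crossed_ext_hom E E'' (compose (carrier (obB E)) \<phi>' \<phi>) (compose (carrier (obC E)) \<psi>' \<psi>)"
proof -
  interpret E: crossed_ext E by fact
  interpret E': crossed_ext E' by fact
  note \<phi> = crossed_ext_homD[OF assms(5)] and \<phi>' = crossed_ext_homD[OF assms(6)]
  have cl: "b \<in> carrier (obB E) \<Longrightarrow> \<phi> b \<in> carrier (obB E')" "c \<in> carrier (obC E) \<Longrightarrow> \<psi> c \<in> carrier (obC E')" for b c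
    using \<phi>(1,2) by (auto simp: mon_hom_iff)
  have N: "n \<in> md E ` carrier (obB E) \<Longrightarrow> \<psi> n \<in> md E' ` carrier (obB E')" for n
    using \<phi>(3)[symmetric] cl by auto
  note r = representativeD(1)
  show ?thesis unfolding crossed_ext_hom_def
    using mon_hom_compose[OF E.mB \<phi>(1) \<phi>'(1)] mon_hom_compose[OF E.mC \<phi>(2) \<phi>'(2)] cl N
     \<phi>(3-7) \<phi>'(3-7) assms(4) by (auto simp: compose_def dest: r)
qed

lemma crossed_ext_hom_id:
  assumes "crossed_ext E"
  shows "crossed_ext_hom E E (\<lambda>b\<in>carrier (obB E). b) (\<lambda>c\<in>carrier (obC E). c)"
proof -
  interpret E: crossed_ext E by fact
  show ?thesis unfolding crossed_ext_hom_def
    using mon_hom_id[OF E.mB] mon_hom_id[OF E.mC] by (auto dest: representativeD(1))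
qed

section \<open>Opcartesian morphisms\<close>

text \<open>Bijectivity on \<open>C\<close> is the property behind the class of opcartesian arrows:
  it is stable under composition and under fibre products over \<open>M\<close>, and push forwards
  have it because they leave \<open>C\<close> unchanged.\<close>

locale bij_morphism = E: crossed_ext E + E': crossed_ext E'
  for E E' :: "'u xseq" +
  fixes \<phi> \<psi>
  assumes same_M: "obM E = obM E'" and crossed_ext_hom: "crossed_ext_hom E E' \<phi> \<psi>"
    and bij: "bij_betw \<psi> (carrier (obC E)) (carrier (obC E'))"
begin

lemmas \<phi>_hom = crossed_ext_homD(1)[OF crossed_ext_hom] and \<psi>_hom = crossed_ext_homD(2)[OF crossed_ext_hom]

lemma closed [simp]: "b \<in> E.B \<Longrightarrow> \<phi> b \<in> E'.B" "c \<in> E.C \<Longrightarrow> \<psi> c \<in> E'.C"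
  by (simp_all add: mon_hom_closed[OF \<phi>_hom] mon_hom_closed[OF \<psi>_hom])

lemma psi_eq [simp]: "c \<in> E.C \<Longrightarrow> c' \<in> E.C \<Longrightarrow> \<psi> c = \<psi> c' \<longleftrightarrow> c = c'"
  using bij by (auto simp: bij_betw_def inj_on_def)

lemma psi_surj: "c' \<in> E'.C \<Longrightarrow> \<exists>c\<in>E.C. c' = \<psi> c"
  using bij by (auto simp: bij_betw_def)

text \<open>\<open>N\<close> and its counterpart in \<open>E'\<close> consist of the elements over
  the neutral element of \<open>M\<close>, and \<open>\<psi>\<close> respects the projections to
  \<open>M\<close>; so the surjection restricts.\<close>

lemma psi_N_surj: "n' \<in> E'.N \<Longrightarrow> \<exists>n\<in>E.N. n' = \<psi> n"
proof -
  assume n': "n' \<in> E'.N"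
  then have "n' \<in> E'.C" by auto
  then obtain c where c: "c \<in> E.C" "n' = \<psi> c" using psi_surj by auto
  have "mp E c = \<one>\<^bsub>obM E\<^esub>" using n' c crossed_ext_homD(5)[OF crossed_ext_hom c(1)] same_M by auto
  then show ?thesis using E.ker_p c by auto
qed

lemma s_closed [simp]: "a \<in> E.A \<Longrightarrow> starA E E' \<phi> a \<in> E'.A"
  and k_s [simp]: "a \<in> E.A \<Longrightarrow> mk E' (starA E E' \<phi> a) = \<phi> (mk E a)"
  using starA[OF E.crossed_ext_axioms E'.crossed_ext_axioms crossed_ext_hom] by auto

text \<open>\<open>\<phi>\<close> turns a representative \<open>v\<close> of \<open>n\<close> into a
  representative of \<open>\<psi> n\<close>, and every element over \<open>\<psi> n\<close> is a
  translate of it.\<close>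

lemma decompose:
  assumes "b' \<in> E'.B"
  shows "\<exists>a\<in>E'.A. \<exists>b\<in>E.B. b' = mk E' a \<otimes>\<^bsub>obB E'\<^esub> \<phi> b"
proof -
  obtain n where n: "n \<in> E.N" "md E' b' = \<psi> n" using psi_N_surj assms by blast
  obtain v where "E.repAB n v" using E.repA n by blast
  note v = representativeD(1)[OF this] and v' = crossed_ext_homD(6)[OF crossed_ext_hom n(1) this]
  show ?thesis using representativeD(3)[OF v' assms n(2)] v by blast
qed

lemma mult_decomposed:
  assumes "a \<in> E'.A" "b \<in> E.B" "a' \<in> E'.A" "b' \<in> E.B"
  shows "(mk E' a \<otimes>\<^bsub>obB E'\<^esub> \<phi> b) \<otimes>\<^bsub>obB E'\<^esub> (mk E' a' \<otimes>\<^bsub>obB E'\<^esub> \<phi> b')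
    = mk E' (a \<otimes>\<^bsub>obA E'\<^esub> a') \<otimes>\<^bsub>obB E'\<^esub> \<phi> (b \<otimes>\<^bsub>obB E\<^esub> b')"
proof -
  have "\<phi> b \<otimes>\<^bsub>obB E'\<^esub> (mk E' a' \<otimes>\<^bsub>obB E'\<^esub> \<phi> b') = mk E' a' \<otimes>\<^bsub>obB E'\<^esub> (\<phi> b \<otimes>\<^bsub>obB E'\<^esub> \<phi> b')"
    using assms E'.k_central[of a' "\<phi> b"] by (simp flip: E'.B.m_assoc)
  then show ?thesis using assms mon_hom_mult[OF \<phi>_hom] by (simp add: E'.B.m_assoc)
qed

end

text \<open>The map on \<open>B'\<close> is forced: a product of \<open>mk E' a\<close> and
  \<open>\<phi> b\<close> must go to the product of \<open>mk E'' (w a)\<close> and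
  \<open>\<phi>g b\<close>. Comparison over a common representative shows that the result is
  independent of the decomposition.\<close>

lemma opcartesian_exists:
  assumes q: "bij_morphism E E' \<phi> \<psi>"
    and E'': "crossed_ext E''" "obM E = obM E''" and g: "crossed_ext_hom E E'' \<phi>g \<psi>g"
    and w: "w \<in> mon_hom (obA E') (obA E'')"
      "\<And>m a. m \<in> carrier (obM E) \<Longrightarrow> a \<in> carrier (obA E') \<Longrightarrow> w (induced_action E' m a) = induced_action E'' m (w a)"
    and ws: "\<And>a. a \<in> carrier (obA E) \<Longrightarrow> starA E E'' \<phi>g a = w (starA E E' \<phi> a)"
  shows "\<exists>\<phi>h \<psi>h. crossed_ext_hom E' E'' \<phi>h \<psi>h \<and> (\<forall>b\<in>carrier (obB E). \<phi>h (\<phi> b) = \<phi>g b) \<and>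
    (\<forall>c\<in>carrier (obC E). \<psi>h (\<psi> c) = \<psi>g c) \<and> starA E' E'' \<phi>h = w"
proof -
  interpret bij_morphism E E' \<phi> \<psi> by fact
  interpret E'': crossed_ext E'' by fact
  note \<phi>g = crossed_ext_homD(1)[OF g] and \<psi>g = crossed_ext_homD(2)[OF g]
  have gcl [simp]: "b \<in> E.B \<Longrightarrow> \<phi>g b \<in> E''.B" "c \<in> E.C \<Longrightarrow> \<psi>g c \<in> E''.C" for b c
    by (simp_all add: mon_hom_closed[OF \<phi>g] mon_hom_closed[OF \<psi>g])
  have wcl [simp]: "a \<in> E'.A \<Longrightarrow> w a \<in> E''.A" for a by (simp add: mon_hom_closed[OF w(1)])
  have ks: "mk E'' (w (starA E E' \<phi> a)) = \<phi>g (mk E a)" if "a \<in> E.A" for a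
    using starA(2)[OF E.crossed_ext_axioms E''(1) g that] ws[OF that] by simp
  \<comment> \<open>The forced value on the element decomposed into \<open>a\<close> and
    \<open>b\<close>; \<open>wd\<close> below shows that it depends on that element only.\<close>
  define val where "val a b = mk E'' (w a) \<otimes>\<^bsub>obB E''\<^esub> \<phi>g b" for a b
  have val_cl [simp]: "a \<in> E'.A \<Longrightarrow> b \<in> E.B \<Longrightarrow> val a b \<in> E''.B" for a b by (simp add: val_def)
  have shift: "mk E' a \<otimes>\<^bsub>obB E'\<^esub> \<phi> (mk E x \<otimes>\<^bsub>obB E\<^esub> v) = mk E' (a \<otimes>\<^bsub>obA E'\<^esub> starA E E' \<phi> x) \<otimes>\<^bsub>obB E'\<^esub> \<phi> v"
      "val a (mk E x \<otimes>\<^bsub>obB E\<^esub> v) = val (a \<otimes>\<^bsub>obA E'\<^esub> starA E E' \<phi> x) v"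
    if "a \<in> E'.A" "x \<in> E.A" "v \<in> E.B" for a x v
    using that mon_hom_mult[OF \<phi>_hom] mon_hom_mult[OF \<phi>g] mon_hom_mult[OF w(1)]
    by (simp_all add: val_def ks E'.B.m_assoc E''.B.m_assoc)
  have wd: "val a b = val a' b'"
    if ab: "a \<in> E'.A" "b \<in> E.B" "a' \<in> E'.A" "b' \<in> E.B"
      and eq: "mk E' a \<otimes>\<^bsub>obB E'\<^esub> \<phi> b = mk E' a' \<otimes>\<^bsub>obB E'\<^esub> \<phi> b'" for a b a' b'
  proof -
    \<comment> \<open>Injectivity of \<open>\<psi>\<close> puts \<open>b\<close> and
      \<open>b'\<close> over the same element of \<open>N\<close>, so both are translates of a
      single representative \<open>v\<close>.\<close>
    have "md E' (\<phi> b) = md E' (\<phi> b')"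
      using arg_cong[OF eq, of "md E'"] ab(1-4) by simp
    then have db: "md E b = md E b'" using crossed_ext_homD(3)[OF crossed_ext_hom] ab(2,4) by simp
    obtain v where "E.repAB (md E b) v" using E.repA ab(2) by blast
    note v = representativeD[OF this]
    obtain x x' where x: "x \<in> E.A" "b = mk E x \<otimes>\<^bsub>obB E\<^esub> v" "x' \<in> E.A" "b' = mk E x' \<otimes>\<^bsub>obB E\<^esub> v"
      using v(3)[of b] v(3)[of b'] db ab(2,4) by auto
    \<comment> \<open>Once \<open>x\<close> and \<open>x'\<close> are absorbed into the first
      components, the same factor \<open>\<phi> v\<close> remains on both sides and is cancelled by
      freeness of \<open>A'\<close> on \<open>B'\<close>.\<close>
    have "mk E' (a \<otimes>\<^bsub>obA E'\<^esub> starA E E' \<phi> x) \<otimes>\<^bsub>obB E'\<^esub> \<phi> v = mk E' (a' \<otimes>\<^bsub>obA E'\<^esub> starA E E' \<phi> x') \<otimes>\<^bsub>obB E'\<^esub> \<phi> v"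
      using eq unfolding x(2,4) shift(1)[OF ab(1) x(1) v(1)] shift(1)[OF ab(3) x(3) v(1)] .
    then have "a \<otimes>\<^bsub>obA E'\<^esub> starA E E' \<phi> x = a' \<otimes>\<^bsub>obA E'\<^esub> starA E E' \<phi> x'"
      by (rule E'.freeA[of _ _ "\<phi> v", rotated 3]) (use ab(1,3) x(1,3) v(1) in simp_all)
    then show ?thesis
      unfolding x(2,4) shift(2)[OF ab(1) x(1) v(1)] shift(2)[OF ab(3) x(3) v(1)] by simp
  qed
  define \<phi>h where "\<phi>h = (\<lambda>y\<in>E'.B. THE z. \<exists>a\<in>E'.A. \<exists>b\<in>E.B. y = mk E' a \<otimes>\<^bsub>obB E'\<^esub> \<phi> b \<and> z = val a b)"
  define \<psi>h where "\<psi>h = (\<lambda>c\<in>E'.C. \<psi>g (inv_into E.C \<psi> c))"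
  have h: "\<phi>h (mk E' a \<otimes>\<^bsub>obB E'\<^esub> \<phi> b) = val a b" if "a \<in> E'.A" "b \<in> E.B" for a b
  proof -
    have "(THE z. \<exists>a'\<in>E'.A. \<exists>b'\<in>E.B. mk E' a \<otimes>\<^bsub>obB E'\<^esub> \<phi> b = mk E' a' \<otimes>\<^bsub>obB E'\<^esub> \<phi> b' \<and> z = val a' b') = val a b"
      (is "The ?P = _")
    proof (rule the_equality)
      show "?P (val a b)" using that by blast
      fix z assume "?P z"
      then obtain a' b' where *: "a' \<in> E'.A" "b' \<in> E.B" "z = val a' b'"
        "mk E' a \<otimes>\<^bsub>obB E'\<^esub> \<phi> b = mk E' a' \<otimes>\<^bsub>obB E'\<^esub> \<phi> b'" by blast
      show "z = val a b" unfolding *(3) by (rule wd[OF that *(1,2,4), symmetric])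
    qed
    then show ?thesis using that by (simp add: \<phi>h_def)
  qed
  have \<psi>h: "\<psi>h (\<psi> c) = \<psi>g c" if "c \<in> E.C" for c
    using bij that by (simp add: \<psi>h_def bij_betw_inv_into_left)
  have h1: "\<phi>h (\<phi> b) = \<phi>g b" if "b \<in> E.B" for b
    using h[of "\<one>\<^bsub>obA E'\<^esub>" b] that mon_hom_one[OF w(1)] by (simp add: val_def)
  have hk: "\<phi>h (mk E' a) = mk E'' (w a)" if "a \<in> E'.A" for a
    using h[of a "\<one>\<^bsub>obB E\<^esub>"] that mon_hom_one[OF \<phi>_hom] mon_hom_one[OF \<phi>g] by (simp add: val_def)
  have dec: thesis if "y \<in> E'.B"
    "\<And>a b. a \<in> E'.A \<Longrightarrow> b \<in> E.B \<Longrightarrow> y = mk E' a \<otimes>\<^bsub>obB E'\<^esub> \<phi> b \<Longrightarrow> thesis" for y thesis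
    using decompose[OF that(1)] that(2) by blast
  have val_mult: "val (a \<otimes>\<^bsub>obA E'\<^esub> a') (b \<otimes>\<^bsub>obB E\<^esub> b') = val a b \<otimes>\<^bsub>obB E''\<^esub> val a' b'"
    if "a \<in> E'.A" "b \<in> E.B" "a' \<in> E'.A" "b' \<in> E.B" for a b a' b'
  proof -
    have "\<phi>g b \<otimes>\<^bsub>obB E''\<^esub> (mk E'' (w a') \<otimes>\<^bsub>obB E''\<^esub> \<phi>g b') = mk E'' (w a') \<otimes>\<^bsub>obB E''\<^esub> (\<phi>g b \<otimes>\<^bsub>obB E''\<^esub> \<phi>g b')"
      using that E''.k_central[of "w a'" "\<phi>g b"] by (simp flip: E''.B.m_assoc)
    then show ?thesis using that mon_hom_mult[OF \<phi>g] mon_hom_mult[OF w(1)]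
      by (simp add: val_def E''.B.m_assoc)
  qed
  have \<phi>h_hom: "\<phi>h \<in> mon_hom (obB E') (obB E'')"
    unfolding mon_hom_iff
  proof (intro conjI ballI)
    fix y assume y: "y \<in> E'.B"
    obtain a b where ab: "a \<in> E'.A" "b \<in> E.B" "y = mk E' a \<otimes>\<^bsub>obB E'\<^esub> \<phi> b" using dec[OF y] .
    show "\<phi>h y \<in> E''.B" unfolding ab(3) h[OF ab(1,2)] using ab(1,2) by simp
    fix y' assume y': "y' \<in> E'.B"
    obtain a' b' where ab': "a' \<in> E'.A" "b' \<in> E.B" "y' = mk E' a' \<otimes>\<^bsub>obB E'\<^esub> \<phi> b'" using dec[OF y'] .
    show "\<phi>h (y \<otimes>\<^bsub>obB E'\<^esub> y') = \<phi>h y \<otimes>\<^bsub>obB E''\<^esub> \<phi>h y'"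
      unfolding ab(3) ab'(3) mult_decomposed[OF ab(1,2) ab'(1,2)] h[OF ab(1,2)] h[OF ab'(1,2)]
        h[OF E'.A.m_closed[OF ab(1) ab'(1)] E.B.m_closed[OF ab(2) ab'(2)]]
      by (rule val_mult[OF ab(1,2) ab'(1,2)])
  next
    show "\<phi>h \<one>\<^bsub>obB E'\<^esub> = \<one>\<^bsub>obB E''\<^esub>"
      using h1[of "\<one>\<^bsub>obB E\<^esub>"] mon_hom_one[OF \<phi>_hom] mon_hom_one[OF \<phi>g] by simp
  qed (simp add: \<phi>h_def)
  have \<psi>h_hom: "\<psi>h \<in> mon_hom (obC E') (obC E'')"
    unfolding mon_hom_iff
  proof (intro conjI ballI)
    fix y assume y: "y \<in> E'.C"
    obtain c where c: "c \<in> E.C" "y = \<psi> c" using psi_surj[OF y] by blast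
    show "\<psi>h y \<in> E''.C" unfolding c(2) \<psi>h[OF c(1)] using c(1) by simp
    fix y' assume y': "y' \<in> E'.C"
    obtain c' where c': "c' \<in> E.C" "y' = \<psi> c'" using psi_surj[OF y'] by blast
    have "\<psi>h (\<psi> (c \<otimes>\<^bsub>obC E\<^esub> c')) = \<psi>h (\<psi> c) \<otimes>\<^bsub>obC E''\<^esub> \<psi>h (\<psi> c')"
      using c(1) c'(1) mon_hom_mult[OF \<psi>g] by (simp add: \<psi>h)
    then show "\<psi>h (y \<otimes>\<^bsub>obC E'\<^esub> y') = \<psi>h y \<otimes>\<^bsub>obC E''\<^esub> \<psi>h y'"
      unfolding c(2) c'(2) using mon_hom_mult[OF \<psi>_hom c(1) c'(1)] by simp
  next
    show "\<psi>h \<one>\<^bsub>obC E'\<^esub> = \<one>\<^bsub>obC E''\<^esub>"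
      using \<psi>h[of "\<one>\<^bsub>obC E\<^esub>"] mon_hom_one[OF \<psi>_hom] mon_hom_one[OF \<psi>g] by simp
  qed (simp add: \<psi>h_def)
  have "crossed_ext_hom E' E'' \<phi>h \<psi>h"
    unfolding crossed_ext_hom_def
  proof (intro conjI ballI allI impI)
    fix y assume y: "y \<in> E'.B"
    obtain a b where ab: "a \<in> E'.A" "b \<in> E.B" "y = mk E' a \<otimes>\<^bsub>obB E'\<^esub> \<phi> b" using dec[OF y] .
    show "md E'' (\<phi>h y) = \<psi>h (md E' y)"
      unfolding ab(3) h[OF ab(1,2)] using ab(1,2) crossed_ext_homD(3)[OF crossed_ext_hom] crossed_ext_homD(3)[OF g]
      by (simp add: val_def \<psi>h)
  next
    fix z y assume z: "z \<in> E'.C" and y: "y \<in> E'.B"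
    obtain a b where ab: "a \<in> E'.A" "b \<in> E.B" "y = mk E' a \<otimes>\<^bsub>obB E'\<^esub> \<phi> b" using dec[OF y] .
    obtain c where c: "c \<in> E.C" "z = \<psi> c" using psi_surj[OF z] by blast
    note ind = E'.induced[OF closed(2)[OF c(1)] ab(1)]
    note ind'' = E''.induced[OF gcl(2)[OF c(1)] wcl[OF ab(1)]]
    have pc: "mp E' (\<psi> c) = mp E c" "mp E'' (\<psi>g c) = mp E c" using crossed_ext_homD(5)[OF crossed_ext_hom c(1)] crossed_ext_homD(5)[OF g c(1)] by auto
    \<comment> \<open>The component from \<open>A'\<close> is moved by the induced action at
      \<open>mp E c\<close>, which \<open>w\<close> respects; the other component is moved inside
      \<open>B\<close>, where \<open>\<phi>\<close> and \<open>\<phi>g\<close> are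
      equivariant.\<close>
    have "act E' (\<psi> c) y = mk E' (induced_action E' (mp E c) a) \<otimes>\<^bsub>obB E'\<^esub> \<phi> (act E c b)"
      using ab c ind pc crossed_ext_homD(4)[OF crossed_ext_hom] by simp
    then have "\<phi>h (act E' (\<psi> c) y) = val (induced_action E' (mp E c) a) (act E c b)"
      using h[OF ind(1)[unfolded pc] E.act_closed[OF c(1) ab(2)]] by (simp only:)
    also have "\<dots> = mk E'' (induced_action E'' (mp E c) (w a)) \<otimes>\<^bsub>obB E''\<^esub> act E'' (\<psi>g c) (\<phi>g b)"
      using w(2)[OF E.p_closed[OF c(1)] ab(1)] crossed_ext_homD(4)[OF g c(1) ab(2)] by (simp add: val_def)
    also have "\<dots> = act E'' (\<psi>g c) (val a b)"
      using ind'' pc ab(1,2) c(1) by (simp add: val_def)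
    finally show "\<phi>h (act E' z y) = act E'' (\<psi>h z) (\<phi>h y)"
      unfolding c(2) ab(3) \<psi>h[OF c(1)] h[OF ab(1,2)] .
  next
    fix z assume z: "z \<in> E'.C"
    obtain c where c: "c \<in> E.C" "z = \<psi> c" using psi_surj[OF z] by blast
    show "mp E'' (\<psi>h z) = mp E' z" unfolding c(2) \<psi>h[OF c(1)] using crossed_ext_homD(5)[OF crossed_ext_hom c(1)] crossed_ext_homD(5)[OF g c(1)] by simp
  next
    fix n' v' assume n': "n' \<in> E'.N" and v': "E'.repAB n' v'"
    obtain n where n: "n \<in> E.N" "n' = \<psi> n" using psi_N_surj[OF n'] by blast
    \<comment> \<open>One representative in \<open>E\<close> suffices. The given \<open>v'\<close>
      differs from \<open>\<phi> v\<close> by an invertible \<open>a\<close>, so its image differs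
      from the representative \<open>\<phi>g v\<close> by the invertible \<open>w a\<close>.\<close>
    obtain v where v: "E.repAB n v" using E.repA n by blast
    note vB = representativeD(1)[OF v]
    obtain a b where ab: "a \<in> E'.A" "b \<in> E'.A" "a \<otimes>\<^bsub>obA E'\<^esub> b = \<one>\<^bsub>obA E'\<^esub>" "b \<otimes>\<^bsub>obA E'\<^esub> a = \<one>\<^bsub>obA E'\<^esub>"
      "v' = mk E' a \<otimes>\<^bsub>obB E'\<^esub> \<phi> v"
      by (rule E'.sA.rep_related[OF crossed_ext_homD(6)[OF crossed_ext_hom n(1) v, folded n(2)] v'])
    have wab: "w a \<otimes>\<^bsub>obA E''\<^esub> w b = \<one>\<^bsub>obA E''\<^esub>" "w b \<otimes>\<^bsub>obA E''\<^esub> w a = \<one>\<^bsub>obA E''\<^esub>"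
      using mon_hom_mult[OF w(1) ab(1,2)] mon_hom_mult[OF w(1) ab(2,1)] mon_hom_one[OF w(1)] ab(3,4) by auto
    have nC: "n \<in> E.C" using n(1) by auto
    show "E''.repAB (\<psi>h n') (\<phi>h v')"
      unfolding n(2) \<psi>h[OF nC] ab(5) h[OF ab(1) vB] val_def
      by (rule E''.sA.rep_translate[OF crossed_ext_homD(6)[OF g n(1) v] wcl[OF ab(1)] wcl[OF ab(2)] wab])
  next
    fix m u' assume m: "m \<in> carrier (obM E')" and u': "E'.repNC m u'"
    have m': "m \<in> carrier (obM E)" using m same_M by simp
    obtain u where u: "E.repNC m u" using E.repN m' by blast
    note uC = representativeD(1)[OF u]
    obtain a' b' where ab': "a' \<in> carrier (obN E')" "b' \<in> carrier (obN E')"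
      "a' \<otimes>\<^bsub>obN E'\<^esub> b' = \<one>\<^bsub>obN E'\<^esub>" "b' \<otimes>\<^bsub>obN E'\<^esub> a' = \<one>\<^bsub>obN E'\<^esub>"
      "u' = mn E' a' \<otimes>\<^bsub>obC E'\<^esub> \<psi> u"
      by (rule E'.sN.rep_related[OF crossed_ext_homD(7)[OF crossed_ext_hom m' u] u'])
    \<comment> \<open>Here the translating elements lie in \<open>N'\<close>. They are pulled back
      along \<open>\<psi>\<close>, whose injectivity keeps them mutually inverse, before
      \<open>\<psi>g\<close> is applied.\<close>
    obtain a b where ab: "a \<in> E.N" "a' = \<psi> a" "b \<in> E.N" "b' = \<psi> b"
      using psi_N_surj[of a'] psi_N_surj[of b'] ab'(1,2) by auto
    have abC: "a \<in> E.C" "b \<in> E.C" using ab by auto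
    have "a \<otimes>\<^bsub>obC E\<^esub> b = \<one>\<^bsub>obC E\<^esub>" "b \<otimes>\<^bsub>obC E\<^esub> a = \<one>\<^bsub>obC E\<^esub>"
      using ab'(3,4) abC mon_hom_mult[OF \<psi>_hom] mon_hom_one[OF \<psi>_hom]
      by (subst psi_eq[symmetric]; simp add: ab(2,4))+
    then have gab: "\<psi>g a \<otimes>\<^bsub>obN E''\<^esub> \<psi>g b = \<one>\<^bsub>obN E''\<^esub>" "\<psi>g b \<otimes>\<^bsub>obN E''\<^esub> \<psi>g a = \<one>\<^bsub>obN E''\<^esub>"
      using mon_hom_mult[OF \<psi>g] mon_hom_one[OF \<psi>g] abC by (metis obN_sel(2,3))+
    have gN: "\<psi>g a \<in> carrier (obN E'')" "\<psi>g b \<in> carrier (obN E'')"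
      using ab(1,3) crossed_ext_homD(3)[OF g, symmetric] by auto
    have "u' = \<psi> (a \<otimes>\<^bsub>obC E\<^esub> u)"
      using ab'(1,5) ab(2) mon_hom_mult[OF \<psi>_hom abC(1) uC] by simp
    then have "\<psi>h u' = mn E'' (\<psi>g a) \<otimes>\<^bsub>obC E''\<^esub> \<psi>g u"
      using \<psi>h[of "a \<otimes>\<^bsub>obC E\<^esub> u"] abC(1) uC gN(1) mon_hom_mult[OF \<psi>g abC(1) uC] by simp
    then show "E''.repNC m (\<psi>h u')"
      using E''.sN.rep_translate[OF crossed_ext_homD(7)[OF g m' u] gN gab] by simp
  qed (fact \<phi>h_hom \<psi>h_hom)+
  moreover from this have "starA E' E'' \<phi>h = w"
    by (rule starA_eqI[OF E'.crossed_ext_axioms E''(1)]) (use w(1) hk in auto)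
  ultimately show ?thesis using h1 \<psi>h by blast
qed

text \<open>On \<open>B'\<close> the equality of the \<open>starA\<close> maps settles the factor
  from \<open>A'\<close>, agreement after \<open>\<phi>\<close> settles the other one, and
  \<open>decompose\<close> covers all elements.\<close>

lemma opcartesian_unique:
  assumes q: "bij_morphism E E' \<phi> \<psi>" and E'': "crossed_ext E''"
    and h: "crossed_ext_hom E' E'' \<phi>1 \<psi>1" "crossed_ext_hom E' E'' \<phi>2 \<psi>2"
    and eq: "\<And>b. b \<in> carrier (obB E) \<Longrightarrow> \<phi>1 (\<phi> b) = \<phi>2 (\<phi> b)" "\<And>c. c \<in> carrier (obC E) \<Longrightarrow> \<psi>1 (\<psi> c) = \<psi>2 (\<psi> c)"
      "starA E' E'' \<phi>1 = starA E' E'' \<phi>2"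
  shows "\<phi>1 = \<phi>2" "\<psi>1 = \<psi>2"
proof -
  interpret bij_morphism E E' \<phi> \<psi> by fact
  interpret E'': crossed_ext E'' by fact
  show "\<phi>1 = \<phi>2"
  proof (rule mon_hom_eqI[OF crossed_ext_homD(1)[OF h(1)] crossed_ext_homD(1)[OF h(2)]])
    fix y assume y: "y \<in> E'.B"
    obtain a b where ab: "a \<in> E'.A" "b \<in> E.B" "y = mk E' a \<otimes>\<^bsub>obB E'\<^esub> \<phi> b" using decompose[OF y] by blast
    have "\<phi>1 (mk E' a) = \<phi>2 (mk E' a)"
      using starA(2)[OF E'.crossed_ext_axioms E'' h(1) ab(1)] starA(2)[OF E'.crossed_ext_axioms E'' h(2) ab(1)] eq(3) by simp
    then show "\<phi>1 y = \<phi>2 y"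
      using ab eq(1) mon_hom_mult[OF crossed_ext_homD(1)[OF h(1)]] mon_hom_mult[OF crossed_ext_homD(1)[OF h(2)]] by simp
  qed
  show "\<psi>1 = \<psi>2"
  proof (rule mon_hom_eqI[OF crossed_ext_homD(2)[OF h(1)] crossed_ext_homD(2)[OF h(2)]])
    fix y assume y: "y \<in> E'.C"
    obtain c where "c \<in> E.C" "y = \<psi> c" using psi_surj[OF y] by blast
    then show "\<psi>1 y = \<psi>2 y" using eq(2) by simp
  qed
qed

section \<open>Push forward\<close>

text \<open>Pairs encoded within the universe type, as the monoids of the category all have their
  carrier there. Surjectivity of \<open>pr\<close> lets equality of elements be tested on the two
  coordinates.\<close>

locale pairing_bijection =
  fixes pr :: "'u \<Rightarrow> 'u \<Rightarrow> 'u" and \<pi>1 \<pi>2 :: "'u \<Rightarrow> 'u"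
  assumes \<pi>1 [simp]: "\<pi>1 (pr x y) = x" and \<pi>2 [simp]: "\<pi>2 (pr x y) = y"
    and pr [simp]: "pr (\<pi>1 z) (\<pi>2 z) = z"
begin

lemma pr_eq_iff [simp]: "pr x y = pr x' y' \<longleftrightarrow> x = x' \<and> y = y'"
  by (metis \<pi>1 \<pi>2)

end

locale push_forward = pairing_bijection pr \<pi>1 \<pi>2 + crossed_ext E
  for pr :: "'u \<Rightarrow> 'u \<Rightarrow> 'u" and \<pi>1 \<pi>2 and E :: "'u xseq" +
  fixes A' \<eta>' w
  assumes semimodule: "can_semimodule (obM E) (A', \<eta>')"
    and w_hom: "w \<in> mon_hom (obA E) A'"
    and w_act: "m \<in> carrier (obM E) \<Longrightarrow> a \<in> A \<Longrightarrow> w (induced_action E m a) = \<eta>' m (w a)"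
begin

sublocale A': comm_monoid A' using semimodule by (simp add: can_semimodule_def)

lemma A'_canc: "right_cancellative A'" using semimodule by (simp add: can_semimodule_def)

lemma \<eta>'_hom: "\<eta>' \<in> mon_hom (obM E) (End_monoid A')"
  using semimodule by (simp add: can_semimodule_def)

lemma w_simps [simp]: "a \<in> A \<Longrightarrow> w a \<in> carrier A'"
  "a \<in> A \<Longrightarrow> a' \<in> A \<Longrightarrow> w (a \<otimes>\<^bsub>obA E\<^esub> a') = w a \<otimes>\<^bsub>A'\<^esub> w a'" "w \<one>\<^bsub>obA E\<^esub> = \<one>\<^bsub>A'\<^esub>"
  using w_hom by (auto simp: mon_hom_iff)

lemma \<eta>'_simps [simp]:
  "m \<in> carrier (obM E) \<Longrightarrow> x \<in> carrier A' \<Longrightarrow> \<eta>' m x \<in> carrier A'"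
  "m \<in> carrier (obM E) \<Longrightarrow> x \<in> carrier A' \<Longrightarrow> y \<in> carrier A' \<Longrightarrow> \<eta>' m (x \<otimes>\<^bsub>A'\<^esub> y) = \<eta>' m x \<otimes>\<^bsub>A'\<^esub> \<eta>' m y"
  "m \<in> carrier (obM E) \<Longrightarrow> \<eta>' m \<one>\<^bsub>A'\<^esub> = \<one>\<^bsub>A'\<^esub>"
  "m \<in> carrier (obM E) \<Longrightarrow> m' \<in> carrier (obM E) \<Longrightarrow> x \<in> carrier A' \<Longrightarrow> \<eta>' (m \<otimes>\<^bsub>obM E\<^esub> m') x = \<eta>' m (\<eta>' m' x)"
  "x \<in> carrier A' \<Longrightarrow> \<eta>' \<one>\<^bsub>obM E\<^esub> x = x"
  using \<eta>'_hom unfolding action_hom_iff[OF mM] by (simp_all add: mon_hom_iff)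

text \<open>The choice is not normalised: over the neutral element of \<open>N\<close> it may differ
  from the neutral element of \<open>B\<close>.\<close>

definition v :: "'u \<Rightarrow> 'u" where "v n = (SOME v. repAB n v)"

definition coord :: "'u \<Rightarrow> 'u" where "coord b = (THE a. a \<in> A \<and> b = k a \<otimes>\<^bsub>obB E\<^esub> v (d b))"

text \<open>\<open>\<theta> x b\<close> encodes the class of \<open>(x, b)\<close> in the quotient of \<open>A' \<times> B\<close> by
  \<open>(x, k(a) + b) \<sim> (x + w(a), b)\<close>.\<close>

definition \<theta> :: "'u \<Rightarrow> 'u \<Rightarrow> 'u" where "\<theta> x b = pr (x \<otimes>\<^bsub>A'\<^esub> w (coord b)) (d b)"

lemma v_rep: "n \<in> N \<Longrightarrow> repAB n (v n)"
  unfolding v_def using repA by (rule someI_ex)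

lemma v [simp]: "b \<in> B \<Longrightarrow> v (d b) \<in> B" "b \<in> B \<Longrightarrow> d (v (d b)) = d b"
  by (simp_all add: representativeD(1,2)[OF v_rep[OF imageI]])

lemma coord: "b \<in> B \<Longrightarrow> coord b \<in> A" "b \<in> B \<Longrightarrow> k (coord b) \<otimes>\<^bsub>obB E\<^esub> v (d b) = b"
proof -
  assume b: "b \<in> B"
  have "\<exists>!a. a \<in> A \<and> b = k a \<otimes>\<^bsub>obB E\<^esub> v (d b)"
    using v_rep[of "d b"] b by (intro representativeD(3)) auto
  from theI'[OF this, folded coord_def] show "coord b \<in> A" "k (coord b) \<otimes>\<^bsub>obB E\<^esub> v (d b) = b" by auto
qed

lemmas [simp] = coord(1)

lemma coord_eqI: "a \<in> A \<Longrightarrow> b \<in> B \<Longrightarrow> b = k a \<otimes>\<^bsub>obB E\<^esub> v (d b) \<Longrightarrow> coord b = a"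
  by (rule freeA[of _ _ "v (d b)"]) (simp_all add: coord)

text \<open>Translation by \<open>k a\<close> does not change the image under \<open>d\<close>, so
  both elements are measured against the same chosen representative.\<close>

lemma coord_translate: "a \<in> A \<Longrightarrow> b \<in> B \<Longrightarrow> coord (k a \<otimes>\<^bsub>obB E\<^esub> b) = a \<otimes>\<^bsub>obA E\<^esub> coord b"
  by (rule coord_eqI) (simp_all add: coord B.m_assoc)

text \<open>The relation that defines the quotient, now an equality of encodings.\<close>

lemma \<theta>_translate: "x \<in> carrier A' \<Longrightarrow> a \<in> A \<Longrightarrow> b \<in> B \<Longrightarrow>
    \<theta> x (k a \<otimes>\<^bsub>obB E\<^esub> b) = \<theta> (x \<otimes>\<^bsub>A'\<^esub> w a) b"
  by (simp add: \<theta>_def coord_translate A'.m_assoc)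

lemma \<theta>_section: "b \<in> B \<Longrightarrow> x \<in> carrier A' \<Longrightarrow> \<theta> x (v (d b)) = pr x (d b)"
proof -
  assume b: "b \<in> B" and x: "x \<in> carrier A'"
  have "coord (v (d b)) = \<one>\<^bsub>obA E\<^esub>" using b by (intro coord_eqI) simp_all
  then show ?thesis using b x by (simp add: \<theta>_def)
qed

lemma \<theta>_inj: "x \<in> carrier A' \<Longrightarrow> y \<in> carrier A' \<Longrightarrow> b \<in> B \<Longrightarrow> \<theta> x b = \<theta> y b \<Longrightarrow> x = y"
  using A'_canc by (simp add: \<theta>_def right_cancellative_def) (metis coord(1) w_simps(1))

text \<open>By \<open>\<theta>_section\<close> a pair \<open>pr x n\<close> stands for the class of
  \<open>x\<close> and \<open>v n\<close>, whence the product of chosen representatives in the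
  multiplication. The unit is in general not the pair of neutral elements, because \<open>v\<close>
  need not be neutral there.\<close>

definition B' :: "'u monoid" where
  "B' = \<lparr>carrier = {z. \<pi>1 z \<in> carrier A' \<and> \<pi>2 z \<in> N},
     mult = (\<lambda>z z'. \<theta> (\<pi>1 z \<otimes>\<^bsub>A'\<^esub> \<pi>1 z') (v (\<pi>2 z) \<otimes>\<^bsub>obB E\<^esub> v (\<pi>2 z'))), one = \<theta> \<one>\<^bsub>A'\<^esub> \<one>\<^bsub>obB E\<^esub>\<rparr>"

definition push_ext :: "'u xseq" where
  "push_ext = \<lparr>obA = A', obB = B', obC = obC E, obM = obM E,
     mk = (\<lambda>x\<in>carrier A'. \<theta> x \<one>\<^bsub>obB E\<^esub>), md = (\<lambda>z\<in>carrier B'. \<pi>2 z), mp = p,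
     act = (\<lambda>c\<in>C. \<lambda>z\<in>carrier B'. \<theta> (\<eta>' (p c) (\<pi>1 z)) (\<alpha> c (v (\<pi>2 z))))\<rparr>"

lemma \<theta>_closed [simp]: "x \<in> carrier A' \<Longrightarrow> b \<in> B \<Longrightarrow> \<theta> x b \<in> carrier B'"
  by (simp add: \<theta>_def B'_def)

text \<open>From here on computations use arbitrary \<open>x\<close> and \<open>b\<close> in place
  of chosen representatives, so the laws of \<open>B'\<close> follow from those of \<open>A'\<close>
  and \<open>B\<close>.\<close>

lemma B'_cases:
  assumes "z \<in> carrier B'"
  obtains x b where "x \<in> carrier A'" "b \<in> B" "z = \<theta> x b"
proof -
  obtain b where b: "b \<in> B" "\<pi>2 z = d b" and x: "\<pi>1 z \<in> carrier A'" using assms by (auto simp: B'_def)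
  have "\<theta> (\<pi>1 z) (v (d b)) = z" using \<theta>_section[OF b(1) x] b(2) pr by metis
  then show thesis using that x b(1) v by metis
qed

text \<open>The multiplication is the one induced from the product of \<open>A'\<close> and
  \<open>B\<close>. The two coordinates are collected in front of the chosen representatives since
  the image of \<open>k\<close> is central.\<close>

lemma \<theta>_mult:
  assumes "x \<in> carrier A'" "b \<in> B" "x' \<in> carrier A'" "b' \<in> B"
  shows "\<theta> x b \<otimes>\<^bsub>B'\<^esub> \<theta> x' b' = \<theta> (x \<otimes>\<^bsub>A'\<^esub> x') (b \<otimes>\<^bsub>obB E\<^esub> b')"
proof -
  let ?v = "v (d b)" and ?v' = "v (d b')"
  have "b \<otimes>\<^bsub>obB E\<^esub> b' = (k (coord b) \<otimes>\<^bsub>obB E\<^esub> ?v) \<otimes>\<^bsub>obB E\<^esub> (k (coord b') \<otimes>\<^bsub>obB E\<^esub> ?v')"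
    using coord(2) assms by simp
  also have "\<dots> = k (coord b) \<otimes>\<^bsub>obB E\<^esub> ((?v \<otimes>\<^bsub>obB E\<^esub> k (coord b')) \<otimes>\<^bsub>obB E\<^esub> ?v')"
    using assms by (simp add: B.m_assoc)
  also have "\<dots> = k (coord b \<otimes>\<^bsub>obA E\<^esub> coord b') \<otimes>\<^bsub>obB E\<^esub> (?v \<otimes>\<^bsub>obB E\<^esub> ?v')"
    using assms k_central[of "coord b'" ?v] by (simp add: B.m_assoc)
  finally have "\<theta> (x \<otimes>\<^bsub>A'\<^esub> x') (b \<otimes>\<^bsub>obB E\<^esub> b') =
      \<theta> (x \<otimes>\<^bsub>A'\<^esub> x' \<otimes>\<^bsub>A'\<^esub> w (coord b \<otimes>\<^bsub>obA E\<^esub> coord b')) (?v \<otimes>\<^bsub>obB E\<^esub> ?v')"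
    using assms by (simp only: \<theta>_translate[OF A'.m_closed A.m_closed B.m_closed] coord v)
  also have "\<dots> = \<theta> x b \<otimes>\<^bsub>B'\<^esub> \<theta> x' b'"
    using assms by (simp add: B'_def \<theta>_def[of x] \<theta>_def[of x'] A'.m_ac)
  finally show ?thesis by simp
qed

text \<open>Acting on \<open>b\<close> transforms its coordinate by the induced action of
  \<open>p c\<close>; equivariance of \<open>w\<close> matches this with \<open>\<eta>'\<close> on
  the first component.\<close>

lemma \<theta>_act:
  assumes "c \<in> C" "x \<in> carrier A'" "b \<in> B"
  shows "act push_ext c (\<theta> x b) = \<theta> (\<eta>' (p c) x) (\<alpha> c b)"
proof -
  have "\<alpha> c b = \<alpha> c (k (coord b) \<otimes>\<^bsub>obB E\<^esub> v (d b))" using coord(2) assms by simp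
  also have "\<dots> = k (induced_action E (p c) (coord b)) \<otimes>\<^bsub>obB E\<^esub> \<alpha> c (v (d b))"
    using assms induced(2)[OF assms(1) coord(1)[OF assms(3)]] by simp
  finally have "\<theta> (\<eta>' (p c) x) (\<alpha> c b) = \<theta> (\<eta>' (p c) x \<otimes>\<^bsub>A'\<^esub> w (induced_action E (p c) (coord b))) (\<alpha> c (v (d b)))"
    using assms by (simp only: \<theta>_translate[OF \<eta>'_simps(1)[OF p_closed] induced(1) act_closed] coord v)
  also have "\<dots> = act push_ext c (\<theta> x b)"
    using assms \<theta>_closed[OF assms(2,3)] by (simp add: push_ext_def \<theta>_def[of x] w_act)
  finally show ?thesis by simp
qed

lemma B'_monoid: "monoid B'"
proof
  show "z \<otimes>\<^bsub>B'\<^esub> z' \<in> carrier B'" if "z \<in> carrier B'" "z' \<in> carrier B'" for z z'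
    using that by (elim B'_cases) (simp add: \<theta>_mult)
  show "\<one>\<^bsub>B'\<^esub> \<in> carrier B'" by (simp add: B'_def[THEN arg_cong[of _ _ one]])
  show "z \<otimes>\<^bsub>B'\<^esub> z' \<otimes>\<^bsub>B'\<^esub> z'' = z \<otimes>\<^bsub>B'\<^esub> (z' \<otimes>\<^bsub>B'\<^esub> z'')"
    if "z \<in> carrier B'" "z' \<in> carrier B'" "z'' \<in> carrier B'" for z z' z''
    using that by (elim B'_cases) (simp add: \<theta>_mult A'.m_assoc B.m_assoc)
  have one: "\<one>\<^bsub>B'\<^esub> = \<theta> \<one>\<^bsub>A'\<^esub> \<one>\<^bsub>obB E\<^esub>" by (simp add: B'_def)
  show "\<one>\<^bsub>B'\<^esub> \<otimes>\<^bsub>B'\<^esub> z = z" "z \<otimes>\<^bsub>B'\<^esub> \<one>\<^bsub>B'\<^esub> = z" if "z \<in> carrier B'" for z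
    using that by (auto elim!: B'_cases simp: one \<theta>_mult)
qed

lemma B'_one: "\<one>\<^bsub>B'\<^esub> = \<theta> \<one>\<^bsub>A'\<^esub> \<one>\<^bsub>obB E\<^esub>" by (simp add: B'_def)

text \<open>Push forwards thus stay in the full subcategory that is the source of
  \<open>d1\<close>.\<close>

lemma B'_comm:
  assumes "comm_monoid (obB E)"
  shows "comm_monoid B'"
proof -
  interpret BC: comm_monoid "obB E" by fact
  interpret B': monoid B' by (rule B'_monoid)
  show ?thesis
    by unfold_locales (auto elim!: B'_cases simp: \<theta>_mult A'.m_comm BC.m_comm)
qed

lemma push_sel [simp]: "obA push_ext = A'" "obB push_ext = B'" "obC push_ext = obC E" "obM push_ext = obM E" "mp push_ext = p"
  by (simp_all add: push_ext_def)

lemma push_k [simp]: "x \<in> carrier A' \<Longrightarrow> mk push_ext x = \<theta> x \<one>\<^bsub>obB E\<^esub>"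
  by (simp add: push_ext_def)

lemma push_d [simp]: "x \<in> carrier A' \<Longrightarrow> b \<in> B \<Longrightarrow> md push_ext (\<theta> x b) = d b"
  using \<theta>_closed[of x b] by (simp add: push_ext_def) (simp add: \<theta>_def)

text \<open>The image in \<open>C\<close> does not change, so the half of the sequence from
  \<open>N\<close> to \<open>M\<close> is inherited together with its representatives.\<close>

lemma push_N: "md push_ext ` carrier B' = N"
proof
  show "md push_ext ` carrier B' \<subseteq> N" by (auto elim!: B'_cases)
  show "N \<subseteq> md push_ext ` carrier B'"
  proof
    fix n assume "n \<in> N"
    then obtain b where "b \<in> B" "n = d b" by blast
    then show "n \<in> md push_ext ` carrier B'" by (intro image_eqI[of _ _ "\<theta> \<one>\<^bsub>A'\<^esub> b"]) simp_all
  qed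
qed

lemma push_obN [simp]: "obN push_ext = obN E"
  using push_N by (simp add: obN_def)

lemma push_mn [simp]: "mn push_ext = mn E"
  by (simp add: mn_def)

text \<open>An element over \<open>n\<close> is the class of some \<open>x\<close> and
  \<open>k a\<close> times \<open>u\<close>, hence of \<open>x\<close> times \<open>w a\<close> and
  \<open>u\<close>. This gives the coefficient, and \<open>\<theta>_inj\<close> its
  uniqueness.\<close>

lemma rep_push:
  assumes "repAB n u"
  shows "representative A' (mk push_ext) B' (md push_ext) n (\<theta> \<one>\<^bsub>A'\<^esub> u)"
  unfolding representative_def
proof (intro conjI ballI impI)
  note u = representativeD[OF assms]
  show "\<theta> \<one>\<^bsub>A'\<^esub> u \<in> carrier B'" "md push_ext (\<theta> \<one>\<^bsub>A'\<^esub> u) = n" using u by auto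
  have mult: "mk push_ext x \<otimes>\<^bsub>B'\<^esub> \<theta> \<one>\<^bsub>A'\<^esub> u = \<theta> x u" if "x \<in> carrier A'" for x
    using that u(1) by (simp add: \<theta>_mult)
  fix z assume z: "z \<in> carrier B'" "md push_ext z = n"
  obtain x b where xb: "x \<in> carrier A'" "b \<in> B" "z = \<theta> x b" using z(1) by (rule B'_cases)
  have "d b = n" using z(2) xb by simp
  then obtain a where a: "a \<in> A" "b = k a \<otimes>\<^bsub>obB E\<^esub> u" using u(3)[OF xb(2)] by blast
  have z': "z = \<theta> (x \<otimes>\<^bsub>A'\<^esub> w a) u" unfolding xb(3) a(2) by (rule \<theta>_translate[OF xb(1) a(1) u(1)])
  show "\<exists>!y. y \<in> carrier A' \<and> z = mk push_ext y \<otimes>\<^bsub>B'\<^esub> \<theta> \<one>\<^bsub>A'\<^esub> u"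
  proof (rule ex1I[of _ "x \<otimes>\<^bsub>A'\<^esub> w a"])
    show "x \<otimes>\<^bsub>A'\<^esub> w a \<in> carrier A' \<and> z = mk push_ext (x \<otimes>\<^bsub>A'\<^esub> w a) \<otimes>\<^bsub>B'\<^esub> \<theta> \<one>\<^bsub>A'\<^esub> u"
      using xb(1) a(1) z' mult[of "x \<otimes>\<^bsub>A'\<^esub> w a"] by simp
    fix y assume y: "y \<in> carrier A' \<and> z = mk push_ext y \<otimes>\<^bsub>B'\<^esub> \<theta> \<one>\<^bsub>A'\<^esub> u"
    then have "\<theta> y u = \<theta> (x \<otimes>\<^bsub>A'\<^esub> w a) u" using mult z' by simp
    then show "y = x \<otimes>\<^bsub>A'\<^esub> w a" using y xb(1) a(1) u(1) \<theta>_inj by simp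
  qed
qed

lemma push_k_hom: "mk push_ext \<in> mon_hom A' B'"
  unfolding mon_hom_iff by (auto simp: \<theta>_mult B'_one) (simp add: push_ext_def)

lemma push_d_hom: "md push_ext \<in> mon_hom B' (obC E)"
  unfolding mon_hom_iff by (auto elim!: B'_cases simp: \<theta>_mult B'_one) (simp add: push_ext_def)

lemma push_act_hom: "act push_ext \<in> mon_hom (obC E) (End_monoid B')"
  unfolding action_hom_iff[OF mC] mon_hom_iff[of _ B' B']
proof (intro conjI ballI)
  fix c assume c: "c \<in> C"
  show "act push_ext c \<in> extensional (carrier B')" using c by (simp add: push_ext_def)
  show "act push_ext c \<one>\<^bsub>B'\<^esub> = \<one>\<^bsub>B'\<^esub>" using c by (simp add: B'_one \<theta>_act)
  fix z assume z: "z \<in> carrier B'"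
  then show "act push_ext c z \<in> carrier B'" using c by (elim B'_cases) (simp add: \<theta>_act)
  show "act push_ext c (z \<otimes>\<^bsub>B'\<^esub> z') = act push_ext c z \<otimes>\<^bsub>B'\<^esub> act push_ext c z'" if "z' \<in> carrier B'" for z'
    using z that c by (elim B'_cases) (simp add: \<theta>_act \<theta>_mult)
  show "act push_ext (c \<otimes>\<^bsub>obC E\<^esub> c') z = act push_ext c (act push_ext c' z)" if "c' \<in> C" for c'
    using z that c by (elim B'_cases) (simp add: \<theta>_act)
next
  show "act push_ext \<one>\<^bsub>obC E\<^esub> z = z" if "z \<in> carrier B'" for z
    using that by (elim B'_cases) (simp add: \<theta>_act)
  show "act push_ext \<in> extensional C" by (simp add: push_ext_def)
qed

lemma push_crossed_ext: "crossed_ext push_ext"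
proof (rule crossed_ext.intro, simp_all only: push_sel push_N push_obN push_mn)
  show "monoid A'" by (rule A'.monoid_axioms)
  show "right_cancellative A'" by (rule A'_canc)
  show "md push_ext (act push_ext c z) \<otimes>\<^bsub>obC E\<^esub> c = c \<otimes>\<^bsub>obC E\<^esub> md push_ext z" if "c \<in> C" "z \<in> carrier B'" for c z
    using that(2,1) by (elim B'_cases) (simp add: \<theta>_act crossed1)
  show "act push_ext (md push_ext z) z' \<otimes>\<^bsub>B'\<^esub> z = z \<otimes>\<^bsub>B'\<^esub> z'" if "z \<in> carrier B'" "z' \<in> carrier B'" for z z'
    using that by (elim B'_cases) (simp add: \<theta>_act \<theta>_mult crossed2 A'.m_comm)
  show "inj_on (mk push_ext) (carrier A')" by (rule inj_onI) (simp add: \<theta>_inj[of _ _ "\<one>\<^bsub>obB E\<^esub>"])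
  show "mk push_ext ` carrier A' = {b \<in> carrier B'. md push_ext b = \<one>\<^bsub>obC E\<^esub>}"
  proof (intro equalityI subsetI)
    fix z assume "z \<in> {b \<in> carrier B'. md push_ext b = \<one>\<^bsub>obC E\<^esub>}"
    then obtain x b where xb: "x \<in> carrier A'" "b \<in> B" "z = \<theta> x b" "d b = \<one>\<^bsub>obC E\<^esub>"
      by (auto elim!: B'_cases)
    obtain a where a: "a \<in> A" "b = k a" using ker_d xb(2,4) by blast
    have "z = \<theta> (x \<otimes>\<^bsub>A'\<^esub> w a) \<one>\<^bsub>obB E\<^esub>"
      using \<theta>_translate[OF xb(1) a(1) B.one_closed] xb(3) a by simp
    then show "z \<in> mk push_ext ` carrier A'" using xb(1) a(1) by (intro image_eqI[of _ _ "x \<otimes>\<^bsub>A'\<^esub> w a"]) auto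
  qed auto
  show "\<exists>v. representative A' (mk push_ext) B' (md push_ext) n v" if "n \<in> N" for n
    using rep_push[OF v_rep[OF that]] by blast
qed (use B'_monoid mC mM push_k_hom push_d_hom p_hom push_act_hom d_img N_canc repN in simp_all)

text \<open>The canonical map into the quotient. Its companion on \<open>C\<close> is the identity,
  so the lift is bijective there.\<close>

definition q :: "'u \<Rightarrow> 'u" where "q = (\<lambda>b\<in>B. \<theta> \<one>\<^bsub>A'\<^esub> b)"

lemma crossed_ext_hom_q: "crossed_ext_hom E push_ext q (\<lambda>c\<in>C. c)"
  unfolding crossed_ext_hom_def
proof (intro conjI ballI allI impI)
  show "q \<in> mon_hom (obB E) (obB push_ext)" by (auto simp: mon_hom_iff q_def \<theta>_mult B'_one)
  show "(\<lambda>c\<in>C. c) \<in> mon_hom (obC E) (obC push_ext)" using mon_hom_id[OF mC] by simp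
  fix n u assume "n \<in> N" "repAB n u"
  then show "representative (obA push_ext) (mk push_ext) (obB push_ext) (md push_ext) ((\<lambda>c\<in>C. c) n) (q u)"
    using rep_push representativeD(1)[of _ _ _ _ n u] by (auto simp: q_def)
qed (auto simp: q_def \<theta>_act dest: representativeD(1))

lemma starA_q: "starA E push_ext q = w"
proof (rule starA_eqI[OF crossed_ext_axioms push_crossed_ext crossed_ext_hom_q])
  fix a assume "a \<in> A"
  then show "mk push_ext (w a) = q (k a)"
    using \<theta>_translate[of "\<one>\<^bsub>A'\<^esub>" a "\<one>\<^bsub>obB E\<^esub>"] by (simp add: q_def)
qed (simp add: w_hom)

text \<open>Puts the codomain of the lift over the prescribed semimodule by equality, as membership
  in a fibre requires.\<close>

lemma induced_push: "induced_action push_ext = \<eta>'"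
proof (rule crossed_ext.induced_action_eqI[OF push_crossed_ext])
  show "\<eta>' \<in> mon_hom (obM push_ext) (End_monoid (obA push_ext))" using \<eta>'_hom by simp
qed (simp add: \<theta>_act)

end

section \<open>Products and terminal object\<close>

context pairing_bijection
begin

lemma eq_iff: "z = z' \<longleftrightarrow> \<pi>1 z = \<pi>1 z' \<and> \<pi>2 z = \<pi>2 z'"
  by (metis pr)

lemma pair_eqI: "\<pi>1 z = \<pi>1 z' \<Longrightarrow> \<pi>2 z = \<pi>2 z' \<Longrightarrow> z = z'"
  by (metis pr)

definition pmon :: "'u monoid \<Rightarrow> 'u monoid \<Rightarrow> 'u monoid" where
  "pmon G H = \<lparr>carrier = {z. \<pi>1 z \<in> carrier G \<and> \<pi>2 z \<in> carrier H},
     mult = (\<lambda>z z'. pr (\<pi>1 z \<otimes>\<^bsub>G\<^esub> \<pi>1 z') (\<pi>2 z \<otimes>\<^bsub>H\<^esub> \<pi>2 z')), one = pr \<one>\<^bsub>G\<^esub> \<one>\<^bsub>H\<^esub>\<rparr>"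

lemma pmon_simps [simp]:
  "z \<in> carrier (pmon G H) \<longleftrightarrow> \<pi>1 z \<in> carrier G \<and> \<pi>2 z \<in> carrier H"
  "z \<otimes>\<^bsub>pmon G H\<^esub> z' = pr (\<pi>1 z \<otimes>\<^bsub>G\<^esub> \<pi>1 z') (\<pi>2 z \<otimes>\<^bsub>H\<^esub> \<pi>2 z')"
  "\<one>\<^bsub>pmon G H\<^esub> = pr \<one>\<^bsub>G\<^esub> \<one>\<^bsub>H\<^esub>"
  by (simp_all add: pmon_def)

lemma pmon_monoid: "monoid G \<Longrightarrow> monoid H \<Longrightarrow> monoid (pmon G H)"
  by (rule monoidI) (simp_all add: monoid.m_closed monoid.one_closed monoid.m_assoc monoid.l_one monoid.r_one)

lemma pmon_comm_monoid: "comm_monoid G \<Longrightarrow> comm_monoid H \<Longrightarrow> comm_monoid (pmon G H)"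
  by (intro monoid.monoid_comm_monoidI pmon_monoid)
     (simp_all add: comm_monoid.axioms(1) comm_monoid.m_comm)

text \<open>Kept abstract because it serves two situations: \<open>B\<close>, where the middle
  monoid is the full product, and \<open>C\<close>, where it is only the fibre product. The
  assumption \<open>mem\<close> says that enough pairs are present in either case.\<close>

lemma representative_pair_iff:
  assumes S: "\<And>z. z \<in> carrier X'' \<Longrightarrow> \<pi>1 z \<in> carrier X \<and> \<pi>2 z \<in> carrier X'"
    and mult: "\<And>z z'. z \<otimes>\<^bsub>X''\<^esub> z' = pr (\<pi>1 z \<otimes>\<^bsub>X\<^esub> \<pi>1 z') (\<pi>2 z \<otimes>\<^bsub>X'\<^esub> \<pi>2 z')"
    and K: "\<And>z. z \<in> carrier K'' \<longleftrightarrow> \<pi>1 z \<in> carrier K \<and> \<pi>2 z \<in> carrier K'"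
    and k: "\<And>z. z \<in> carrier K'' \<Longrightarrow> k'' z = pr (k (\<pi>1 z)) (k' (\<pi>2 z))"
    and f: "\<And>z. z \<in> carrier X'' \<Longrightarrow> f'' z = m'' \<longleftrightarrow> f (\<pi>1 z) = m \<and> f' (\<pi>2 z) = m'"
    and mem: "\<And>x x'. x \<in> carrier X \<Longrightarrow> x' \<in> carrier X' \<Longrightarrow> f x = m \<Longrightarrow> f' x' = m' \<Longrightarrow> pr x x' \<in> carrier X''"
  shows "representative K'' k'' X'' f'' m'' u \<longleftrightarrow>
    representative K k X f m (\<pi>1 u) \<and> representative K' k' X' f' m' (\<pi>2 u)"
proof
  assume u: "representative K'' k'' X'' f'' m'' u"
  note uD = representativeD[OF u]
  have uX: "\<pi>1 u \<in> carrier X" "\<pi>2 u \<in> carrier X'" "f (\<pi>1 u) = m" "f' (\<pi>2 u) = m'"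
    using S f uD(1,2) by auto
  have dec: "(a \<in> carrier K'' \<and> z = k'' a \<otimes>\<^bsub>X''\<^esub> u) \<longleftrightarrow>
    (\<pi>1 a \<in> carrier K \<and> \<pi>1 z = k (\<pi>1 a) \<otimes>\<^bsub>X\<^esub> \<pi>1 u) \<and> (\<pi>2 a \<in> carrier K' \<and> \<pi>2 z = k' (\<pi>2 a) \<otimes>\<^bsub>X'\<^esub> \<pi>2 u)" for a z
    using K[of a] k[of a] by (auto simp: mult) (metis pr)+
  have ex: "\<exists>!a. (\<pi>1 a \<in> carrier K \<and> x = k (\<pi>1 a) \<otimes>\<^bsub>X\<^esub> \<pi>1 u) \<and> (\<pi>2 a \<in> carrier K' \<and> x' = k' (\<pi>2 a) \<otimes>\<^bsub>X'\<^esub> \<pi>2 u)"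
    if "x \<in> carrier X" "x' \<in> carrier X'" "f x = m" "f' x' = m'" for x x'
    using uD(3)[of "pr x x'"] mem[OF that] f[of "pr x x'"] that unfolding dec by simp
  have "representative K k X f m (\<pi>1 u)"
    unfolding representative_def
  proof (intro conjI ballI impI uX)
    fix x assume x: "x \<in> carrier X" "f x = m"
    \<comment> \<open>The other coordinate is frozen at \<open>\<pi>2 u\<close>; uniqueness of the
      coefficient of this pair then yields uniqueness in the first coordinate.\<close>
    obtain a where a: "\<pi>1 a \<in> carrier K" "x = k (\<pi>1 a) \<otimes>\<^bsub>X\<^esub> \<pi>1 u"
      "\<pi>2 a \<in> carrier K'" "\<pi>2 u = k' (\<pi>2 a) \<otimes>\<^bsub>X'\<^esub> \<pi>2 u" using ex[OF x(1) uX(2) x(2) uX(4)] by blast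
    show "\<exists>!a. a \<in> carrier K \<and> x = k a \<otimes>\<^bsub>X\<^esub> \<pi>1 u"
    proof (rule ex1I[of _ "\<pi>1 a"])
      fix b assume "b \<in> carrier K \<and> x = k b \<otimes>\<^bsub>X\<^esub> \<pi>1 u"
      then have "pr b (\<pi>2 a) = a"
        using ex[OF x(1) uX(2) x(2) uX(4)] a by (metis \<pi>1 \<pi>2)
      then show "b = \<pi>1 a" by (metis \<pi>1)
    qed (use a in blast)
  qed
  moreover have "representative K' k' X' f' m' (\<pi>2 u)"
    unfolding representative_def
  proof (intro conjI ballI impI uX)
    fix x assume x: "x \<in> carrier X'" "f' x = m'"
    obtain a where a: "\<pi>1 a \<in> carrier K" "\<pi>1 u = k (\<pi>1 a) \<otimes>\<^bsub>X\<^esub> \<pi>1 u"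
      "\<pi>2 a \<in> carrier K'" "x = k' (\<pi>2 a) \<otimes>\<^bsub>X'\<^esub> \<pi>2 u" using ex[OF uX(1) x(1) uX(3) x(2)] by blast
    show "\<exists>!a. a \<in> carrier K' \<and> x = k' a \<otimes>\<^bsub>X'\<^esub> \<pi>2 u"
    proof (rule ex1I[of _ "\<pi>2 a"])
      fix b assume "b \<in> carrier K' \<and> x = k' b \<otimes>\<^bsub>X'\<^esub> \<pi>2 u"
      then have "pr (\<pi>1 a) b = a"
        using ex[OF uX(1) x(1) uX(3) x(2)] a by (metis \<pi>1 \<pi>2)
      then show "b = \<pi>2 a" by (metis \<pi>2)
    qed (use a in blast)
  qed
  ultimately show "representative K k X f m (\<pi>1 u) \<and> representative K' k' X' f' m' (\<pi>2 u)" ..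
next
  assume "representative K k X f m (\<pi>1 u) \<and> representative K' k' X' f' m' (\<pi>2 u)"
  then have r: "representative K k X f m (\<pi>1 u)" "representative K' k' X' f' m' (\<pi>2 u)" by auto
  note r1 = representativeD[OF r(1)] and r2 = representativeD[OF r(2)]
  have uX: "u \<in> carrier X''" using mem[OF r1(1) r2(1) r1(2) r2(2)] by simp
  show "representative K'' k'' X'' f'' m'' u"
    unfolding representative_def
  proof (intro conjI ballI impI)
    show "u \<in> carrier X''" by fact
    show "f'' u = m''" using f[OF uX] r1(2) r2(2) by simp
    fix z assume z: "z \<in> carrier X''" "f'' z = m''"
    have z1: "\<pi>1 z \<in> carrier X" "f (\<pi>1 z) = m" and z2: "\<pi>2 z \<in> carrier X'" "f' (\<pi>2 z) = m'"
      using S[OF z(1)] f[OF z(1)] z(2) by auto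
    obtain a where a: "a \<in> carrier K" "\<pi>1 z = k a \<otimes>\<^bsub>X\<^esub> \<pi>1 u" using r1(3)[OF z1] by blast
    obtain b where b: "b \<in> carrier K'" "\<pi>2 z = k' b \<otimes>\<^bsub>X'\<^esub> \<pi>2 u" using r2(3)[OF z2] by blast
    show "\<exists>!a. a \<in> carrier K'' \<and> z = k'' a \<otimes>\<^bsub>X''\<^esub> u"
    proof (rule ex1I[of _ "pr a b"])
      show "pr a b \<in> carrier K'' \<and> z = k'' (pr a b) \<otimes>\<^bsub>X''\<^esub> u"
        using a b by (simp add: K k mult flip: a(2) b(2))
      fix c assume c: "c \<in> carrier K'' \<and> z = k'' c \<otimes>\<^bsub>X''\<^esub> u"
      then have "z = pr (k (\<pi>1 c) \<otimes>\<^bsub>X\<^esub> \<pi>1 u) (k' (\<pi>2 c) \<otimes>\<^bsub>X'\<^esub> \<pi>2 u)" using k[of c] by (simp add: mult)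
      then have "\<pi>1 z = k (\<pi>1 c) \<otimes>\<^bsub>X\<^esub> \<pi>1 u" "\<pi>2 z = k' (\<pi>2 c) \<otimes>\<^bsub>X'\<^esub> \<pi>2 u" by (metis \<pi>1, metis \<pi>2)
      then have "\<pi>1 c = a" "\<pi>2 c = b" using r1(3)[OF z1] r2(3)[OF z2] a b K[of c] c by blast+
      then show "c = pr a b" by (metis pr)
    qed
  qed
qed

text \<open>Only \<open>C\<close> is cut down to pairs with equal image in \<open>M\<close>.
  Elements of \<open>A\<close> and \<open>B\<close> lie over the neutral element, so plain products
  serve for them.\<close>

definition product_ext :: "'u xseq \<Rightarrow> 'u xseq \<Rightarrow> 'u xseq" where
  "product_ext E E' = \<lparr>obA = pmon (obA E) (obA E'), obB = pmon (obB E) (obB E'),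
     obC = (pmon (obC E) (obC E'))\<lparr>carrier := {z. \<pi>1 z \<in> carrier (obC E) \<and> \<pi>2 z \<in> carrier (obC E') \<and>
       mp E (\<pi>1 z) = mp E' (\<pi>2 z)}\<rparr>,
     obM = obM E,
     mk = (\<lambda>z\<in>carrier (pmon (obA E) (obA E')). pr (mk E (\<pi>1 z)) (mk E' (\<pi>2 z))),
     md = (\<lambda>z\<in>carrier (pmon (obB E) (obB E')). pr (md E (\<pi>1 z)) (md E' (\<pi>2 z))),
     mp = (\<lambda>z\<in>{z. \<pi>1 z \<in> carrier (obC E) \<and> \<pi>2 z \<in> carrier (obC E') \<and> mp E (\<pi>1 z) = mp E' (\<pi>2 z)}. mp E (\<pi>1 z)),
     act = (\<lambda>c\<in>{z. \<pi>1 z \<in> carrier (obC E) \<and> \<pi>2 z \<in> carrier (obC E') \<and> mp E (\<pi>1 z) = mp E' (\<pi>2 z)}.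
       \<lambda>b\<in>carrier (pmon (obB E) (obB E')). pr (act E (\<pi>1 c) (\<pi>1 b)) (act E' (\<pi>2 c) (\<pi>2 b)))\<rparr>"

end

section \<open>Fibre products over \<open>M\<close>\<close>

locale fibre_product = pairing_bijection pr \<pi>1 \<pi>2 + E: crossed_ext E + E': crossed_ext E'
  for pr :: "'u \<Rightarrow> 'u \<Rightarrow> 'u" and \<pi>1 \<pi>2 and E E' :: "'u xseq" +
  assumes same_M: "obM E = obM E'"
begin

abbreviation "P \<equiv> product_ext E E'"

lemma P_sel [simp]:
  "obA P = pmon (obA E) (obA E')" "obB P = pmon (obB E) (obB E')" "obM P = obM E"
  by (simp_all add: product_ext_def)

lemma P_C [simp]:
  "z \<in> carrier (obC P) \<longleftrightarrow> \<pi>1 z \<in> carrier (obC E) \<and> \<pi>2 z \<in> carrier (obC E') \<and> mp E (\<pi>1 z) = mp E' (\<pi>2 z)"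
  "z \<otimes>\<^bsub>obC P\<^esub> z' = pr (\<pi>1 z \<otimes>\<^bsub>obC E\<^esub> \<pi>1 z') (\<pi>2 z \<otimes>\<^bsub>obC E'\<^esub> \<pi>2 z')"
  "\<one>\<^bsub>obC P\<^esub> = pr \<one>\<^bsub>obC E\<^esub> \<one>\<^bsub>obC E'\<^esub>"
  by (simp_all add: product_ext_def)

lemma P_maps [simp]:
  "\<pi>1 z \<in> E.A \<Longrightarrow> \<pi>2 z \<in> E'.A \<Longrightarrow> mk P z = pr (mk E (\<pi>1 z)) (mk E' (\<pi>2 z))"
  "\<pi>1 z \<in> E.B \<Longrightarrow> \<pi>2 z \<in> E'.B \<Longrightarrow> md P z = pr (md E (\<pi>1 z)) (md E' (\<pi>2 z))"
  "\<pi>1 z \<in> E.C \<Longrightarrow> \<pi>2 z \<in> E'.C \<Longrightarrow> mp E (\<pi>1 z) = mp E' (\<pi>2 z) \<Longrightarrow> mp P z = mp E' (\<pi>2 z)"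
  "\<pi>1 z \<in> E.C \<Longrightarrow> \<pi>2 z \<in> E'.C \<Longrightarrow> mp E (\<pi>1 z) = mp E' (\<pi>2 z) \<Longrightarrow> \<pi>1 b \<in> E.B \<Longrightarrow> \<pi>2 b \<in> E'.B \<Longrightarrow>
    act P z b = pr (act E (\<pi>1 z) (\<pi>1 b)) (act E' (\<pi>2 z) (\<pi>2 b))"
  by (simp_all add: product_ext_def)

lemma P_ext: "mk P \<in> extensional (carrier (obA P))" "md P \<in> extensional (carrier (obB P))"
  "mp P \<in> extensional (carrier (obC P))" "act P \<in> extensional (carrier (obC P))"
  "c \<in> carrier (obC P) \<Longrightarrow> act P c \<in> extensional (carrier (obB P))"
  by (simp_all add: product_ext_def)

lemma P_N: "md P ` carrier (obB P) = {z. \<pi>1 z \<in> E.N \<and> \<pi>2 z \<in> E'.N}"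
proof (intro equalityI subsetI)
  fix z assume "z \<in> {z. \<pi>1 z \<in> E.N \<and> \<pi>2 z \<in> E'.N}"
  then obtain b b' where b: "b \<in> E.B" "b' \<in> E'.B" "\<pi>1 z = md E b" "\<pi>2 z = md E' b'" by auto
  then have "z = pr (md E b) (md E' b')" by (metis pr)
  then show "z \<in> md P ` carrier (obB P)" using b(1,2) by (intro image_eqI[of _ _ "pr b b'"]) simp_all
qed auto

lemma P_monoid: "monoid (obC P)"
  by (rule monoidI)
    (auto simp: E.C.m_assoc E'.C.m_assoc same_M)

lemma rep_P_A: "n \<in> md P ` carrier (obB P) \<Longrightarrow> representative (obA P) (mk P) (obB P) (md P) n u \<longleftrightarrow>
    E.repAB (\<pi>1 n) (\<pi>1 u) \<and> E'.repAB (\<pi>2 n) (\<pi>2 u)"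
  by (rule representative_pair_iff) (auto simp: eq_iff[of _ n])

lemma rep_P_N: "representative (obN P) (mn P) (obC P) (mp P) m u \<longleftrightarrow> E.repNC m (\<pi>1 u) \<and> E'.repNC m (\<pi>2 u)"
proof (rule representative_pair_iff)
  show "z \<in> carrier (obN P) \<longleftrightarrow> \<pi>1 z \<in> carrier (obN E) \<and> \<pi>2 z \<in> carrier (obN E')" for z
    unfolding obN_sel P_N by simp
  show "mn P z = pr (mn E (\<pi>1 z)) (mn E' (\<pi>2 z))" if "z \<in> carrier (obN P)" for z
    using that unfolding mn_def obN_sel P_N by simp
qed auto

lemma P_crossed_ext: "crossed_ext P"
proof (rule crossed_ext.intro)
  show "monoid (obA P)" "monoid (obB P)" "monoid (obM P)"
    by (simp_all add: pmon_monoid E.mA E'.mA E.mB E'.mB E.mM)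
  show "monoid (obC P)" by (rule P_monoid)
  show "mk P \<in> mon_hom (obA P) (obB P)" unfolding mon_hom_iff using P_ext by simp
  show "md P \<in> mon_hom (obB P) (obC P)" unfolding mon_hom_iff using P_ext by (simp add: same_M)
  show "mp P \<in> mon_hom (obC P) (obM P)" unfolding mon_hom_iff using P_ext by (auto simp: same_M)
  show "act P \<in> mon_hom (obC P) (End_monoid (obB P))"
    unfolding action_hom_iff[OF P_monoid] mon_hom_iff[of _ "obB P"] using P_ext by (simp add: same_M)
  show "md P (act P c b) \<otimes>\<^bsub>obC P\<^esub> c = c \<otimes>\<^bsub>obC P\<^esub> md P b" if "c \<in> carrier (obC P)" "b \<in> carrier (obB P)" for c b
    using that by (simp add: E.crossed1 E'.crossed1)
  show "act P (md P b) b' \<otimes>\<^bsub>obB P\<^esub> b = b \<otimes>\<^bsub>obB P\<^esub> b'" if "b \<in> carrier (obB P)" "b' \<in> carrier (obB P)" for b b'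
    using that by (simp add: E.crossed2 E'.crossed2 same_M)
  show "inj_on (mk P) (carrier (obA P))" by (rule inj_onI, rule pair_eqI) simp_all
  show "mk P ` carrier (obA P) = {b \<in> carrier (obB P). md P b = \<one>\<^bsub>obC P\<^esub>}"
  proof (intro equalityI subsetI)
    fix b assume b: "b \<in> {b \<in> carrier (obB P). md P b = \<one>\<^bsub>obC P\<^esub>}"
    then obtain a a' where a: "a \<in> E.A" "a' \<in> E'.A" "\<pi>1 b = mk E a" "\<pi>2 b = mk E' a'"
      using E.ker_d[of "\<pi>1 b"] E'.ker_d[of "\<pi>2 b"] by auto
    then have "b = pr (mk E a) (mk E' a')" by (metis pr)
    then show "b \<in> mk P ` carrier (obA P)" using a(1,2) by (intro image_eqI[of _ _ "pr a a'"]) simp_all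
  qed auto
  show "md P ` carrier (obB P) = {c \<in> carrier (obC P). mp P c = \<one>\<^bsub>obM P\<^esub>}"
    unfolding P_N E.d_img E'.d_img by (auto simp: same_M)
  show "right_cancellative (obN P)"
    unfolding right_cancellative_def obN_sel P_N
  proof (intro ballI impI, rule pair_eqI)
    fix x y z assume *: "x \<in> {z. \<pi>1 z \<in> E.N \<and> \<pi>2 z \<in> E'.N}" "y \<in> {z. \<pi>1 z \<in> E.N \<and> \<pi>2 z \<in> E'.N}"
      "z \<in> {z. \<pi>1 z \<in> E.N \<and> \<pi>2 z \<in> E'.N}" "x \<otimes>\<^bsub>obC P\<^esub> z = y \<otimes>\<^bsub>obC P\<^esub> z"
    show "\<pi>1 x = \<pi>1 y" by (rule E.freeN[of _ _ "\<pi>1 z"]) (use * in auto)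
    show "\<pi>2 x = \<pi>2 y" by (rule E'.freeN[of _ _ "\<pi>2 z"]) (use * in auto)
  qed
  show "right_cancellative (obA P)"
    unfolding right_cancellative_def
  proof (intro ballI impI, rule pair_eqI)
    fix x y z assume *: "x \<in> carrier (obA P)" "y \<in> carrier (obA P)" "z \<in> carrier (obA P)"
      "x \<otimes>\<^bsub>obA P\<^esub> z = y \<otimes>\<^bsub>obA P\<^esub> z"
    show "\<pi>1 x = \<pi>1 y"
      by (rule E.A_canc[unfolded right_cancellative_def, rule_format, of _ _ "\<pi>1 z"]) (use * in simp_all)
    show "\<pi>2 x = \<pi>2 y"
      by (rule E'.A_canc[unfolded right_cancellative_def, rule_format, of _ _ "\<pi>2 z"]) (use * in simp_all)
  qed
  show "\<exists>u. representative (obN P) (mn P) (obC P) (mp P) m u" if m: "m \<in> carrier (obM P)" for m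
  proof -
    obtain u u' where "E.repNC m u" "E'.repNC m u'" using E.repN[of m] E'.repN[of m] m same_M by auto
    then show ?thesis by (intro exI[of _ "pr u u'"]) (simp add: rep_P_N)
  qed
  show "\<exists>u. representative (obA P) (mk P) (obB P) (md P) n u" if n: "n \<in> md P ` carrier (obB P)" for n
  proof -
    have n': "\<pi>1 n \<in> E.N" "\<pi>2 n \<in> E'.N" using n unfolding P_N by simp_all
    obtain u u' where "E.repAB (\<pi>1 n) u" "E'.repAB (\<pi>2 n) u'" using E.repA[OF n'(1)] E'.repA[OF n'(2)] by blast
    then have "representative (obA P) (mk P) (obB P) (md P) n (pr u u')" unfolding rep_P_A[OF n] by simp
    then show ?thesis by blast
  qed
qed

lemma crossed_ext_hom_\<pi>1: "crossed_ext_hom P E (\<lambda>b\<in>carrier (obB P). \<pi>1 b) (\<lambda>c\<in>carrier (obC P). \<pi>1 c)"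
  unfolding crossed_ext_hom_def
proof (intro conjI ballI allI impI)
  fix n v assume n: "n \<in> md P ` carrier (obB P)" and v: "representative (obA P) (mk P) (obB P) (md P) n v"
  have "n \<in> carrier (obC P)" using n crossed_ext.d_closed[OF P_crossed_ext] by blast
  then show "E.repAB ((\<lambda>c\<in>carrier (obC P). \<pi>1 c) n) ((\<lambda>b\<in>carrier (obB P). \<pi>1 b) v)"
    using v representativeD(1)[OF v] unfolding rep_P_A[OF n] by simp
next
  fix m u assume u: "representative (obN P) (mn P) (obC P) (mp P) m u"
  show "E.repNC m ((\<lambda>c\<in>carrier (obC P). \<pi>1 c) u)"
    using u representativeD(1)[OF u] unfolding rep_P_N by simp
qed (auto simp: mon_hom_iff same_M)

lemma crossed_ext_hom_\<pi>2: "crossed_ext_hom P E' (\<lambda>b\<in>carrier (obB P). \<pi>2 b) (\<lambda>c\<in>carrier (obC P). \<pi>2 c)"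
  unfolding crossed_ext_hom_def
proof (intro conjI ballI allI impI)
  fix n v assume n: "n \<in> md P ` carrier (obB P)" and v: "representative (obA P) (mk P) (obB P) (md P) n v"
  have "n \<in> carrier (obC P)" using n crossed_ext.d_closed[OF P_crossed_ext] by blast
  then show "E'.repAB ((\<lambda>c\<in>carrier (obC P). \<pi>2 c) n) ((\<lambda>b\<in>carrier (obB P). \<pi>2 b) v)"
    using v representativeD(1)[OF v] unfolding rep_P_A[OF n] by simp
next
  fix m u assume u: "representative (obN P) (mn P) (obC P) (mp P) m u"
  show "E'.repNC m ((\<lambda>c\<in>carrier (obC P). \<pi>2 c) u)"
    using u representativeD(1)[OF u] unfolding rep_P_N by simp
qed (auto simp: mon_hom_iff same_M)

lemma crossed_ext_hom_pair:
  assumes T: "crossed_ext T" "obM T = obM E" and x: "crossed_ext_hom T E \<phi> \<psi>" and y: "crossed_ext_hom T E' \<phi>' \<psi>'"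
  shows "crossed_ext_hom T P (\<lambda>b\<in>carrier (obB T). pr (\<phi> b) (\<phi>' b)) (\<lambda>c\<in>carrier (obC T). pr (\<psi> c) (\<psi>' c))" (is "crossed_ext_hom T P ?\<phi> ?\<psi>")
proof -
  interpret T: crossed_ext T by fact
  note xD = crossed_ext_homD[OF x] and yD = crossed_ext_homD[OF y]
  note h = xD(1,2) yD(1,2)
  have cl [simp]: "b \<in> T.B \<Longrightarrow> \<phi> b \<in> E.B" "b \<in> T.B \<Longrightarrow> \<phi>' b \<in> E'.B"
     "c \<in> T.C \<Longrightarrow> \<psi> c \<in> E.C" "c \<in> T.C \<Longrightarrow> \<psi>' c \<in> E'.C" for b c
    by (simp_all add: mon_hom_closed[OF h(1)] mon_hom_closed[OF h(2)] mon_hom_closed[OF h(3)] mon_hom_closed[OF h(4)])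
  note mult = mon_hom_mult[OF h(1)] mon_hom_mult[OF h(2)] mon_hom_mult[OF h(3)] mon_hom_mult[OF h(4)]
  note one = mon_hom_one[OF h(1)] mon_hom_one[OF h(2)] mon_hom_one[OF h(3)] mon_hom_one[OF h(4)]
  show ?thesis unfolding crossed_ext_hom_def
  proof (intro conjI ballI allI impI)
    show "?\<phi> \<in> mon_hom (obB T) (obB P)" unfolding mon_hom_iff by (simp add: mult one)
    \<comment> \<open>Both components of the pair lie over \<open>mp T c\<close>, which is the
      condition that cuts out the fibre product.\<close>
    show "?\<psi> \<in> mon_hom (obC T) (obC P)" unfolding mon_hom_iff by (simp add: mult one xD(5) yD(5))
    show "md P (?\<phi> b) = ?\<psi> (md T b)" if "b \<in> T.B" for b using that by (simp add: xD(3) yD(3))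
    show "?\<phi> (act T c b) = act P (?\<psi> c) (?\<phi> b)" if "c \<in> T.C" "b \<in> T.B" for c b
      using that by (simp add: xD(4,5) yD(4,5))
    show "mp P (?\<psi> c) = mp T c" if "c \<in> T.C" for c using that by (simp add: xD(5) yD(5))
    fix n v assume n: "n \<in> T.N" and v: "T.repAB n v"
    have nC: "n \<in> T.C" using n by auto
    obtain b where b: "b \<in> T.B" "n = md T b" using n by blast
    have "?\<psi> n = md P (?\<phi> b)" using b nC by (simp add: xD(3) yD(3))
    moreover have "?\<phi> b \<in> carrier (obB P)" using b by simp
    ultimately have n': "?\<psi> n \<in> md P ` carrier (obB P)" by simp
    show "representative (obA P) (mk P) (obB P) (md P) (?\<psi> n) (?\<phi> v)"
      unfolding rep_P_A[OF n'] using xD(6)[OF n v] yD(6)[OF n v] nC representativeD(1)[OF v] by simp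
  next
    fix m u assume m: "m \<in> carrier (obM T)" and u: "T.repNC m u"
    show "representative (obN P) (mn P) (obC P) (mp P) m (?\<psi> u)"
      unfolding rep_P_N using xD(7)[OF m u] yD(7)[OF m u] representativeD(1)[OF u] by simp
  qed
qed

end

section \<open>The terminal extension\<close>

definition trivial_monoid :: "'u \<Rightarrow> 'u monoid" where
  "trivial_monoid e = \<lparr>carrier = {e}, mult = (\<lambda>_ _. e), one = e\<rparr>"

text \<open>The identity of \<open>M\<close> preceded by trivial monoids. These are carried by the
  neutral element of \<open>M\<close>, so that \<open>mk\<close> and \<open>md\<close> are
  restrictions of the identity.\<close>

definition terminal_ext :: "'u monoid \<Rightarrow> 'u xseq" where
  "terminal_ext M = (let T = trivial_monoid \<one>\<^bsub>M\<^esub>; i = (\<lambda>x\<in>{\<one>\<^bsub>M\<^esub>}. x) in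
     \<lparr>obA = T, obB = T, obC = M, obM = M, mk = i, md = i,
      mp = (\<lambda>m\<in>carrier M. m), act = (\<lambda>m\<in>carrier M. i)\<rparr>)"

lemma trivial_monoid [simp]: "carrier (trivial_monoid e) = {e}" "x \<otimes>\<^bsub>trivial_monoid e\<^esub> y = e"
  "\<one>\<^bsub>trivial_monoid e\<^esub> = e"
  by (simp_all add: trivial_monoid_def)

lemma trivial_comm_monoid: "comm_monoid (trivial_monoid e)"
  by (rule comm_monoidI) auto

lemma terminal_ext_sel [simp]: "obA (terminal_ext M) = trivial_monoid \<one>\<^bsub>M\<^esub>" "obB (terminal_ext M) = trivial_monoid \<one>\<^bsub>M\<^esub>"
  "obC (terminal_ext M) = M" "obM (terminal_ext M) = M" "mk (terminal_ext M) = (\<lambda>x\<in>{\<one>\<^bsub>M\<^esub>}. x)" "md (terminal_ext M) = (\<lambda>x\<in>{\<one>\<^bsub>M\<^esub>}. x)"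
  "mp (terminal_ext M) = (\<lambda>m\<in>carrier M. m)" "act (terminal_ext M) = (\<lambda>m\<in>carrier M. \<lambda>x\<in>{\<one>\<^bsub>M\<^esub>}. x)"
  by (simp_all add: terminal_ext_def Let_def)

lemma terminal_ext_crossed_ext:
  assumes "monoid M"
  shows "crossed_ext (terminal_ext M)"
proof -
  interpret monoid M by fact
  note triv = comm_monoid.axioms(1)[OF trivial_comm_monoid]
  show ?thesis
  proof (rule crossed_ext.intro)
    show "act (terminal_ext M) \<in> mon_hom (obC (terminal_ext M)) (End_monoid (obB (terminal_ext M)))"
      using monoid_axioms by (simp add: action_hom_iff) (auto simp: mon_hom_iff)
  qed (auto simp: triv monoid_axioms mon_hom_iff right_cancellative_def representative_def mn_def)
qed

text \<open>In the terminal extension there is just one element over each element of the base, and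
  it is a representative; preservation of representatives is therefore automatic.\<close>

lemma crossed_ext_hom_terminal:
  assumes "crossed_ext E"
  shows "crossed_ext_hom E (terminal_ext (obM E)) (\<lambda>b\<in>carrier (obB E). \<one>\<^bsub>obM E\<^esub>) (mp E)"
proof -
  interpret crossed_ext E by fact
  show ?thesis
    unfolding crossed_ext_hom_def using p_hom
    by (auto simp: mon_hom_iff representative_def mn_def)
qed

section \<open>The fibres of D1 and d1\<close>

text \<open>The flag \<open>com\<close> selects between the sources of \<open>D1\<close> and
  \<open>d1\<close>, so that one verification covers both fibres.\<close>

definition XSub :: "bool \<Rightarrow> 'u monoid \<Rightarrow> ('u xseq, 'u xarr) cat" where
  "XSub com M = full_subcat (XSExt M) (\<lambda>E. com \<longrightarrow> comm_monoid (obB E))"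

definition DSub :: "bool \<Rightarrow> 'u monoid \<Rightarrow> ('u xseq, 'u xarr, 'u smod, 'u sarr) cfunctor" where
  "DSub com M = (D1 M)\<lparr>Src := XSub com M\<rparr>"

lemma DSub_D1: "DSub False M = D1 M" and DSub_d1: "DSub True M = d1 M"
  by (simp_all add: DSub_def XSub_def D1_def d1_def com_XSExt_def full_subcat_def)

section \<open>The source category and the functor laws\<close>

lemma XSub_Ob: "E \<in> Ob (XSub com M) \<longleftrightarrow> crossed_ext E \<and> obM E = M \<and> (com \<longrightarrow> comm_monoid (obB E))"
  by (auto simp: XSub_def full_subcat_def XSExt_def crossed_schreier_extension_iff)

lemma XSub_hom: "in_hom (XSub com M) f E E' \<longleftrightarrow>
   (\<exists>\<phi> \<psi>. f = (E, (\<phi>, \<psi>), E') \<and> E \<in> Ob (XSub com M) \<and> E' \<in> Ob (XSub com M) \<and> crossed_ext_hom E E' \<phi> \<psi>)"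
  by (cases f) (auto simp: in_hom_def XSub_Ob, auto simp: XSub_def full_subcat_def XSExt_def crossed_schreier_extension_iff xsext_morphism_iff)

lemma XSub_hom_triple [simp]: "in_hom (XSub com M) (E, (\<phi>, \<psi>), E') F F' \<longleftrightarrow>
   E = F \<and> E' = F' \<and> E \<in> Ob (XSub com M) \<and> E' \<in> Ob (XSub com M) \<and> crossed_ext_hom E E' \<phi> \<psi>"
  by (auto simp: XSub_hom)

lemma XSub_sel:
  "Idn (XSub com M) E = (E, (\<lambda>b\<in>carrier (obB E). b, \<lambda>c\<in>carrier (obC E). c), E)"
  "(F, (\<phi>', \<psi>'), E'') \<cdot>\<^bsub>XSub com M\<^esub> (E, (\<phi>, \<psi>), F') =
    (E, (compose (carrier (obB E)) \<phi>' \<phi>, compose (carrier (obC E)) \<psi>' \<psi>), E'')"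
  "Dom (XSub com M) (E, (\<phi>, \<psi>), F') = E" "Cod (XSub com M) (E, (\<phi>, \<psi>), F') = F'"
  by (simp_all add: XSub_def full_subcat_def XSExt_def)

lemma XSub_Ar: "f \<in> Ar (XSub com M) \<longleftrightarrow> in_hom (XSub com M) f (Dom (XSub com M) f) (Cod (XSub com M) f)"
  by (simp add: in_hom_def)

lemma crossed_ext_hom_comp_id:
  assumes "crossed_ext E" "crossed_ext_hom E E' \<phi> \<psi>"
  shows "compose (carrier (obB E)) \<phi> (\<lambda>b\<in>carrier (obB E). b) = \<phi>"
     "compose (carrier (obC E)) \<psi> (\<lambda>c\<in>carrier (obC E). c) = \<psi>"
     "compose (carrier (obB E)) (\<lambda>b\<in>carrier (obB E'). b) \<phi> = \<phi>"
     "compose (carrier (obC E)) (\<lambda>c\<in>carrier (obC E'). c) \<psi> = \<psi>"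
  using crossed_ext_homD(1,2)[OF assms(2)]
  by (auto simp: mon_hom_iff compose_def fun_eq_iff extensional_def)

lemma mon_hom_compose_assoc:
  assumes "f \<in> mon_hom G H"
  shows "compose (carrier G) h (compose (carrier G) g f) = compose (carrier G) (compose (carrier H) h g) f"
  using assms by (auto simp: mon_hom_iff compose_def fun_eq_iff)

lemma XSub_category: "category (XSub com M)"
proof (unfold_locales, goal_cases)
  case (1 f) then show ?case by (auto simp: XSub_Ar XSub_hom)
next
  case (2 f) then show ?case by (auto simp: XSub_Ar XSub_hom)
next
  case (3 X) then show ?case by (simp add: XSub_sel crossed_ext_hom_id XSub_Ob)
next
  case (4 f X Y g Z) then show ?case by (auto simp: XSub_hom[of _ _ f] XSub_hom[of _ _ g] XSub_sel XSub_Ob crossed_ext_hom_compose)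
next
  case (5 f X Y) then show ?case by (auto simp: XSub_hom XSub_sel XSub_Ob crossed_ext_hom_comp_id)
next
  case (6 f X Y) then show ?case by (auto simp: XSub_hom XSub_sel XSub_Ob crossed_ext_hom_comp_id)
next
  case (7 f X Y g Z h W) then show ?case
    by (auto simp: XSub_hom XSub_sel mon_hom_compose_assoc[OF crossed_ext_homD(1)] mon_hom_compose_assoc[OF crossed_ext_homD(2)])
qed

lemma DSub_sel: "Src (DSub com M) = XSub com M" "Tgt (DSub com M) = can_Smod M"
  "FOb (DSub com M) E = (obA E, induced_action E)"
  "FAr (DSub com M) (E, (\<phi>, \<psi>), E') = ((obA E, induced_action E), starA E E' \<phi>, (obA E', induced_action E'))"
  by (simp_all add: DSub_def D1_def)

lemma starA_compose:
  assumes "crossed_ext E" "crossed_ext E'" "crossed_ext E''" "obM E = obM E'" "crossed_ext_hom E E' \<phi> \<psi>" "crossed_ext_hom E' E'' \<phi>' \<psi>'"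
  shows "starA E E'' (compose (carrier (obB E)) \<phi>' \<phi>) = compose (carrier (obA E)) (starA E' E'' \<phi>') (starA E E' \<phi>)"
proof (rule starA_eqI[OF assms(1,3) crossed_ext_hom_compose[OF assms]])
  note s = starA_hom[OF assms(1,2,5)] starA_hom[OF assms(2,3,6)]
  show "compose (carrier (obA E)) (starA E' E'' \<phi>') (starA E E' \<phi>) \<in> mon_hom (obA E) (obA E'')"
    by (rule mon_hom_compose[OF crossed_ext.mA[OF assms(1)] s])
  fix a assume a: "a \<in> carrier (obA E)"
  have "mk E a \<in> carrier (obB E)" using mon_hom_closed[OF crossed_ext.k_hom[OF assms(1)] a] .
  then show "mk E'' (compose (carrier (obA E)) (starA E' E'' \<phi>') (starA E E' \<phi>) a) =
      compose (carrier (obB E)) \<phi>' \<phi> (mk E a)"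
    using starA[OF assms(1,2,5) a] starA[OF assms(2,3,6)] a by (simp add: compose_def)
qed

lemma starA_id: "crossed_ext E \<Longrightarrow> starA E E (\<lambda>b\<in>carrier (obB E). b) = (\<lambda>a\<in>carrier (obA E). a)"
  by (rule starA_eqI[OF _ _ crossed_ext_hom_id])
     (auto simp: mon_hom_id crossed_ext.mA crossed_ext.k_closed)

definition bij_base :: "'u xarr \<Rightarrow> bool" where
  "bij_base = (\<lambda>(E, (\<phi>, \<psi>), E'). bij_betw \<psi> (carrier (obC E)) (carrier (obC E')))"

lemma bij_base_opcartesian:
  assumes good: "bij_base q" and q: "q \<in> Ar (XSub com M)"
  shows "is_opcartesian (DSub com M) q"
proof -
  obtain E E' \<phi> \<psi> where q': "q = (E, (\<phi>, \<psi>), E')" and E: "E \<in> Ob (XSub com M)" "E' \<in> Ob (XSub com M)"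
    and crossed_ext_hom: "crossed_ext_hom E E' \<phi> \<psi>" using q unfolding XSub_Ar XSub_hom by blast
  have c: "crossed_ext E" "crossed_ext E'" and M: "obM E = M" "obM E' = M" using E by (auto simp: XSub_Ob)
  interpret bij_morphism E E' \<phi> \<psi>
    using good c M crossed_ext_hom by (simp add: bij_morphism_def bij_morphism_axioms_def bij_base_def q')
  show ?thesis
    unfolding is_opcartesian_def Let_def DSub_sel(1,2)
  proof (intro conjI allI impI q, elim conjE)
    fix g v
    assume g: "g \<in> Ar (XSub com M)" "Dom (XSub com M) g = Dom (XSub com M) q"
      and v: "in_hom (can_Smod M) v (FOb (DSub com M) (Cod (XSub com M) q)) (FOb (DSub com M) (Cod (XSub com M) g))"
      and gv: "FAr (DSub com M) g = v \<cdot>\<^bsub>can_Smod M\<^esub> FAr (DSub com M) q"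
    obtain E'' \<phi>g \<psi>g where g': "g = (E, (\<phi>g, \<psi>g), E'')" and E'': "E'' \<in> Ob (XSub com M)" and xmg: "crossed_ext_hom E E'' \<phi>g \<psi>g"
      using g unfolding XSub_Ar[of g] XSub_hom q' XSub_sel by (auto simp: XSub_sel)
    have c'': "crossed_ext E''" "obM E'' = M" using E'' by (auto simp: XSub_Ob)
    obtain w where v': "v = ((obA E', induced_action E'), w, (obA E'', induced_action E''))"
      and w: "w \<in> mon_hom (obA E') (obA E'')"
      "\<And>m a. m \<in> carrier M \<Longrightarrow> a \<in> carrier (obA E') \<Longrightarrow> w (induced_action E' m a) = induced_action E'' m (w a)"
      using v unfolding in_hom_can_Smod q' g' XSub_sel DSub_sel by auto
    have ws: "starA E E'' \<phi>g = compose (carrier (obA E)) w (starA E E' \<phi>)"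
      using gv unfolding q' g' v' DSub_sel can_Smod_sel by simp
    have "\<exists>\<phi>h \<psi>h. crossed_ext_hom E' E'' \<phi>h \<psi>h \<and> (\<forall>b\<in>carrier (obB E). \<phi>h (\<phi> b) = \<phi>g b) \<and>
      (\<forall>c\<in>carrier (obC E). \<psi>h (\<psi> c) = \<psi>g c) \<and> starA E' E'' \<phi>h = w"
      by (rule opcartesian_exists[OF bij_morphism_axioms c''(1) _ xmg w(1)])
         (use M c'' w(2) ws in \<open>simp_all add: compose_def\<close>)
    then obtain \<phi>h \<psi>h where h: "crossed_ext_hom E' E'' \<phi>h \<psi>h" "\<And>b. b\<in>carrier (obB E) \<Longrightarrow> \<phi>h (\<phi> b) = \<phi>g b"
      "\<And>c. c\<in>carrier (obC E) \<Longrightarrow> \<psi>h (\<psi> c) = \<psi>g c" "starA E' E'' \<phi>h = w" by blast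
    have comp: "compose (carrier (obB E)) \<phi>h \<phi> = \<phi>g" "compose (carrier (obC E)) \<psi>h \<psi> = \<psi>g"
      using h(2,3) crossed_ext_homD(1,2)[OF xmg]
      by (auto simp: compose_def mon_hom_iff fun_eq_iff extensional_def)
    show "\<exists>!h. in_hom (XSub com M) h (Cod (XSub com M) q) (Cod (XSub com M) g) \<and>
        FAr (DSub com M) h = v \<and> h \<cdot>\<^bsub>XSub com M\<^esub> q = g"
    proof (rule ex1I[of _ "(E', (\<phi>h, \<psi>h), E'')"])
      show "in_hom (XSub com M) (E', (\<phi>h, \<psi>h), E'') (Cod (XSub com M) q) (Cod (XSub com M) g) \<and>
        FAr (DSub com M) (E', (\<phi>h, \<psi>h), E'') = v \<and> (E', (\<phi>h, \<psi>h), E'') \<cdot>\<^bsub>XSub com M\<^esub> q = g"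
        using h(1,4) E E'' comp by (simp add: q' g' v' XSub_sel DSub_sel)
      fix h' assume h': "in_hom (XSub com M) h' (Cod (XSub com M) q) (Cod (XSub com M) g) \<and>
        FAr (DSub com M) h' = v \<and> h' \<cdot>\<^bsub>XSub com M\<^esub> q = g"
      then obtain \<phi>2 \<psi>2 where h2: "h' = (E', (\<phi>2, \<psi>2), E'')" "crossed_ext_hom E' E'' \<phi>2 \<psi>2"
        by (auto simp: XSub_hom[of _ _ h'] q' g' XSub_sel)
      have star: "starA E' E'' \<phi>2 = w" and "compose (carrier (obB E)) \<phi>2 \<phi> = \<phi>g" "compose (carrier (obC E)) \<psi>2 \<psi> = \<psi>g"
        using h' by (auto simp: h2(1) q' g' v' XSub_sel DSub_sel)
      then have "\<And>b. b\<in>carrier (obB E) \<Longrightarrow> \<phi>2 (\<phi> b) = \<phi>g b" "\<And>c. c\<in>carrier (obC E) \<Longrightarrow> \<psi>2 (\<psi> c) = \<psi>g c"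
        by (auto simp: compose_def fun_eq_iff split: if_splits)
      then have "\<phi>2 = \<phi>h" "\<psi>2 = \<psi>h"
        using h(2,3,4) star by (intro opcartesian_unique[OF bij_morphism_axioms c''(1) h2(2) h(1)]; simp)+
      then show "h' = (E', (\<phi>h, \<psi>h), E'')" using h2(1) by simp
    qed
  qed
qed

lemma terminal_ext_terminal:
  assumes "monoid M"
  shows "is_terminal (XSub com M) (terminal_ext M)"
  unfolding is_terminal_def
proof (intro conjI ballI)
  show one: "terminal_ext M \<in> Ob (XSub com M)"
    using terminal_ext_crossed_ext[OF assms] by (simp add: XSub_Ob trivial_comm_monoid)
  fix T assume T: "T \<in> Ob (XSub com M)"
  then have c: "crossed_ext T" "obM T = M" by (auto simp: XSub_Ob)
  show "\<exists>!t. in_hom (XSub com M) t T (terminal_ext M)"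
  proof (rule ex1I[of _ "(T, (\<lambda>b\<in>carrier (obB T). \<one>\<^bsub>M\<^esub>, mp T), terminal_ext M)"])
    show "in_hom (XSub com M) (T, (\<lambda>b\<in>carrier (obB T). \<one>\<^bsub>M\<^esub>, mp T), terminal_ext M) T (terminal_ext M)"
      using crossed_ext_hom_terminal[OF c(1)] c one T by simp
    fix t assume "in_hom (XSub com M) t T (terminal_ext M)"
    then obtain \<phi> \<psi> where t: "t = (T, (\<phi>, \<psi>), terminal_ext M)" and crossed_ext_hom: "crossed_ext_hom T (terminal_ext M) \<phi> \<psi>" by (auto simp: XSub_hom)
    have "\<phi> = (\<lambda>b\<in>carrier (obB T). \<one>\<^bsub>M\<^esub>)"
      using crossed_ext_homD(1)[OF crossed_ext_hom] by (auto simp: mon_hom_iff fun_eq_iff extensional_def)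
    \<comment> \<open>The projection of the terminal extension is the identity of \<open>M\<close>,
      so compatibility with projections determines \<open>\<psi>\<close>.\<close>
    moreover have "\<psi> = mp T"
      using crossed_ext_homD(2)[OF crossed_ext_hom] crossed_ext_homD(5)[OF crossed_ext_hom] crossed_ext.p_hom[OF c(1)]
      by (intro extensionalityI[of _ "carrier (obC T)"]) (auto simp: mon_hom_iff)
    ultimately show "t = (T, (\<lambda>b\<in>carrier (obB T). \<one>\<^bsub>M\<^esub>, mp T), terminal_ext M)" using t by simp
  qed
qed

section \<open>Products, products of base bijections, and lifts\<close>

context pairing_bijection
begin

definition pj1 :: "'u xseq \<Rightarrow> 'u xseq \<Rightarrow> 'u xarr" where
  "pj1 E E' = (product_ext E E', (\<lambda>b\<in>carrier (obB (product_ext E E')). \<pi>1 b, \<lambda>c\<in>carrier (obC (product_ext E E')). \<pi>1 c), E)"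

definition pj2 :: "'u xseq \<Rightarrow> 'u xseq \<Rightarrow> 'u xarr" where
  "pj2 E E' = (product_ext E E', (\<lambda>b\<in>carrier (obB (product_ext E E')). \<pi>2 b, \<lambda>c\<in>carrier (obC (product_ext E E')). \<pi>2 c), E')"

lemma fibre_productI: "E \<in> Ob (XSub com M) \<Longrightarrow> E' \<in> Ob (XSub com M) \<Longrightarrow> fibre_product pr \<pi>1 \<pi>2 E E'"
  by (simp add: fibre_product_def fibre_product_axioms_def pairing_bijection_axioms XSub_Ob)

lemma product_ext_Ob:
  assumes E: "E \<in> Ob (XSub com M)" "E' \<in> Ob (XSub com M)"
  shows "product_ext E E' \<in> Ob (XSub com M)"
proof -
  interpret fibre_product pr \<pi>1 \<pi>2 E E' using fibre_productI[OF E] .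
  show ?thesis using E P_crossed_ext by (simp add: XSub_Ob pmon_comm_monoid)
qed

lemma product_ext_product:
  assumes E: "E \<in> Ob (XSub com M)" "E' \<in> Ob (XSub com M)"
  shows "is_product (XSub com M) (product_ext E E') (pj1 E E') (pj2 E E') E E'"
proof -
  interpret fibre_product pr \<pi>1 \<pi>2 E E' using fibre_productI[OF E] .
  note P = product_ext_Ob[OF E]
  show ?thesis
    unfolding is_product_def
  proof (intro conjI allI impI)
    show "product_ext E E' \<in> Ob (XSub com M)" by (fact P)
    show "in_hom (XSub com M) (pj1 E E') (product_ext E E') E" "in_hom (XSub com M) (pj2 E E') (product_ext E E') E'"
      using E P crossed_ext_hom_\<pi>1 crossed_ext_hom_\<pi>2 by (simp_all only: pj1_def pj2_def XSub_hom_triple simp_thms)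
    fix T x y assume xy: "in_hom (XSub com M) x T E \<and> in_hom (XSub com M) y T E'"
    then obtain \<phi> \<psi> \<phi>' \<psi>' where x: "x = (T, (\<phi>, \<psi>), E)" "crossed_ext_hom T E \<phi> \<psi>" and y: "y = (T, (\<phi>', \<psi>'), E')" "crossed_ext_hom T E' \<phi>' \<psi>'"
      and T: "T \<in> Ob (XSub com M)" by (auto simp: XSub_hom)
    have c: "crossed_ext T" "obM T = obM E" using T E by (auto simp: XSub_Ob)
    let ?h = "(T, (\<lambda>b\<in>carrier (obB T). pr (\<phi> b) (\<phi>' b), \<lambda>c\<in>carrier (obC T). pr (\<psi> c) (\<psi>' c)), product_ext E E')"
    note xP = crossed_ext_hom_pair[OF c x(2) y(2)]
    have cl: "b \<in> carrier (obB T) \<Longrightarrow> \<phi> b \<in> E.B \<and> \<phi>' b \<in> E'.B"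
       "k \<in> carrier (obC T) \<Longrightarrow> \<psi> k \<in> E.C \<and> \<psi>' k \<in> E'.C \<and> mp E (\<psi> k) = mp E' (\<psi>' k)" for b k
      using crossed_ext_homD(1,2)[OF x(2)] crossed_ext_homD(1,2)[OF y(2)] crossed_ext_homD(5)[OF x(2)] crossed_ext_homD(5)[OF y(2)] by (auto simp: mon_hom_iff)
    show "\<exists>!h. in_hom (XSub com M) h T (product_ext E E') \<and> pj1 E E' \<cdot>\<^bsub>XSub com M\<^esub> h = x \<and> pj2 E E' \<cdot>\<^bsub>XSub com M\<^esub> h = y"
    proof (rule ex1I[of _ ?h])
      have "compose (carrier (obB T)) (\<lambda>b\<in>carrier (obB P). \<pi>1 b) (\<lambda>b\<in>carrier (obB T). pr (\<phi> b) (\<phi>' b)) = \<phi>"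
        "compose (carrier (obC T)) (\<lambda>b\<in>carrier (obC P). \<pi>1 b) (\<lambda>b\<in>carrier (obC T). pr (\<psi> b) (\<psi>' b)) = \<psi>"
        "compose (carrier (obB T)) (\<lambda>b\<in>carrier (obB P). \<pi>2 b) (\<lambda>b\<in>carrier (obB T). pr (\<phi> b) (\<phi>' b)) = \<phi>'"
        "compose (carrier (obC T)) (\<lambda>b\<in>carrier (obC P). \<pi>2 b) (\<lambda>b\<in>carrier (obC T). pr (\<psi> b) (\<psi>' b)) = \<psi>'"
        using crossed_ext_homD(1,2)[OF x(2)] crossed_ext_homD(1,2)[OF y(2)] cl
        by (auto simp: compose_def fun_eq_iff mon_hom_iff extensional_def)
      then show "in_hom (XSub com M) ?h T (product_ext E E') \<and> pj1 E E' \<cdot>\<^bsub>XSub com M\<^esub> ?h = x \<and> pj2 E E' \<cdot>\<^bsub>XSub com M\<^esub> ?h = y"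
        using T P xP by (simp only: pj1_def pj2_def XSub_hom_triple XSub_sel x(1) y(1) simp_thms)
      fix h assume h: "in_hom (XSub com M) h T (product_ext E E') \<and> pj1 E E' \<cdot>\<^bsub>XSub com M\<^esub> h = x \<and> pj2 E E' \<cdot>\<^bsub>XSub com M\<^esub> h = y"
      then obtain \<phi>h \<psi>h where h': "h = (T, (\<phi>h, \<psi>h), product_ext E E')" "crossed_ext_hom T P \<phi>h \<psi>h" by (auto simp: XSub_hom[of _ _ h])
      have eqs: "compose (carrier (obB T)) (\<lambda>b\<in>carrier (obB P). \<pi>1 b) \<phi>h = \<phi>"
        "compose (carrier (obC T)) (\<lambda>b\<in>carrier (obC P). \<pi>1 b) \<psi>h = \<psi>"
        "compose (carrier (obB T)) (\<lambda>b\<in>carrier (obB P). \<pi>2 b) \<phi>h = \<phi>'"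
        "compose (carrier (obC T)) (\<lambda>b\<in>carrier (obC P). \<pi>2 b) \<psi>h = \<psi>'"
        using h unfolding h'(1) pj1_def pj2_def XSub_sel x(1) y(1) by blast+
      have "\<phi>h b = pr (\<phi> b) (\<phi>' b)" if "b \<in> carrier (obB T)" for b
        using that mon_hom_closed[OF crossed_ext_homD(1)[OF h'(2)] that] unfolding eqs[symmetric] compose_def by simp
      then have 1: "\<phi>h = (\<lambda>b\<in>carrier (obB T). pr (\<phi> b) (\<phi>' b))"
        using mon_hom_ext[OF crossed_ext_homD(1)[OF h'(2)]] by (intro extensionalityI[of _ "carrier (obB T)"]) simp_all
      have "\<psi>h b = pr (\<psi> b) (\<psi>' b)" if "b \<in> carrier (obC T)" for b
        using that mon_hom_closed[OF crossed_ext_homD(2)[OF h'(2)] that] unfolding eqs[symmetric] compose_def by simp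
      then have 2: "\<psi>h = (\<lambda>b\<in>carrier (obC T). pr (\<psi> b) (\<psi>' b))"
        using mon_hom_ext[OF crossed_ext_homD(2)[OF h'(2)]] by (intro extensionalityI[of _ "carrier (obC T)"]) simp_all
      show "h = ?h" unfolding h'(1) 1 2 ..
    qed
  qed
qed

text \<open>On \<open>C\<close> the arrow acts as \<open>\<psi>f\<close> and \<open>\<psi>g\<close>
  on the two coordinates. Since these respect the projections to \<open>M\<close>, the preimages of
  a compatible pair are again compatible, which gives surjectivity onto the fibre product.\<close>

lemma bij_base_product:
  assumes f: "in_hom (XSub com M) f X X'" and g: "in_hom (XSub com M) g Y Y'" and good: "bij_base f" "bij_base g"
    and h: "in_hom (XSub com M) h (product_ext X Y) (product_ext X' Y')"
    and eq: "pj1 X' Y' \<cdot>\<^bsub>XSub com M\<^esub> h = f \<cdot>\<^bsub>XSub com M\<^esub> pj1 X Y" "pj2 X' Y' \<cdot>\<^bsub>XSub com M\<^esub> h = g \<cdot>\<^bsub>XSub com M\<^esub> pj2 X Y"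
  shows "bij_base h"
proof -
  obtain \<phi>f \<psi>f \<phi>g \<psi>g \<phi>h \<psi>h where f': "f = (X, (\<phi>f, \<psi>f), X')" "crossed_ext_hom X X' \<phi>f \<psi>f"
    and g': "g = (Y, (\<phi>g, \<psi>g), Y')" "crossed_ext_hom Y Y' \<phi>g \<psi>g"
    and h': "h = (product_ext X Y, (\<phi>h, \<psi>h), product_ext X' Y')" "crossed_ext_hom (product_ext X Y) (product_ext X' Y') \<phi>h \<psi>h"
    and Ob: "X \<in> Ob (XSub com M)" "X' \<in> Ob (XSub com M)" "Y \<in> Ob (XSub com M)" "Y' \<in> Ob (XSub com M)"
    using f g h by (auto simp: XSub_hom)
  interpret P: fibre_product pr \<pi>1 \<pi>2 X Y using fibre_productI[OF Ob(1,3)] .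
  interpret P': fibre_product pr \<pi>1 \<pi>2 X' Y' using fibre_productI[OF Ob(2,4)] .
  have bf: "bij_betw \<psi>f P.E.C P'.E.C" and bg: "bij_betw \<psi>g P.E'.C P'.E'.C"
    using good by (auto simp: bij_base_def f'(1) g'(1))
  have eqs: "compose (carrier (obC P.P)) (\<lambda>b\<in>carrier (obC P'.P). \<pi>1 b) \<psi>h =
      compose (carrier (obC P.P)) \<psi>f (\<lambda>b\<in>carrier (obC P.P). \<pi>1 b)"
    "compose (carrier (obC P.P)) (\<lambda>b\<in>carrier (obC P'.P). \<pi>2 b) \<psi>h =
      compose (carrier (obC P.P)) \<psi>g (\<lambda>b\<in>carrier (obC P.P). \<pi>2 b)"
    using eq unfolding f'(1) g'(1) h'(1) pj1_def pj2_def XSub_sel by blast+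
  have hcl: "\<psi>h z \<in> carrier (obC P'.P)" if "z \<in> carrier (obC P.P)" for z
    using mon_hom_closed[OF crossed_ext_homD(2)[OF h'(2)] that] .
  have val: "\<psi>h z = pr (\<psi>f (\<pi>1 z)) (\<psi>g (\<pi>2 z))" if "z \<in> carrier (obC P.P)" for z
    by (rule pair_eqI)
       (use fun_cong[OF eqs(1), of z] fun_cong[OF eqs(2), of z] that hcl[OF that] in \<open>simp_all add: compose_def\<close>)
  have "bij_betw \<psi>h (carrier (obC P.P)) (carrier (obC P'.P))"
    unfolding bij_betw_def
  proof (intro conjI equalityI subsetI)
    show "inj_on \<psi>h (carrier (obC P.P))"
      by (intro inj_onI, rule pair_eqI) (use bf bg in \<open>auto simp: val bij_betw_def inj_on_def\<close>)
    fix z assume z: "z \<in> carrier (obC P'.P)"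
    then obtain c c' where c: "c \<in> P.E.C" "\<pi>1 z = \<psi>f c" "c' \<in> P.E'.C" "\<pi>2 z = \<psi>g c'"
      using bf bg by (auto simp: bij_betw_def) blast
    have "mp X c = mp Y c'" using z c crossed_ext_homD(5)[OF f'(2) c(1)] crossed_ext_homD(5)[OF g'(2) c(3)] by simp
    then have cc: "pr c c' \<in> carrier (obC P.P)" using c by simp
    have "z = \<psi>h (pr c c')" by (rule pair_eqI) (use c in \<open>simp_all add: val[OF cc]\<close>)
    then show "z \<in> \<psi>h ` carrier (obC P.P)" using cc by blast
  qed (use hcl in blast)
  then show ?thesis by (simp add: bij_base_def h'(1))
qed

lemma bij_base_lift:
  fixes X :: "'u xseq"
  assumes X: "X \<in> Ob (XSub com M)" and v: "in_hom (can_Smod M) v (FOb (DSub com M) X) V"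
  shows "\<exists>q. q \<in> Ar (XSub com M) \<and> Dom (XSub com M) q = X \<and> FOb (DSub com M) (Cod (XSub com M) q) = V \<and>
    FAr (DSub com M) q = v \<and> bij_base q"
proof -
  obtain A' \<eta>' where V: "V = (A', \<eta>')" by (cases V)
  obtain w where w: "v = ((obA X, induced_action X), w, V)" "can_semimodule M V" "w \<in> mon_hom (obA X) A'"
    "\<forall>m\<in>carrier M. \<forall>a\<in>carrier (obA X). w (induced_action X m a) = \<eta>' m (w a)"
    using v by (auto simp: in_hom_can_Smod DSub_sel V)
  interpret push_forward pr \<pi>1 \<pi>2 X A' \<eta>' w
    using X w pairing_bijection_axioms
    by (auto simp: push_forward_def push_forward_axioms_def XSub_Ob V)
  have push_ext: "push_ext \<in> Ob (XSub com M)" using X push_crossed_ext B'_comm by (auto simp: XSub_Ob)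
  show ?thesis
  proof (intro exI[of _ "(X, (q, \<lambda>c\<in>C. c), push_ext)"] conjI)
    show "(X, (q, \<lambda>c\<in>C. c), push_ext) \<in> Ar (XSub com M)"
      unfolding XSub_Ar using X push_ext crossed_ext_hom_q by (simp add: XSub_sel)
    show "bij_base (X, (q, \<lambda>c\<in>C. c), push_ext)" by (auto simp: bij_base_def bij_betw_def inj_on_def)
  qed (simp_all add: XSub_sel DSub_sel induced_push starA_q V w(1))
qed

lemma opcartesian_class_DSub:
  assumes M: "monoid M" and V: "can_semimodule M V"
  shows "opcartesian_class (XSub com M) (DSub com M) M V product_ext pj1 pj2 (terminal_ext M) bij_base"
proof (intro opcartesian_class.intro opcartesian_class_axioms.intro XSub_category)
  show "in_hom (can_Smod M) (FAr (DSub com M) f) (FOb (DSub com M) X) (FOb (DSub com M) Y)"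
    if f: "in_hom (XSub com M) f X Y" for f X Y
  proof -
    obtain \<phi> \<psi> where f': "f = (X, (\<phi>, \<psi>), Y)" "crossed_ext X" "crossed_ext Y" "obM X = M" "obM Y = M" "crossed_ext_hom X Y \<phi> \<psi>"
      using f by (auto simp: XSub_hom XSub_Ob)
    then show ?thesis
      using crossed_ext.induced_can_semimodule[OF f'(2)] crossed_ext.induced_can_semimodule[OF f'(3)]
        starA_hom[OF f'(2,3,6)] starA_equivariant[OF f'(2,3,6)]
      by (simp add: in_hom_can_Smod DSub_sel)
  qed
  show "FAr (DSub com M) (g \<cdot>\<^bsub>XSub com M\<^esub> f) = FAr (DSub com M) g \<cdot>\<^bsub>can_Smod M\<^esub> FAr (DSub com M) f"
    if "in_hom (XSub com M) f X Y" "in_hom (XSub com M) g Y Z" for f X Y g Z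
    using that by (auto simp: XSub_hom XSub_Ob DSub_sel XSub_sel can_Smod_sel starA_compose)
  show "FAr (DSub com M) (Idn (XSub com M) X) = Idn (can_Smod M) (FOb (DSub com M) X)"
    if "X \<in> Ob (XSub com M)" for X
    using that by (simp add: XSub_Ob DSub_sel XSub_sel can_Smod_sel starA_id)
  show "bij_base (Idn (XSub com M) X)" for X
    by (auto simp: bij_base_def XSub_sel bij_betw_def inj_on_def)
  show "bij_base (g \<cdot>\<^bsub>XSub com M\<^esub> f)"
    if fg: "in_hom (XSub com M) f X Y" "in_hom (XSub com M) g Y Z" and good: "bij_base f" "bij_base g" for f X Y g Z
  proof -
    obtain \<phi> \<psi> \<phi>' \<psi>' where fg': "f = (X, (\<phi>, \<psi>), Y)" "g = (Y, (\<phi>', \<psi>'), Z)" using fg by (auto simp: XSub_hom)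
    have "bij_betw (\<psi>' \<circ> \<psi>) (carrier (obC X)) (carrier (obC Z))"
      using good by (auto simp: bij_base_def fg' intro: bij_betw_trans)
    also have "bij_betw (\<psi>' \<circ> \<psi>) (carrier (obC X)) (carrier (obC Z)) \<longleftrightarrow>
        bij_betw (compose (carrier (obC X)) \<psi>' \<psi>) (carrier (obC X)) (carrier (obC Z))"
      by (rule bij_betw_cong) (simp add: compose_def)
    finally show ?thesis by (simp add: bij_base_def fg' XSub_sel)
  qed
qed (rule DSub_sel V terminal_ext_terminal[OF M] product_ext_product bij_base_opcartesian bij_base_product bij_base_lift; assumption)+

end

text \<open>An infinite set is equinumerous with its square; this is where infinity of the universe
  enters.\<close>

lemma exists_pairing_bijection:
  assumes "infinite (UNIV :: 'u set)"
  shows "\<exists>pr \<pi>1 \<pi>2 :: 'u \<Rightarrow> _. pairing_bijection pr \<pi>1 \<pi>2"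
proof -
  obtain f :: "'u \<times> 'u \<Rightarrow> 'u" where "bij_betw f (UNIV \<times> UNIV) UNIV"
    using card_of_Times_same_infinite[OF assms] unfolding card_of_ordIso[symmetric] by blast
  then have "bij f" by simp
  then have "pairing_bijection (\<lambda>x y. f (x, y)) (\<lambda>z. fst (inv_into UNIV f z)) (\<lambda>z. snd (inv_into UNIV f z))"
    by unfold_locales (simp_all add: bij_is_inj bij_is_surj surj_f_inv_f)
  then show ?thesis by blast
qed

theorem corollary5p7:
  fixes M A :: "'u monoid" and \<eta> :: "'u \<Rightarrow> 'u \<Rightarrow> 'u"
  assumes "infinite (UNIV :: 'u set)"
    and "monoid M"
    and "(A, \<eta>) \<in> Ob (can_Smod M)"
  shows "(\<exists>S. symmetric_monoidal_category (fibre (D1 M) (A, \<eta>)) S \<and>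
              natural_structure (D1 M) (A, \<eta>) S) \<and>
         (\<exists>S. symmetric_monoidal_category (fibre (d1 M) (A, \<eta>)) S \<and>
              natural_structure (d1 M) (A, \<eta>) S)"
proof -
  obtain pr \<pi>1 \<pi>2 where "pairing_bijection pr \<pi>1 (\<pi>2 :: 'u \<Rightarrow> 'u)"
    using exists_pairing_bijection[OF assms(1)] by blast
  then interpret pairing_bijection pr \<pi>1 \<pi>2 .
  have "can_semimodule M (A, \<eta>)" using assms(3) by (simp add: can_Smod_sel)
  \<comment> \<open>The flag \<open>False\<close> yields \<open>D1\<close> and \<open>True\<close>
    yields \<open>d1\<close>; the formal argument applies to both.\<close>
  note fib = opcartesian_class_DSub[OF assms(2) this]
  show ?thesis
    using opcartesian_class.symmetric_monoidal_fibre[OF fib[of False]]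
      opcartesian_class.natural_fibre[OF fib[of False]]
      opcartesian_class.symmetric_monoidal_fibre[OF fib[of True]]
      opcartesian_class.natural_fibre[OF fib[of True]]
    unfolding DSub_D1 DSub_d1 by blast
qed

end
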